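(* The parameterized problem MaxLin2-AA[$k$] has a kernel with at most $O(k^2\log k)$ variables; that is, there is a polynomial-time algorithm that maps any instance $(S,k)$ to an instance $(S',k')$ of MaxLin2-AA[$k$] such that $(S,k)$ is a yes-instance if and only if $(S',k')$ is, $k'$ is bounded by a function of $k$, and $S'$ has at most $O(k^2\log k)$ variables.
   Context: An instance of MaxLin2-AA consists of a system $S$ of $m$ equations $\prod_{i\in I_j}x_i=b_j$, $j=1,\dots,m$, in variables $x_1,\dots,x_n$, where $\emptyset\ne I_j\subseteq[n]$ and $x_i,b_j\in\{-1,1\}$; equation $j$ has a positive integral weight $w_j$; and a nonnegative integer $k$ (the parameter). Let $W=\sum_j w_j$ and let $\mathrm{sat}(S)$ be the maximum total weight of equations that can be simultaneously satisfied by an assignment in $\{-1,1\}^n$. The question is whether $\mathrm{sat}(S)\ge W/2+k$. *)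

theory Defs
  imports Complex_Main "HOL-Library.FuncSet" "HOL-Library.Landau_Symbols"
    "HOL-Computational_Algebra.Polynomial"
begin

text \<open>
  The machine model is pure first-order Lisp: call-by-value recursive functions on binary trees.
  Every evaluation step is charged the size of the tree it produces (trees are copied, never
  shared), and at least 1.  Consequently an evaluation of cost \<open>t\<close> has at most \<open>t\<close> steps and touches
  only trees of total size at most \<open>t\<close>, up to a constant factor depending on the program, so it can
  be carried out by a Turing machine in time polynomial in \<open>t\<close>; conversely, a step of a Turing
  machine costs here at most a constant times the length of its tape, represented by two list-like
  trees.  Thus polynomial cost means polynomial time in the usual sense.
\<close>

datatype tree = Leaf | Node tree tree

text \<open>
  \<open>Var i\<close> is the \<open>i\<close>-th entry of the environment (de Bruijn style: \<open>Bind\<close> pushes a new entry 0),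
  \<open>Cond\<close> tests whether a tree is a \<open>Node\<close>, and \<open>Call f es\<close> applies the \<open>f\<close>-th function of the
  program, whose body sees exactly the argument values.
\<close>

datatype exp =
    Var nat
  | Atom
  | Pair exp exp
  | Fst exp
  | Snd exp
  | Cond exp exp exp
  | Bind exp exp
  | Call nat "exp list"

type_synonym program = "exp list"

fun fst_tree :: "tree \<Rightarrow> tree" where
  "fst_tree Leaf = Leaf"
| "fst_tree (Node l r) = l"

fun snd_tree :: "tree \<Rightarrow> tree" where
  "snd_tree Leaf = Leaf"
| "snd_tree (Node l r) = r"

text \<open>
  \<open>eval P env e v t\<close>: with the functions \<open>P\<close>, in environment \<open>env\<close>, the expression \<open>e\<close> terminates with
  value \<open>v\<close> at cost \<open>t\<close>.  Note that \<open>size\<close> counts the inner nodes of a tree.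
\<close>

inductive
  eval :: "program \<Rightarrow> tree list \<Rightarrow> exp \<Rightarrow> tree \<Rightarrow> nat \<Rightarrow> bool" and
  evals :: "program \<Rightarrow> tree list \<Rightarrow> exp list \<Rightarrow> tree list \<Rightarrow> nat \<Rightarrow> bool"
  for P :: program
where
  eval_Var: "i < length env \<Longrightarrow> eval P env (Var i) (env ! i) (1 + size (env ! i))"
| eval_Atom: "eval P env Atom Leaf 1"
| eval_Pair: "eval P env e1 v1 t1 \<Longrightarrow> eval P env e2 v2 t2 \<Longrightarrow>
    eval P env (Pair e1 e2) (Node v1 v2) (t1 + t2 + 1 + size (Node v1 v2))"
| eval_Fst: "eval P env e v t \<Longrightarrow> eval P env (Fst e) (fst_tree v) (t + 1 + size (fst_tree v))"
| eval_Snd: "eval P env e v t \<Longrightarrow> eval P env (Snd e) (snd_tree v) (t + 1 + size (snd_tree v))"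
| eval_Cond_Node: "eval P env e (Node l r) t \<Longrightarrow> eval P env e1 v t1 \<Longrightarrow>
    eval P env (Cond e e1 e2) v (t + t1 + 1 + size v)"
| eval_Cond_Leaf: "eval P env e Leaf t \<Longrightarrow> eval P env e2 v t2 \<Longrightarrow>
    eval P env (Cond e e1 e2) v (t + t2 + 1 + size v)"
| eval_Bind: "eval P env e1 v1 t1 \<Longrightarrow> eval P (v1 # env) e2 v2 t2 \<Longrightarrow>
    eval P env (Bind e1 e2) v2 (t1 + t2 + 1 + size v2)"
| eval_Call: "evals P env es vs ts \<Longrightarrow> f < length P \<Longrightarrow> eval P vs (P ! f) v t \<Longrightarrow>
    eval P env (Call f es) v (ts + t + 1 + size v)"
| evals_Nil: "evals P env [] [] 0"
| evals_Cons: "eval P env e v t \<Longrightarrow> evals P env es vs ts \<Longrightarrow>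
    evals P env (e # es) (v # vs) (t + ts)"

lemma eval_deterministic:
  "eval P env e v t \<Longrightarrow> eval P env e v' t' \<Longrightarrow> v' = v \<and> t' = t"
  "evals P env es vs ts \<Longrightarrow> evals P env es vs' ts' \<Longrightarrow> vs' = vs \<and> ts' = ts"
proof (induction arbitrary: v' t' and vs' ts' rule: eval_evals.inducts)
  case (eval_Pair env e1 v1 t1 e2 v2 t2)
  from eval_Pair.prems show ?case
    by cases (use eval_Pair.IH in blast)
next
  case (eval_Fst env e v t)
  from eval_Fst.prems show ?case by cases (use eval_Fst.IH in blast)
next
  case (eval_Snd env e v t)
  from eval_Snd.prems show ?case by cases (use eval_Snd.IH in blast)
next
  case (eval_Cond_Node env e l r t e1 v t1 e2)
  from eval_Cond_Node.prems show ?case by cases (use eval_Cond_Node.IH in blast)+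
next
  case (eval_Cond_Leaf env e t e2 v t2 e1)
  from eval_Cond_Leaf.prems show ?case by cases (use eval_Cond_Leaf.IH in blast)+
next
  case (eval_Bind env e1 v1 t1 e2 v2 t2)
  from eval_Bind.prems show ?case by cases (use eval_Bind.IH in blast)
next
  case (eval_Call env es vs ts f v t)
  from eval_Call.prems show ?case by cases (use eval_Call.IH in blast)
next
  case (evals_Cons env e v t es vs ts)
  from evals_Cons.prems show ?case by cases (use evals_Cons.IH in blast)
qed (auto elim: eval.cases evals.cases)

definition polytime_computable ::
  "('a \<Rightarrow> tree) \<Rightarrow> ('b \<Rightarrow> tree) \<Rightarrow> 'a set \<Rightarrow> ('a \<Rightarrow> 'b) \<Rightarrow> bool" where
  "polytime_computable enc enc' A f \<longleftrightarrow>
     (\<exists>P e (p :: nat poly). \<forall>x\<in>A. \<exists>t. eval P [enc x] e (enc' (f x)) t \<and> t \<le> poly p (size (enc x)))"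

text \<open>\<open>Equation I b w\<close> stands for $\prod_{i \in I} x_i = b$ with weight \<open>w\<close>.\<close>

datatype equation = Equation (lhs: "nat set") (rhs: int) (weight: nat)

datatype lin_system = LinSystem (num_vars: nat) (equations: "equation list")

type_synonym maxlin_instance = "lin_system \<times> nat"

definition maxlin_instances :: "maxlin_instance set" where
  "maxlin_instances = {(S, k). \<forall>e\<in>set (equations S).
     lhs e \<noteq> {} \<and> lhs e \<subseteq> {1..num_vars S} \<and> rhs e \<in> {-1, 1} \<and> 0 < weight e}"

definition assignments :: "lin_system \<Rightarrow> (nat \<Rightarrow> int) set" where
  "assignments S = {1..num_vars S} \<rightarrow>\<^sub>E {-1, 1}"

definition satisfies :: "(nat \<Rightarrow> int) \<Rightarrow> equation \<Rightarrow> bool" where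
  "satisfies x e \<longleftrightarrow> (\<Prod>i\<in>lhs e. x i) = rhs e"

definition satisfied_weight :: "lin_system \<Rightarrow> (nat \<Rightarrow> int) \<Rightarrow> nat" where
  "satisfied_weight S x = (\<Sum>e\<leftarrow>filter (satisfies x) (equations S). weight e)"

definition total_weight :: "lin_system \<Rightarrow> nat" where
  "total_weight S = (\<Sum>e\<leftarrow>equations S. weight e)"

definition sat :: "lin_system \<Rightarrow> nat" where
  "sat S = Max (satisfied_weight S ` assignments S)"

lemma finite_assignments: "finite (assignments S)"
  unfolding assignments_def by (intro finite_PiE) auto

lemma assignments_nonempty: "assignments S \<noteq> {}"
  unfolding assignments_def by (simp add: PiE_eq_empty_iff)

definition maxlin_yes :: "maxlin_instance set" where
  "maxlin_yes = {(S, k) \<in> maxlin_instances. real (sat S) \<ge> real (total_weight S) / 2 + real k}"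

text \<open>
  A system is given by its number of variables in unary and, for each equation, the 0/1 incidence
  row of its left-hand side, its right-hand side and its weight; weights and the parameter are
  written in binary (least significant bit first).
\<close>

fun enc_list :: "('a \<Rightarrow> tree) \<Rightarrow> 'a list \<Rightarrow> tree" where
  "enc_list f [] = Leaf"
| "enc_list f (x # xs) = Node (f x) (enc_list f xs)"

definition enc_bool :: "bool \<Rightarrow> tree" where
  "enc_bool b = (if b then Node Leaf Leaf else Leaf)"

fun bits :: "nat \<Rightarrow> bool list" where
  "bits n = (if n = 0 then [] else odd n # bits (n div 2))"

declare bits.simps [simp del]

definition enc_nat :: "nat \<Rightarrow> tree" where
  "enc_nat n = enc_list enc_bool (bits n)"

definition enc_equation :: "nat \<Rightarrow> equation \<Rightarrow> tree" where
  "enc_equation n e =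
     Node (enc_list enc_bool (map (\<lambda>i. i \<in> lhs e) [1..<Suc n]))
       (Node (enc_bool (rhs e = 1)) (enc_nat (weight e)))"

definition enc_system :: "lin_system \<Rightarrow> tree" where
  "enc_system S =
     Node (enc_list enc_bool (replicate (num_vars S) True))
       (enc_list (enc_equation (num_vars S)) (equations S))"

definition enc_instance :: "maxlin_instance \<Rightarrow> tree" where
  "enc_instance = (\<lambda>(S, k). Node (enc_system S) (enc_nat k))"

lemma enc_list_eq_iff: "enc_list f xs = enc_list f ys \<longleftrightarrow> map f xs = map f ys"
proof (induction xs arbitrary: ys)
  case Nil
  then show ?case by (cases ys) auto
next
  case (Cons x xs)
  then show ?case by (cases ys) auto
qed

lemma inj_enc_bool: "inj enc_bool"
  by (auto simp: inj_def enc_bool_def split: if_splits)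

lemma bits_inject: "bits m = bits n \<Longrightarrow> m = n"
proof (induction m arbitrary: n rule: bits.induct)
  case (1 m)
  show ?case
  proof (cases "m = 0 \<or> n = 0")
    case True
    with 1(2) show ?thesis by (auto simp: bits.simps[of m] bits.simps[of n] split: if_splits)
  next
    case False
    with 1(2) have *: "odd m = odd n" "bits (m div 2) = bits (n div 2)"
      by (auto simp: bits.simps[of m] bits.simps[of n])
    from 1(1)[OF _ *(2)] False have "m div 2 = n div 2" by simp
    with *(1) show ?thesis by (metis bit_eq_rec)
  qed
qed

lemma enc_nat_inject: "enc_nat m = enc_nat n \<Longrightarrow> m = n"
  by (auto simp: enc_nat_def enc_list_eq_iff inj_map_eq_map[OF inj_enc_bool] intro: bits_inject)

lemma enc_equation_inject:
  assumes "enc_equation n e = enc_equation n e'"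
    and "lhs e \<subseteq> {1..n}" "lhs e' \<subseteq> {1..n}" "rhs e \<in> {-1, 1}" "rhs e' \<in> {-1, 1}"
  shows "e = e'"
proof -
  have "\<forall>i\<in>{1..n}. i \<in> lhs e \<longleftrightarrow> i \<in> lhs e'"
    using assms(1)
    by (auto simp: enc_equation_def enc_list_eq_iff inj_map_eq_map[OF inj_enc_bool] inj_eq[OF inj_enc_bool]
        simp del: upt_Suc)
  then have "lhs e = lhs e'" using assms(2,3) by blast
  moreover have "rhs e = rhs e'"
    using assms(1,4,5) by (auto simp: enc_equation_def enc_bool_def split: if_splits)
  moreover have "weight e = weight e'"
    using assms(1) by (auto simp: enc_equation_def intro: enc_nat_inject)
  ultimately show ?thesis by (simp add: equation.expand)
qed

lemma inj_on_enc_instance: "inj_on enc_instance maxlin_instances"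
proof (rule inj_onI, clarify)
  fix S k S' k'
  assume inst: "(S, k) \<in> maxlin_instances" "(S', k') \<in> maxlin_instances"
    and eq: "enc_instance (S, k) = enc_instance (S', k')"
  from eq have k: "k = k'" by (auto simp: enc_instance_def intro: enc_nat_inject)
  from eq have "replicate (num_vars S) True = replicate (num_vars S') True"
    by (simp add: enc_instance_def enc_system_def enc_list_eq_iff inj_map_eq_map[OF inj_enc_bool]
        del: map_replicate)
  then have n: "num_vars S = num_vars S'" by simp
  from eq n have "map (enc_equation (num_vars S)) (equations S) =
      map (enc_equation (num_vars S)) (equations S')"
    by (simp add: enc_instance_def enc_system_def enc_list_eq_iff)
  moreover have "inj_on (enc_equation (num_vars S)) (set (equations S) \<union> set (equations S'))"
  proof (rule inj_onI)
    fix e e'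
    assume mem: "e \<in> set (equations S) \<union> set (equations S')" "e' \<in> set (equations S) \<union> set (equations S')"
      and eq: "enc_equation (num_vars S) e = enc_equation (num_vars S) e'"
    have valid: "lhs d \<subseteq> {1..num_vars S}" "rhs d \<in> {-1, 1}"
      if "d \<in> set (equations S) \<union> set (equations S')" for d
      using that inst n unfolding maxlin_instances_def by auto
    show "e = e'"
      by (rule enc_equation_inject[OF eq valid(1)[OF mem(1)] valid(1)[OF mem(2)]
            valid(2)[OF mem(1)] valid(2)[OF mem(2)]])
  qed
  ultimately have "equations S = equations S'" by (rule map_inj_on)
  with n k show "S = S' \<and> k = k'" by (simp add: lin_system.expand)
qed

end

theory Submission
  imports Defs
begin

text \<open>
  Let $f(y) = \sum_v c_v \chi_v(y)$ be twice the satisfied weight minus the total weight as a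
  function on $\mathbb{F}_2^n$; the question is whether $\max f \ge 2k$.  Column operations make every
  remaining variable the left-hand side of an equation and preserve the range of \<open>f\<close>; this is the
  kernel unless the number \<open>r\<close> of variables exceeds $64 k^2 \log k$ or so.  In that case a branching
  algorithm runs: if not all of a basis of equations is falsified, one of them is satisfied, which
  raises the mean of \<open>f\<close> by at least 1, so that $(r + 2)^{2k + 1}$ steps suffice.  It is stopped after
  as many steps as there are equations.  If it has not finished by then, there are so few equations
  that the answer is yes: some vector is not a sum of fewer than \<open>2k\<close> left-hand sides, and in a
  shortest representation of it no subsum of two or more terms is a left-hand side.  Hence the mean
  of \<open>f\<close> on the subspace on which the equations of the representation are satisfied is at least \<open>2k\<close>.
\<close>

section \<open>Compositional polynomial time\<close>

text \<open>The step budget has two uses. It keeps the running time polynomial whatever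
  \<open>k\<close> is, and exhausting it bounds the number m of equations: an unfinished search has
  m + 1 <= (r + 2)^(2k + 1). For r > 64 k^2 log k this gives (m + 1)^(2k - 1) < 2^r, which is what
  counting the sums of at most 2k - 1 left-hand sides needs. Two features of the encoding shape the
  algorithm. As \<open>k\<close> is written in binary, the bound 64 k^2 log k may be too long to
  write in unary; it is compared with r only after capping \<open>k\<close> at r. As the output must
  be the encoding of an instance, with weights free of leading zeros, equations with equal left-hand
  sides are never merged, only dropped together when their signed weights cancel; every weight in
  the kernel is a weight of the input.\<close>

lemma poly_nat_mono: "x \<le> y \<Longrightarrow> poly p x \<le> poly p (y :: nat)"
  by (induction p) (auto intro!: add_mono mult_mono)

lemma eval_size: "eval P env e v t \<Longrightarrow> size v \<le> t"
  by (cases rule: eval.cases) auto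

text \<open>Indices count from the front of the environment, so entries appended at the end are
  never seen. An expression written for a single input can thus run under an enclosing
  \<open>Bind\<close>.\<close>

lemma eval_weaken:
  "eval P env e v t \<Longrightarrow> eval P (env @ env') e v t"
  "evals P env es vs ts \<Longrightarrow> evals P (env @ env') es vs ts"
proof (induction rule: eval_evals.inducts)
  case (eval_Var i env)
  then show ?case using eval_evals.eval_Var[of i "env @ env'" P] by (simp add: nth_append)
qed (simp_all only: append_Cons, (blast intro: eval_evals.intros)+)

lemma eval_extend_program:
  "eval P env e v t \<Longrightarrow> eval (P @ Q) env e v t"
  "evals P env es vs ts \<Longrightarrow> evals (P @ Q) env es vs ts"
proof (induction rule: eval_evals.inducts)
  case (eval_Call env es vs ts f v t)
  moreover from this have "(P @ Q) ! f = P ! f" "f < length (P @ Q)" by (simp_all add: nth_append)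
  ultimately show ?case by (metis eval_evals.eval_Call)
qed (blast intro: eval_evals.intros)+

text \<open>Calls refer to absolute positions in the program, so a program placed behind
  \<open>n\<close> other functions has to renumber them.\<close>

primrec shift_calls :: "nat \<Rightarrow> exp \<Rightarrow> exp" where
  "shift_calls n (Var i) = Var i"
| "shift_calls n Atom = Atom"
| "shift_calls n (Pair a b) = Pair (shift_calls n a) (shift_calls n b)"
| "shift_calls n (Fst a) = Fst (shift_calls n a)"
| "shift_calls n (Snd a) = Snd (shift_calls n a)"
| "shift_calls n (Cond a b c) = Cond (shift_calls n a) (shift_calls n b) (shift_calls n c)"
| "shift_calls n (Bind a b) = Bind (shift_calls n a) (shift_calls n b)"
| "shift_calls n (Call f es) = Call (n + f) (map (shift_calls n) es)"

lemma eval_shift_calls: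
  "eval P env e v t \<Longrightarrow>
     eval (Q @ map (shift_calls (length Q)) P) env (shift_calls (length Q) e) v t"
  "evals P env es vs ts \<Longrightarrow>
     evals (Q @ map (shift_calls (length Q)) P) env (map (shift_calls (length Q)) es) vs ts"
proof (induction rule: eval_evals.inducts)
  case (eval_Call env es vs ts f v t)
  moreover from this have
    "(Q @ map (shift_calls (length Q)) P) ! (length Q + f) = shift_calls (length Q) (P ! f)"
    "length Q + f < length (Q @ map (shift_calls (length Q)) P)"
    by (simp_all add: nth_append)
  ultimately show ?case unfolding shift_calls.simps by (metis eval_evals.eval_Call)
qed (simp_all only: shift_calls.simps list.map, (blast intro: eval_evals.intros)+)

section \<open>Upper bounds on evaluation cost\<close>

definition runs :: "program \<Rightarrow> tree list \<Rightarrow> exp \<Rightarrow> tree \<Rightarrow> nat \<Rightarrow> bool" where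
  "runs P env e v T \<longleftrightarrow> (\<exists>t\<le>T. eval P env e v t)"

lemma runs_mono: "runs P env e v T \<Longrightarrow> T \<le> T' \<Longrightarrow> runs P env e v T'"
  unfolding runs_def using le_trans by blast

lemma runs_Var: "i < length env \<Longrightarrow> runs P env (Var i) (env ! i) (1 + size (env ! i))"
  unfolding runs_def by (blast intro: eval_Var)

lemma runs_Atom: "runs P env Atom Leaf 1"
  unfolding runs_def by (blast intro: eval_Atom)

lemma runs_Pair:
  "runs P env e1 v1 t1 \<Longrightarrow> runs P env e2 v2 t2 \<Longrightarrow>
    runs P env (Pair e1 e2) (Node v1 v2) (t1 + t2 + 1 + size (Node v1 v2))"
  unfolding runs_def by (meson eval_Pair add_le_mono le_refl)

lemma runs_Fst:
  "runs P env e v t \<Longrightarrow> runs P env (Fst e) (fst_tree v) (t + 1 + size (fst_tree v))"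
  unfolding runs_def by (meson eval_Fst add_le_mono le_refl)

lemma runs_Snd:
  "runs P env e v t \<Longrightarrow> runs P env (Snd e) (snd_tree v) (t + 1 + size (snd_tree v))"
  unfolding runs_def by (meson eval_Snd add_le_mono le_refl)

lemma runs_Cond_Node:
  "runs P env e (Node l r) t \<Longrightarrow> runs P env e1 v t1 \<Longrightarrow>
    runs P env (Cond e e1 e2) v (t + t1 + 1 + size v)"
  unfolding runs_def by (meson eval_Cond_Node add_le_mono le_refl)

lemma runs_Cond_Leaf:
  "runs P env e Leaf t \<Longrightarrow> runs P env e2 v t2 \<Longrightarrow>
    runs P env (Cond e e1 e2) v (t + t2 + 1 + size v)"
  unfolding runs_def by (meson eval_Cond_Leaf add_le_mono le_refl)

lemma runs_Bind:
  "runs P env e1 v1 t1 \<Longrightarrow> runs P (v1 # env) e2 v2 t2 \<Longrightarrow>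
    runs P env (Bind e1 e2) v2 (t1 + t2 + 1 + size v2)"
  unfolding runs_def by (meson eval_Bind add_le_mono le_refl)

text \<open>Three arguments suffice: the recursive function of a loop takes the context, the
  remaining list and the accumulator.\<close>

lemma runs_Call3:
  assumes "runs P env e1 v1 t1" "runs P env e2 v2 t2" "runs P env e3 v3 t3"
    and "f < length P" "runs P [v1, v2, v3] (P ! f) v t"
  shows "runs P env (Call f [e1, e2, e3]) v (t1 + t2 + t3 + t + 1 + size v)"
proof -
  obtain t1' t2' t3' t' where *: "t1' \<le> t1" "eval P env e1 v1 t1'" "t2' \<le> t2" "eval P env e2 v2 t2'"
    "t3' \<le> t3" "eval P env e3 v3 t3'" "t' \<le> t" "eval P [v1, v2, v3] (P ! f) v t'"
    using assms unfolding runs_def by blast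
  have "evals P env [e1, e2, e3] [v1, v2, v3] (t1' + (t2' + (t3' + 0)))"
    using * by (intro evals_Cons evals_Nil)
  from eval_Call[OF this assms(4) *(8)] show ?thesis
    unfolding runs_def using * by (intro exI[of _ "_ + t' + 1 + size v"]) auto
qed

lemma runs_size: "runs P env e v T \<Longrightarrow> size v \<le> T"
  unfolding runs_def using eval_size le_trans by blast

lemma runs_weaken: "runs P [x] e v T \<Longrightarrow> runs P (x # env) e v T"
  unfolding runs_def using eval_weaken(1)[of P "[x]"] by auto

lemma runs_extend_program: "runs P env e v T \<Longrightarrow> runs (P @ Q) env e v T"
  unfolding runs_def using eval_extend_program by blast

lemma runs_shift_calls:
  "runs P env e v T \<Longrightarrow>
    runs (Q @ map (shift_calls (length Q)) P) env (shift_calls (length Q) e) v T"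
  unfolding runs_def using eval_shift_calls by blast

section \<open>Encodable types and polynomial-time functions\<close>

class encodable =
  fixes enc :: "'a \<Rightarrow> tree"

instantiation bool :: encodable
begin
definition enc_bool_class [simp]: "enc = enc_bool"
instance ..
end

instantiation list :: (encodable) encodable
begin
definition enc_list_class [simp]: "enc = enc_list enc"
instance ..
end

instantiation prod :: (encodable, encodable) encodable
begin
definition enc_prod_class [simp]: "enc x = Node (enc (fst x)) (enc (snd x))"
instance ..
end

abbreviation len :: "'a::encodable \<Rightarrow> nat" where
  "len x \<equiv> size (enc x)"

lemma length_le_len: "length xs \<le> len xs"
  by (induction xs) auto

text \<open>The bound ranges over the whole type, including values that encode no instance. No
  domain has to be carried through compositions, but ragged rows and other junk must obey the same
  bound.\<close>

definition poly_time :: "('a::encodable \<Rightarrow> 'b::encodable) \<Rightarrow> bool" where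
  "poly_time f \<longleftrightarrow> (\<exists>P e (p :: nat poly). \<forall>x. runs P [enc x] e (enc (f x)) (poly p (len x)))"

lemma polytime_computable_iff_poly_time: "polytime_computable enc enc UNIV f \<longleftrightarrow> poly_time f"
  unfolding polytime_computable_def poly_time_def runs_def by blast

definition pbounded :: "('a::encodable \<Rightarrow> nat) \<Rightarrow> bool" where
  "pbounded f \<longleftrightarrow> (\<exists>p :: nat poly. \<forall>x. f x \<le> poly p (len x))"

lemma pbounded_mono: "pbounded g \<Longrightarrow> (\<And>x. f x \<le> g x) \<Longrightarrow> pbounded f"
  unfolding pbounded_def using le_trans by blast

lemma pbounded_const: "pbounded (\<lambda>_. c)"
  unfolding pbounded_def by (intro exI[of _ "[:c:]"]) simp

lemma pbounded_len_id: "pbounded len"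
  unfolding pbounded_def by (intro exI[of _ "[:0, 1:]"]) simp

lemma pbounded_add: "pbounded f \<Longrightarrow> pbounded g \<Longrightarrow> pbounded (\<lambda>x. f x + g x)"
  unfolding pbounded_def by (metis poly_add add_mono)

lemma pbounded_mult: "pbounded f \<Longrightarrow> pbounded g \<Longrightarrow> pbounded (\<lambda>x. f x * g x)"
  unfolding pbounded_def by (metis poly_mult mult_le_mono)

lemma pbounded_poly: "pbounded f \<Longrightarrow> pbounded (\<lambda>x. poly p (f x))"
proof -
  assume "pbounded f"
  then obtain q where q: "\<And>x. f x \<le> poly q (len x)" unfolding pbounded_def by blast
  then have "\<And>x. poly p (f x) \<le> poly (pcompose p q) (len x)"
    by (simp add: poly_pcompose poly_nat_mono)
  then show ?thesis unfolding pbounded_def by blast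
qed

lemma poly_timeI:
  assumes "pbounded T" "\<And>x. runs P [enc x] e (enc (f x)) (T x)"
  shows "poly_time f"
  using assms unfolding pbounded_def poly_time_def by (meson runs_mono)

lemma pbounded_len:
  assumes "poly_time f"
  shows "pbounded (\<lambda>x. len (f x))"
  using assms unfolding pbounded_def poly_time_def using runs_size by blast

text \<open>Each function comes with its own program; a combination needs one program for both, so
  the second is appended with its calls shifted.\<close>

lemma poly_time_common2:
  assumes "poly_time f" "poly_time g"
  obtains P ef p eg q where
    "\<And>x. runs P [enc x] ef (enc (f x)) (poly p (len x))"
    "\<And>x. runs P [enc x] eg (enc (g x)) (poly q (len x))"
proof -
  obtain P ef p where f: "\<And>x. runs P [enc x] ef (enc (f x)) (poly p (len x))"
    using assms(1) unfolding poly_time_def by blast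
  obtain Q eg q where g: "\<And>x. runs Q [enc x] eg (enc (g x)) (poly q (len x))"
    using assms(2) unfolding poly_time_def by blast
  show ?thesis
    using that[of "P @ map (shift_calls (length P)) Q" ef p "shift_calls (length P) eg" q]
      runs_extend_program[OF f] runs_shift_calls[OF g] by blast
qed

lemma poly_time_common3:
  assumes "poly_time f" "poly_time g" "poly_time h"
  obtains P ef p eg q eh r where
    "\<And>x. runs P [enc x] ef (enc (f x)) (poly p (len x))"
    "\<And>x. runs P [enc x] eg (enc (g x)) (poly q (len x))"
    "\<And>x. runs P [enc x] eh (enc (h x)) (poly r (len x))"
proof -
  obtain P ef p eg q where fg: "\<And>x. runs P [enc x] ef (enc (f x)) (poly p (len x))"
    "\<And>x. runs P [enc x] eg (enc (g x)) (poly q (len x))"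
    using poly_time_common2[OF assms(1,2)] by blast
  obtain Q eh r where h: "\<And>x. runs Q [enc x] eh (enc (h x)) (poly r (len x))"
    using assms(3) unfolding poly_time_def by blast
  show ?thesis
    using that[of "P @ map (shift_calls (length P)) Q" ef p eg q "shift_calls (length P) eh" r]
      runs_extend_program[OF fg(1)] runs_extend_program[OF fg(2)] runs_shift_calls[OF h] by blast
qed

section \<open>Closure under composition, branching and loops\<close>

lemma poly_time_id: "poly_time (\<lambda>x. x)"
proof (rule poly_timeI)
  show "pbounded (\<lambda>x :: 'a. 1 + len x)" by (intro pbounded_add pbounded_const pbounded_len_id)
  show "runs [] [enc x] (Var 0) (enc x) (1 + len x)" for x :: 'a
    using runs_Var[of 0 "[enc x]"] by simp
qed

primrec quote :: "tree \<Rightarrow> exp" where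
  "quote Leaf = Atom"
| "quote (Node l r) = Pair (quote l) (quote r)"

lemma runs_quote: "\<exists>T. \<forall>P env. runs P env (quote v) v T"
proof (induction v)
  case Leaf
  then show ?case using runs_Atom by auto
next
  case (Node l r)
  then show ?case using runs_Pair unfolding quote.simps by blast
qed

lemma poly_time_const: "poly_time (\<lambda>_. c)"
proof -
  obtain T where "\<And>P env. runs P env (quote (enc c)) (enc c) T" using runs_quote by blast
  then show ?thesis by (intro poly_timeI[OF pbounded_const])
qed

lemma poly_time_comp:
  assumes "poly_time g" "poly_time f"
  shows "poly_time (\<lambda>x. g (f x))"
proof -
  obtain P ef p eg q where *: "\<And>x. runs P [enc x] ef (enc (f x)) (poly p (len x))"
    "\<And>x. runs P [enc x] eg (enc (g x)) (poly q (len x))"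
    using poly_time_common2[OF assms(2,1)] by blast
  show ?thesis
  proof (rule poly_timeI)
    show "pbounded (\<lambda>x. poly p (len x) + poly q (len (f x)) + 1 + poly q (len (f x)))"
      by (intro pbounded_add pbounded_poly pbounded_len pbounded_len_id pbounded_const assms)
    show "runs P [enc x] (Bind ef eg) (enc (g (f x)))
        (poly p (len x) + poly q (len (f x)) + 1 + poly q (len (f x)))" for x
      by (rule runs_mono[OF runs_Bind[OF *(1) runs_weaken[OF *(2)]]])
        (use runs_size[OF *(2)] in simp)
  qed
qed

lemma poly_time_Node:
  assumes "poly_time f" "poly_time g" "\<And>x. enc (h x) = Node (enc (f x)) (enc (g x))"
  shows "poly_time h"
proof -
  obtain P ef p eg q where *: "\<And>x. runs P [enc x] ef (enc (f x)) (poly p (len x))"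
    "\<And>x. runs P [enc x] eg (enc (g x)) (poly q (len x))"
    using poly_time_common2[OF assms(1,2)] by blast
  show ?thesis
  proof (rule poly_timeI)
    show "pbounded (\<lambda>x. poly p (len x) + poly q (len x) + 1 + (len (f x) + len (g x) + 1))"
      by (intro pbounded_add pbounded_poly pbounded_len pbounded_len_id pbounded_const assms)
    show "runs P [enc x] (Pair ef eg) (enc (h x))
        (poly p (len x) + poly q (len x) + 1 + (len (f x) + len (g x) + 1))" for x
      unfolding assms(3) by (rule runs_mono[OF runs_Pair[OF *]]) simp
  qed
qed

lemma poly_time_Pair: "poly_time f \<Longrightarrow> poly_time g \<Longrightarrow> poly_time (\<lambda>x. (f x, g x))"
  by (rule poly_time_Node[of f g]) auto

lemma poly_time_Cons: "poly_time f \<Longrightarrow> poly_time g \<Longrightarrow> poly_time (\<lambda>x. f x # g x)"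
  by (rule poly_time_Node[of f g]) auto

lemma poly_time_fst_tree:
  assumes "poly_time f" "\<And>x. enc (h x) = fst_tree (enc (f x))"
  shows "poly_time h"
proof -
  obtain P ef p where *: "\<And>x. runs P [enc x] ef (enc (f x)) (poly p (len x))"
    using assms(1) unfolding poly_time_def by blast
  show ?thesis
  proof (rule poly_timeI)
    show "pbounded (\<lambda>x. poly p (len x) + 1 + len (f x))"
      by (intro pbounded_add pbounded_poly pbounded_len pbounded_len_id pbounded_const assms)
    show "runs P [enc x] (Fst ef) (enc (h x)) (poly p (len x) + 1 + len (f x))" for x
      unfolding assms(2) by (rule runs_mono[OF runs_Fst[OF *]]) (cases "enc (f x)", simp_all)
  qed
qed

lemma poly_time_snd_tree:
  assumes "poly_time f" "\<And>x. enc (h x) = snd_tree (enc (f x))"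
  shows "poly_time h"
proof -
  obtain P ef p where *: "\<And>x. runs P [enc x] ef (enc (f x)) (poly p (len x))"
    using assms(1) unfolding poly_time_def by blast
  show ?thesis
  proof (rule poly_timeI)
    show "pbounded (\<lambda>x. poly p (len x) + 1 + len (f x))"
      by (intro pbounded_add pbounded_poly pbounded_len pbounded_len_id pbounded_const assms)
    show "runs P [enc x] (Snd ef) (enc (h x)) (poly p (len x) + 1 + len (f x))" for x
      unfolding assms(2) by (rule runs_mono[OF runs_Snd[OF *]]) (cases "enc (f x)", simp_all)
  qed
qed

lemma poly_time_fst: "poly_time f \<Longrightarrow> poly_time (\<lambda>x. fst (f x))"
  by (erule poly_time_fst_tree) simp

lemma poly_time_snd: "poly_time f \<Longrightarrow> poly_time (\<lambda>x. snd (f x))"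
  by (erule poly_time_snd_tree) simp

lemma poly_time_tl: "poly_time f \<Longrightarrow> poly_time (\<lambda>x. tl (f x))"
proof (erule poly_time_snd_tree)
  show "enc (tl (f x)) = snd_tree (enc (f x))" for x by (cases "f x") auto
qed

text \<open>The only test of the model is the one for \<open>Leaf\<close>, which encodes both
  \<open>False\<close> and \<open>[]\<close>; hence a common rule for both uses.\<close>

lemma poly_time_Cond:
  assumes "poly_time f" "poly_time g" "poly_time h"
    and "\<And>x. k x = (if enc (f x) = Leaf then h x else g x)"
  shows "poly_time k"
proof -
  obtain P ef p eg q eh r where *: "\<And>x. runs P [enc x] ef (enc (f x)) (poly p (len x))"
    "\<And>x. runs P [enc x] eg (enc (g x)) (poly q (len x))"
    "\<And>x. runs P [enc x] eh (enc (h x)) (poly r (len x))"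
    using poly_time_common3[OF assms(1-3)] by blast
  show ?thesis
  proof (rule poly_timeI)
    let ?T = "\<lambda>x. poly p (len x) + (poly q (len x) + poly r (len x)) + 1 + (len (g x) + len (h x))"
    show "pbounded ?T"
      by (intro pbounded_add pbounded_poly pbounded_len pbounded_len_id pbounded_const assms)
    show "runs P [enc x] (Cond ef eg eh) (enc (k x)) (?T x)" for x
    proof (cases "enc (f x)")
      case Leaf
      have "runs P [enc x] (Cond ef eg eh) (enc (h x)) (poly p (len x) + poly r (len x) + 1 + len
        (h x))"
        using runs_Cond_Leaf[OF _ *(3)] *(1)[of x] Leaf by metis
      then show ?thesis using Leaf assms(4) by (auto elim: runs_mono)
    next
      case (Node a b)
      have "runs P [enc x] (Cond ef eg eh) (enc (g x)) (poly p (len x) + poly q (len x) + 1 + len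
        (g x))"
        using runs_Cond_Node[OF _ *(2)] *(1)[of x] Node by metis
      then show ?thesis using Node assms(4) by (auto elim: runs_mono)
    qed
  qed
qed

lemma poly_time_If:
  assumes "poly_time f" "poly_time g" "poly_time h"
  shows "poly_time (\<lambda>x. if f x then g x else h x)"
  by (rule poly_time_Cond[OF assms]) (auto simp: enc_bool_def)

lemma poly_time_case_list:
  assumes "poly_time f" "poly_time g" "poly_time (\<lambda>z. h (fst z) (fst (snd z)) (snd (snd z)))"
  shows "poly_time (\<lambda>x. case f x of [] \<Rightarrow> g x | a # as \<Rightarrow> h x a as)"
proof -
  obtain P ef p eg q eh r where run: "\<And>x. runs P [enc x] ef (enc (f x)) (poly p (len x))"
    "\<And>x. runs P [enc x] eg (enc (g x)) (poly q (len x))"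
    "\<And>z. runs P [enc z] eh (enc (h (fst z) (fst (snd z)) (snd (snd z)))) (poly r (len z))"
    using poly_time_common3[OF assms] by blast
  show ?thesis
  proof (rule poly_timeI)
    \<comment> \<open>\<open>a # as\<close> and \<open>(a, as)\<close> have the same encoding, so
      pairing the input with the value of \<open>ef\<close> yields the encoding of
      \<open>(x, (a, as))\<close>. \<open>ef\<close> is evaluated twice, because the tested value is
      not bound.\<close>
    let ?e = "Cond ef (Bind (Pair (Var 0) ef) eh) eg"
    let ?U = "\<lambda>x. poly r (len x + len (f x) + 1)"
    let ?T = "\<lambda>x. poly p (len x) + (2 * ?U x + 4 + poly p (len x) + 2 * len x +
        len (f x) + poly q (len x)) + 1 + (?U x + len (g x))"
    show "pbounded ?T"
      by (intro pbounded_add pbounded_mult pbounded_poly pbounded_len pbounded_len_id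
          pbounded_const assms)
    show "runs P [enc x] ?e (enc (case f x of [] \<Rightarrow> g x | a # as \<Rightarrow> h x a as)) (?T x)" for x
    proof (cases "f x")
      case Nil
      have "runs P [enc x] ?e (enc (g x)) (poly p (len x) + poly q (len x) + 1 + len (g x))"
        using runs_Cond_Leaf[OF _ run(2)] run(1)[of x] Nil by fastforce
      then show ?thesis using Nil by (auto elim: runs_mono)
    next
      case (Cons a as)
      have h: "runs P [enc (x, (a, as))] eh (enc (h x a as)) (?U x)"
        using run(3)[of "(x, (a, as))"] Cons by (simp add: algebra_simps)
      have "runs P [enc x] (Pair (Var 0) ef) (enc (x, (a, as)))
          ((1 + len x) + poly p (len x) + 1 + (len x + len (f x) + 1))"
        using runs_Pair[OF runs_Var[of 0 "[enc x]" P] run(1)[of x]] Cons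
        by (auto simp: algebra_simps)
      from runs_Bind[OF this runs_weaken[OF h]]
      have "runs P [enc x] (Bind (Pair (Var 0) ef) eh) (enc (h x a as))
          (2 * ?U x + 4 + poly p (len x) + 2 * len x + len (f x))"
        by (rule runs_mono) (use runs_size[OF h] in simp)
      from runs_Cond_Node[OF _ this] run(1)[of x] Cons
      have "runs P [enc x] ?e (enc (h x a as)) (poly p (len x) +
           (2 * ?U x + 4 + poly p (len x) + 2 * len x + len (f x)) + 1 + len (h x a as))"
        by fastforce
      then have "runs P [enc x] ?e (enc (h x a as)) (?T x)"
        by (rule runs_mono) (use runs_size[OF h] in linarith)
      then show ?thesis using Cons by simp
    qed
  qed
qed

text \<open>The loop is the tail-recursive function \<open>body\<close>, which sits behind
  \<open>Ps\<close> and calls itself by the index \<open>length Ps\<close>. A round costs at most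
  \<open>20 * B + 20\<close> for copying trees of size at most \<open>B\<close>, plus the step on an
  argument of size at most \<open>3 * B + 2\<close>. The bound on the accumulators of all prefixes
  passes on to the tail with the updated accumulator.\<close>

lemma runs_loop:
  fixes c :: "'c::encodable" and xs :: "'a::encodable list" and b :: "'b::encodable"
  assumes step: "\<And>z. runs Ps [enc z] es (enc (step (fst z) (fst (snd z)) (snd (snd z)))) (poly p
    (len z))"
    and body: "body = Cond (Var 1) (Call (length Ps) [Var 0, Snd (Var 1),
      Bind (Pair (Var 0) (Pair (Var 2) (Fst (Var 1)))) es]) (Var 2)"
    and "len c \<le> B" "len xs \<le> B" "\<And>i. len (foldl (step c) b (take i xs)) \<le> B"
  shows "runs (Ps @ [body]) [enc c, enc xs, enc b] body (enc (foldl (step c) b xs))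
    ((length xs + 1) * (20 * B + 20 + poly p (3 * B + 2)))"
  using assms(3-)
proof (induction xs arbitrary: b)
  case Nil
  let ?P = "Ps @ [body]"
  have V: "runs ?P [enc c, Leaf, enc b] (Var 1) Leaf 1"
    "runs ?P [enc c, Leaf, enc b] (Var 2) (enc b) (1 + len b)"
    using runs_Var[of 1 "[enc c, Leaf, enc b]" ?P] runs_Var[of 2 "[enc c, Leaf, enc b]" ?P] by
      simp_all
  have "runs ?P [enc c, enc ([] :: 'a list), enc b] body (enc b) (1 + (1 + len b) + 1 + len b)"
    using runs_Cond_Leaf[OF V] unfolding body by simp
  then have "runs ?P [enc c, enc ([] :: 'a list), enc b] body (enc b)
     (20 * B + 20 + poly p (3 * B + 2))"
    by (rule runs_mono) (use Nil(3)[of 0] in simp)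
  then show ?case by simp
next
  case (Cons a xs)
  let ?P = "Ps @ [body]" and ?env = "[enc c, enc (a # xs), enc b]" and ?r = "foldl (step c) b (a #
    xs)"
  let ?q = "poly p (3 * B + 2)"
  have b: "len b \<le> B" using Cons.prems(3)[of 0] by simp
  have a: "len a \<le> B" using Cons.prems(2) by simp
  have r: "len ?r \<le> B" using Cons.prems(3)[of "length (a # xs)"] by (simp del: foldl_Cons)
  have v: "len (step c b a) \<le> B" using Cons.prems(3)[of 1] by simp
  have IH: "runs ?P [enc c, enc xs, enc (step c b a)] body (enc ?r)
     ((length xs + 1) * (20 * B + 20 + ?q))"
    using Cons.IH[of "step c b a"] Cons.prems(1,2) Cons.prems(3)[of "Suc _"] by simp
  have "runs ?P [enc (c, (b, a))] es (enc (step c b a)) ?q"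
    by (rule runs_mono[OF runs_extend_program[OF step[of "(c, (b, a))", simplified fst_conv
      snd_conv]]])
      (use a b Cons.prems(1) in \<open>auto intro!: poly_nat_mono\<close>)
  then have "runs ?P [Node (enc c) (Node (enc b) (enc a))] es (enc (step c b a)) ?q" by simp
  note es = runs_weaken[OF this, of ?env]
  have V: "runs ?P ?env (Var 0) (enc c) (1 + len c)"
    "runs ?P ?env (Var 1) (Node (enc a) (enc xs)) (1 + len (a # xs))"
    "runs ?P ?env (Var 2) (enc b) (1 + len b)"
    using runs_Var[of 0 ?env ?P] runs_Var[of 1 ?env ?P] runs_Var[of 2 ?env ?P] by simp_all
  note F = runs_Fst[OF V(2), unfolded fst_tree.simps] and S = runs_Snd[OF V(2), unfolded
    snd_tree.simps]
  have P: "?P ! length Ps = body" by simp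
  note call = runs_Call3[OF V(1) S runs_Bind[OF runs_Pair[OF V(1) runs_Pair[OF V(3) F]] es], of
    "length Ps",
      unfolded P, OF _ IH]
  show ?case
    by (subst (2) body, rule runs_mono[OF runs_Cond_Node[OF V(2) call]])
      (use a b r v Cons.prems(1,2) in \<open>simp_all add: algebra_simps\<close>)
qed

text \<open>
  Without the polynomial bound on the accumulators the running time could be exponential.
\<close>

lemma poly_time_foldl:
  assumes xs: "poly_time xs" and init: "poly_time init"
    and step: "poly_time (\<lambda>z. step (fst z) (fst (snd z)) (snd (snd z)))"
    and B: "pbounded B" "\<And>x i. len (foldl (step x) (init x) (take i (xs x))) \<le> B x"
  shows "poly_time (\<lambda>x. foldl (step x) (init x) (xs x))"
proof -
  obtain Ps ex p ei q es r where run: "\<And>x. runs Ps [enc x] ex (enc (xs x)) (poly p (len x))"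
    "\<And>x. runs Ps [enc x] ei (enc (init x)) (poly q (len x))"
    "\<And>z. runs Ps [enc z] es (enc (step (fst z) (fst (snd z)) (snd (snd z)))) (poly r (len z))"
    using poly_time_common3[OF xs init step] by blast
  define body where "body = Cond (Var 1) (Call (length Ps) [Var 0, Snd (Var 1),
      Bind (Pair (Var 0) (Pair (Var 2) (Fst (Var 1)))) es]) (Var 2)"
  let ?P = "Ps @ [body]"
  let ?M = "\<lambda>x. len x + len (xs x) + B x"
  let ?L = "\<lambda>x. (len (xs x) + 1) * (20 * ?M x + 20 + poly r (3 * ?M x + 2))"
  let ?T = "\<lambda>x. (1 + len x) + poly p (len x) + poly q (len x) + ?L x + 1 + B x"
  show ?thesis
  proof (rule poly_timeI)
    show "pbounded ?T"
      by (intro pbounded_add pbounded_mult pbounded_poly pbounded_len pbounded_len_id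
          pbounded_const xs B)
    show "runs ?P [enc x] (Call (length Ps) [Var 0, ex, ei]) (enc (foldl (step x) (init x) (xs
      x))) (?T x)"
      for x
    proof -
      have "runs ?P [enc x, enc (xs x), enc (init x)] body (enc (foldl (step x) (init x) (xs x)))
         ((length (xs x) + 1) * (20 * ?M x + 20 + poly r (3 * ?M x + 2)))"
        by (rule runs_loop[OF run(3) body_def]) (auto intro: order_trans[OF B(2)])
      then have loop: "runs ?P [enc x, enc (xs x), enc (init x)] (?P ! length Ps)
          (enc (foldl (step x) (init x) (xs x))) (?L x)"
        unfolding nth_append_length by (rule runs_mono) (use length_le_len[of "xs x"] in simp)
      have V: "runs ?P [enc x] (Var 0) (enc x) (1 + len x)"
        using runs_Var[of 0 "[enc x]"] by simp
      have "len (foldl (step x) (init x) (xs x)) \<le> B x"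
        using B(2)[of x "length (xs x)"] by simp
      moreover have "runs ?P [enc x] (Call (length Ps) [Var 0, ex, ei])
          (enc (foldl (step x) (init x) (xs x)))
          ((1 + len x) + poly p (len x) + poly q (len x) + ?L x + 1 + len (foldl (step x) (init x)
            (xs x)))"
        by (rule runs_Call3[OF V runs_extend_program[OF run(1)]
              runs_extend_program[OF run(2)] _ loop]) simp
      ultimately show ?thesis by (simp add: runs_mono)
    qed
  qed
qed

section \<open>Polynomial-time list functions\<close>

lemma len_list: "len xs = (\<Sum>x\<leftarrow>xs. len x + 1)"
  by (induction xs) auto

lemma len_append: "len (xs @ ys) = len xs + len ys"
  by (simp add: len_list del: enc_list_class)

lemma len_rev: "len (rev xs) = len xs"
  unfolding len_list by (metis rev_map sum_list_rev)

lemma len_take_le: "len (take i xs) \<le> len xs"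
  by (metis append_take_drop_id len_append le_add1)

lemma len_drop_le: "len (drop i xs) \<le> len xs"
  by (metis append_take_drop_id len_append le_add2)

lemma len_filter_le: "len (filter P xs) \<le> len xs"
  by (induction xs) auto

lemma len_mem_le: "x \<in> set xs \<Longrightarrow> len x \<le> len xs"
  by (induction xs) auto

lemma len_zip_le: "len (zip xs ys) \<le> len xs + len ys"
proof (induction xs arbitrary: ys)
  case (Cons x xs)
  show ?case
    by (cases ys) (use Cons.IH in \<open>auto intro!: le_SucI simp: algebra_simps\<close>)
qed simp

lemma len_bool_le: "len (b :: bool) \<le> 1"
  by (auto simp: enc_bool_def)

lemma len_bool_list_le: "len (bs :: bool list) \<le> 2 * length bs"
proof (induction bs)
  case (Cons b bs)
  then show ?case using len_bool_le[of b] by simp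
qed simp

lemma poly_time_rev:
  assumes "poly_time f"
  shows "poly_time (\<lambda>x. rev (f x))"
proof -
  have fold: "foldl (\<lambda>b a. a # b) [] xs = rev xs" for xs :: "'b list"
    by (induction xs rule: rev_induct) auto
  have "poly_time (\<lambda>x. foldl (\<lambda>b a. a # b) [] (f x))"
    by (rule poly_time_foldl[OF assms poly_time_const _ pbounded_len[OF assms]])
      (auto simp: fold len_rev len_take_le simp del: enc_list_class
        intro!: poly_time_Cons poly_time_fst poly_time_snd poly_time_id)
  then show ?thesis by (simp add: fold)
qed

lemma poly_time_append:
  assumes "poly_time f" "poly_time g"
  shows "poly_time (\<lambda>x. f x @ g x)"
proof -
  have fold: "foldl (\<lambda>b a. a # b) ys xs = rev xs @ ys" for xs ys :: "'b list"
    by (induction xs rule: rev_induct) auto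
  have "poly_time (\<lambda>x. foldl (\<lambda>b a. a # b) (g x) (rev (f x)))"
  proof (rule poly_time_foldl[OF poly_time_rev[OF assms(1)] assms(2)])
    show "pbounded (\<lambda>x. len (f x) + len (g x))"
      by (intro pbounded_add pbounded_len assms)
    show "len (foldl (\<lambda>b a. a # b) (g x) (take i (rev (f x)))) \<le> len (f x) + len (g x)" for x i
      using len_take_le[of i "rev (f x)"]
      by (simp add: fold len_rev len_append del: enc_list_class)
  qed (intro poly_time_Cons poly_time_fst poly_time_snd poly_time_id)
  then show ?thesis by (simp add: fold)
qed

lemma poly_time_map:
  assumes f: "poly_time (\<lambda>z. f (fst z) (snd z))" and xs: "poly_time xs"
  shows "poly_time (\<lambda>x. map (f x) (xs x))"
proof -
  have fold: "foldl (\<lambda>b a. f x a # b) [] ys = rev (map (f x) ys)" for x ys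
    by (induction ys rule: rev_induct) auto
  obtain p :: "nat poly" where p: "\<And>x a. len (f x a) \<le> poly p (len (x, a))"
    using pbounded_len[OF f] unfolding pbounded_def by (metis fst_conv snd_conv)
  have "poly_time (\<lambda>x. foldl (\<lambda>b a. f x a # b) [] (xs x))"
  proof (rule poly_time_foldl[OF xs poly_time_const])
    \<comment> \<open>An element is no larger than its list, so every image is bounded in terms of
      \<open>x\<close> and \<open>xs x\<close>. The inner 1 is the node of the pair, the outer 1
      that of the list.\<close>
    let ?B = "\<lambda>x. poly p (len x + len (xs x) + 1) + 1"
    show "pbounded (\<lambda>x. len (xs x) * ?B x)"
      by (intro pbounded_add pbounded_mult pbounded_poly pbounded_len pbounded_len_id
          pbounded_const xs)
    show "len (foldl (\<lambda>b a. f x a # b) [] (take i (xs x))) \<le> len (xs x) * ?B x" for x i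
    proof -
      have "len (map (f x) ys) \<le> length ys * ?B x" if "set ys \<subseteq> set (xs x)" for ys
        using that
      proof (induction ys)
        case (Cons a ys)
        have "len (f x a) \<le> poly p (len x + len (xs x) + 1)"
          using p[of x a] Cons.prems len_mem_le[of a "xs x"]
          by (elim order_trans) (auto intro!: poly_nat_mono)
        then show ?case using Cons by auto
      qed simp
      from this[of "take i (xs x)"]
      have "len (map (f x) (take i (xs x))) \<le> length (take i (xs x)) * ?B x"
        by (simp add: set_take_subset)
      also have "\<dots> \<le> len (xs x) * ?B x"
        using length_le_len[of "xs x"] by (intro mult_right_mono) auto
      finally show ?thesis by (simp add: fold len_rev del: enc_list_class)
    qed
    show "poly_time (\<lambda>z. f (fst z) (snd (snd z)) # fst (snd z))"
      by (intro poly_time_Cons poly_time_fst poly_time_snd poly_time_id)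
       (use poly_time_comp[OF f, of "\<lambda>z. (fst z, snd (snd z))"] in
         \<open>simp add: poly_time_Pair poly_time_fst poly_time_snd poly_time_id\<close>)
  qed
  from poly_time_rev[OF this] show ?thesis by (simp add: fold)
qed

lemma poly_time_filter:
  assumes f: "poly_time (\<lambda>z. f (fst z) (snd z))" and xs: "poly_time xs"
  shows "poly_time (\<lambda>x. filter (f x) (xs x))"
proof -
  have fold: "foldl (\<lambda>b a. if f x a then a # b else b) [] ys = rev (filter (f x) ys)" for x ys
    by (induction ys rule: rev_induct) auto
  have "poly_time (\<lambda>x. foldl (\<lambda>b a. if f x a then a # b else b) [] (xs x))"
  proof (rule poly_time_foldl[OF xs poly_time_const _ pbounded_len[OF xs]])
    show "len (foldl (\<lambda>b a. if f x a then a # b else b) [] (take i (xs x))) \<le> len (xs x)" for x i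
      using order_trans[OF len_filter_le len_take_le]
      by (simp add: fold len_rev del: enc_list_class)
    show "poly_time (\<lambda>z. if f (fst z) (snd (snd z)) then snd (snd z) # fst (snd z) else fst (snd z))"
      by (intro poly_time_If poly_time_Cons poly_time_fst poly_time_snd poly_time_id)
       (use poly_time_comp[OF f, of "\<lambda>z. (fst z, snd (snd z))"] in
         \<open>simp add: poly_time_Pair poly_time_fst poly_time_snd poly_time_id\<close>)
  qed
  from poly_time_rev[OF this] show ?thesis by (simp add: fold)
qed

lemma poly_time_drop_length:
  assumes f: "poly_time f" and g: "poly_time g"
  shows "poly_time (\<lambda>x. drop (length (f x)) (g x))"
proof -
  have fold: "foldl (\<lambda>b a. tl b) ys xs = drop (length xs) ys" for xs :: "'b list" and ys :: "'c list"
    by (induction xs arbitrary: ys) (auto simp: drop_Suc)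
  have "poly_time (\<lambda>x. foldl (\<lambda>b a. tl b) (g x) (f x))"
    by (rule poly_time_foldl[OF f g _ pbounded_len[OF g]])
      (auto simp: fold len_drop_le simp del: enc_list_class
        intro!: poly_time_tl poly_time_fst poly_time_snd poly_time_id)
  then show ?thesis by (simp add: fold)
qed

lemma poly_time_zip:
  assumes f: "poly_time f" and g: "poly_time g"
  shows "poly_time (\<lambda>x. zip (f x) (g x))"
proof -
  \<comment> \<open>The accumulator holds the unread rest of the second list and the reversed
    output.\<close>
  let ?s = "\<lambda>(b :: 'c list \<times> ('b \<times> 'c) list) a.
    case fst b of [] \<Rightarrow> ([], snd b) | y # ys \<Rightarrow> (ys, (a, y) # snd b)"
  have fold: "foldl ?s (ys, out) xs = (drop (length xs) ys, rev (zip xs ys) @ out)" for xs ys out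
    by (induction xs arbitrary: ys out) (auto split: list.splits)
  have "poly_time (\<lambda>x. foldl ?s (g x, []) (f x))"
  proof (rule poly_time_foldl[OF f])
    show "pbounded (\<lambda>x. len (g x) + (len (f x) + len (g x)) + 1)"
      by (intro pbounded_add pbounded_len pbounded_const f g)
    show "len (foldl ?s (g x, []) (take i (f x))) \<le> len (g x) + (len (f x) + len (g x)) + 1" for x i
      using len_drop_le[of "length (take i (f x))" "g x"] len_zip_le[of "take i (f x)" "g x"]
        len_take_le[of i "f x"]
      unfolding fold by (simp add: len_rev[simplified])
  qed (intro poly_time_Cons poly_time_fst poly_time_snd poly_time_id poly_time_case_list
        poly_time_Pair poly_time_const g)+
  from poly_time_rev[OF poly_time_snd[OF this]] show ?thesis by (simp add: fold)
qed

lemma poly_time_not: "poly_time f \<Longrightarrow> poly_time (\<lambda>x. \<not> f x)"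
  by (drule poly_time_If[OF _ poly_time_const[of False] poly_time_const[of True]])
    (erule iffD1[OF arg_cong, rotated], auto)

lemma poly_time_conj:
  assumes "poly_time f" "poly_time g"
  shows "poly_time (\<lambda>x. f x \<and> g x)"
proof -
  have "(f x \<and> g x) = (if f x then g x else False)" for x by simp
  then show ?thesis using poly_time_If[OF assms poly_time_const[of False]] by presburger
qed

lemma poly_time_disj:
  assumes "poly_time f" "poly_time g"
  shows "poly_time (\<lambda>x. f x \<or> g x)"
proof -
  have "(f x \<or> g x) = (if f x then True else g x)" for x by simp
  then show ?thesis using poly_time_If[OF assms(1) poly_time_const[of True] assms(2)] by presburger
qed

lemma poly_time_bool_eq:
  assumes "poly_time f" "poly_time g"
  shows "poly_time (\<lambda>x. (f x :: bool) = g x)"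
proof -
  have "poly_time (\<lambda>x. if f x then g x else \<not> g x)"
    by (intro poly_time_If poly_time_not assms)
  moreover have "(if f x then g x else \<not> g x) = (f x = g x)" for x by auto
  ultimately show ?thesis by simp
qed

lemma poly_time_Nil_eq:
  assumes "poly_time f"
  shows "poly_time (\<lambda>x. f x = [])"
proof (rule poly_time_Cond[OF assms poly_time_const[of False] poly_time_const[of True]])
  show "(f x = []) = (if enc (f x) = Leaf then True else False)" for x by (cases "f x") auto
qed

text \<open>Equality of trees is not primitive; two lists of bits agree iff neither is longer and no
  position differs.\<close>

lemma poly_time_bool_list_eq:
  fixes f g :: "'a::encodable \<Rightarrow> bool list"
  assumes "poly_time f" "poly_time g"
  shows "poly_time (\<lambda>x. f x = g x)"
proof -
  have "poly_time (\<lambda>x. drop (length (f x)) (g x) = [] \<and> drop (length (g x)) (f x) = [] \<and>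
      filter (\<lambda>p. \<not> (fst p = snd p)) (zip (f x) (g x)) = [])"
    by (intro poly_time_conj poly_time_Nil_eq poly_time_drop_length poly_time_filter poly_time_not
      poly_time_bool_eq poly_time_zip poly_time_fst poly_time_snd poly_time_id assms)
  moreover have "(drop (length xs) ys = [] \<and> drop (length ys) xs = [] \<and>
      filter (\<lambda>p. \<not> (fst p = snd p)) (zip xs ys) = []) \<longleftrightarrow> xs = ys" for xs ys :: "bool list"
  proof (induction xs arbitrary: ys)
    case (Cons x xs)
    show ?case using Cons.IH by (cases ys) auto
  qed auto
  ultimately show ?thesis by simp
qed

named_theorems polytime

text \<open>\<open>poly_time_comp\<close> stays out, as its conclusion unifies with every goal.
  Inside \<open>map\<close>, \<open>filter\<close> and folds the body sees a tuple that starts with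
  the input, so a parameter \<open>f x\<close> becomes \<open>f (fst z)\<close>; such instances are
  supplied by hand.\<close>

lemmas [polytime] = poly_time_id poly_time_const poly_time_Pair poly_time_fst poly_time_snd
  poly_time_Cons poly_time_If poly_time_case_list poly_time_rev poly_time_append
  poly_time_map poly_time_filter poly_time_zip poly_time_not poly_time_conj poly_time_disj
  poly_time_bool_eq poly_time_Nil_eq poly_time_bool_list_eq poly_time_drop_length

section \<open>The kernelization\<close>

text \<open>
  A vector over $\mathbb{F}_2$ is a list of bits, a natural number is a list of bits with the least
  significant bit first, possibly with leading zeros, and an equation is a row consisting of the
  vector of its left-hand side, its sign (\<open>True\<close> for right-hand side 1) and its weight.
\<close>

type_synonym row = "bool list \<times> bool \<times> bool list"

section \<open>Binary arithmetic\<close>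

definition zeros :: "bool list \<Rightarrow> bool list" where
  "zeros v = map (\<lambda>_. False) v"

text \<open>One step of ripple-carry addition; the state is the carry and the reversed
  output.\<close>

definition add_step :: "bool \<times> bool list \<Rightarrow> bool \<times> bool \<Rightarrow> bool \<times> bool list" where
  "add_step a p =
     (if fst p = snd p then (fst p, fst a # snd a) else (fst a, (\<not> fst a) # snd a))"

text \<open>With each argument padded by the length of the other, the length of the result depends
  on the two lengths alone; this gives the size bounds.\<close>

definition add :: "bool list \<Rightarrow> bool list \<Rightarrow> bool list" where
  "add u v = (\<lambda>a. rev (fst a # snd a))
     (foldl add_step (False, []) (zip (u @ zeros v) (v @ zeros u)))"

text \<open>The least significant bits come first, so the last difference decides, in favour of
  \<open>v\<close> iff its bit is set.\<close>

definition le :: "bool list \<Rightarrow> bool list \<Rightarrow> bool" where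
  "le u v = foldl (\<lambda>a p. if fst p = snd p then a else snd p) True (zip (u @ zeros v) (v @ zeros u))"

definition total :: "bool list list \<Rightarrow> bool list" where
  "total ws = foldl add [] ws"

section \<open>Vectors over F_2 and systems of rows\<close>

definition xor :: "bool list \<Rightarrow> bool list \<Rightarrow> bool list" where
  "xor u v = map (\<lambda>p. \<not> (fst p = snd p)) (zip u v)"

definition diff :: "bool list \<Rightarrow> bool list \<Rightarrow> bool list" where
  "diff u v = map (\<lambda>p. fst p \<and> \<not> snd p) (zip u v)"

definition union :: "bool list \<Rightarrow> bool list \<Rightarrow> bool list" where
  "union u v = map (\<lambda>p. fst p \<or> snd p) (zip u v)"

definition meets :: "bool list \<Rightarrow> bool list \<Rightarrow> bool" where
  "meets u v \<longleftrightarrow> filter (\<lambda>p. fst p \<and> snd p) (zip u v) \<noteq> []"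

definition nonzero :: "bool list \<Rightarrow> bool" where
  "nonzero v \<longleftrightarrow> filter (\<lambda>b. b) v \<noteq> []"

text \<open>The variable that an equation with left-hand side \<open>v\<close> eliminates, as a unit
  vector.\<close>

definition first_one :: "bool list \<Rightarrow> bool list" where
  "first_one v = foldl (\<lambda>a b. if b then True # zeros a else False # a) [] (rev v)"

definition pos_weight :: "row list \<Rightarrow> bool list \<Rightarrow> bool list" where
  "pos_weight S v = total (map (\<lambda>t. snd (snd t)) (filter (\<lambda>t. fst t = v \<and> fst (snd t)) S))"

definition neg_weight :: "row list \<Rightarrow> bool list \<Rightarrow> bool list" where
  "neg_weight S v = total (map (\<lambda>t. snd (snd t)) (filter (\<lambda>t. fst t = v \<and> \<not> fst (snd t)) S))"

definition cancelled :: "row list \<Rightarrow> bool list \<Rightarrow> bool" where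
  "cancelled S v \<longleftrightarrow>
     le (pos_weight S v) (neg_weight S v) \<and> le (neg_weight S v) (pos_weight S v)"

definition prune :: "row list \<Rightarrow> row list" where
  "prune S = filter (\<lambda>t. \<not> cancelled S (fst t)) S"

definition sign :: "row list \<Rightarrow> bool list \<Rightarrow> bool" where
  "sign S v \<longleftrightarrow> \<not> le (pos_weight S v) (neg_weight S v)"

text \<open>Eliminates the first variable of \<open>v\<close> by the equation with left-hand side
  \<open>v\<close> and sign \<open>s\<close>; \<open>=\<close> on Booleans is the product of signs.
  Number and order of the rows are kept, on which the pairing of \<open>S\<close> and
  \<open>F\<close> by \<open>zip\<close> relies.\<close>

definition restrict :: "bool list \<Rightarrow> bool \<Rightarrow> row list \<Rightarrow> row list" where
  "restrict v s S = map (\<lambda>t. if meets (first_one v) (fst t)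
     then (xor (fst t) v, fst (snd t) = s, snd (snd t)) else t) S"

text \<open>A change of variables when \<open>d\<close> is a unit vector: the row picked becomes
  \<open>d\<close>, and signs stay as they are. Unlike \<open>restrict\<close>, this excludes no
  assignment.\<close>

definition pivot :: "bool list \<Rightarrow> row list \<Rightarrow> row list" where
  "pivot d S = (case filter (\<lambda>t. meets d (fst t)) S of [] \<Rightarrow> S
     | t # ts \<Rightarrow> map (\<lambda>r. if meets d (fst r) then (xor (fst r) (diff (fst t) d), snd r) else r) S)"

text \<open>The unit vector selecting the current column moves on by a \<open>False\<close> put in
  front. It grows longer than the rows, which is harmless because vectors are zipped.\<close>

definition gauss :: "bool list \<Rightarrow> row list \<Rightarrow> row list" where
  "gauss n S = snd (foldl (\<lambda>a b. (False # fst a, pivot (fst a) (snd a))) (True # zeros n, S) n)"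

definition support :: "bool list \<Rightarrow> row list \<Rightarrow> bool list" where
  "support n S = foldl (\<lambda>m t. union m (fst t)) (zeros n) S"

definition select :: "bool list \<Rightarrow> bool list \<Rightarrow> bool list" where
  "select m v = map (\<lambda>p. snd p) (filter (\<lambda>p. fst p) (zip m v))"

definition compress :: "bool list \<Rightarrow> row list \<Rightarrow> bool list \<times> row list" where
  "compress n S = (\<lambda>m. (filter (\<lambda>b. b) m, map (\<lambda>t. (select m (fst t), snd t)) S)) (support n S)"

definition mean_ge :: "bool list \<Rightarrow> row list \<Rightarrow> bool" where
  "mean_ge k S \<longleftrightarrow>
     le (add (total (map (\<lambda>t. snd (snd t)) (filter (\<lambda>t. \<not> nonzero (fst t) \<and> \<not> fst (snd t)) S))) k)
        (total (map (\<lambda>t. snd (snd t)) (filter (\<lambda>t. \<not> nonzero (fst t) \<and> fst (snd t)) S)))"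

text \<open>
  An entry \<open>(S, F)\<close> of the work list stands for the assignments of \<open>F\<close>, which arises from \<open>S\<close> by
  falsifying some equations.  For an equation \<open>s\<close> of \<open>S\<close> that is still undetermined in \<open>F\<close>, where
  it reads \<open>t\<close>, either \<open>s\<close> is satisfied, and then the falsified equations are forgotten, or it is
  falsified as well.  "Satisfied" is with respect to the net sign of all equations with this
  left-hand side.
\<close>

definition satisfied :: "row list \<Rightarrow> row \<Rightarrow> row list" where
  "satisfied S s = prune (restrict (fst s) (sign S (fst s)) S)"

definition falsified :: "row list \<Rightarrow> row list \<Rightarrow> row \<times> row \<Rightarrow> row list" where
  "falsified S F q = restrict (fst (snd q))
     (fst (snd (snd q)) = (fst (snd (fst q)) = (\<not> sign S (fst (fst q))))) F"

text \<open>The flag records success; the work list is then empty and further steps change nothing.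
  The mean of \<open>S\<close> is tested besides that of \<open>F\<close> because the potential
  below measures the distance of \<open>mean S\<close> from the target.\<close>

definition search_step ::
  "bool list \<Rightarrow> bool \<times> (row list \<times> row list) list \<Rightarrow> bool \<times> (row list \<times> row list) list" where
  "search_step k a = (case snd a of [] \<Rightarrow> a
     | p # rest \<Rightarrow>
         if mean_ge k (fst p) \<or> mean_ge k (snd p) then (True, [])
         else (case filter (\<lambda>q. nonzero (fst (snd q))) (zip (fst p) (snd p)) of [] \<Rightarrow> (fst a, rest)
           | q # qs \<Rightarrow> (fst a, (satisfied (fst p) (fst q), satisfied (fst p) (fst q)) #
               (fst p, falsified (fst p) (snd p) q) # rest)))"

definition search :: "bool list \<Rightarrow> row list \<Rightarrow> bool \<times> (row list \<times> row list) list" where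
  "search k S = foldl (\<lambda>a _. search_step k a) (False, [(S, S)]) S"

text \<open>Multiplication in unary; only the length matters.\<close>

definition mult :: "bool list \<Rightarrow> bool list \<Rightarrow> bool list" where
  "mult u v = foldl (\<lambda>a _. v @ a) [] u"

text \<open>The minimum of the numbers written in unary as \<open>u\<close> and in binary as \<open>k\<close>.\<close>

definition capped :: "bool list \<Rightarrow> bool list \<Rightarrow> bool list" where
  "capped u k = foldl (\<lambda>a b. map (\<lambda>p. fst p) (zip u (a @ a @ (if b then [True] else [])))) [] (rev k)"

definition var_bound :: "bool list \<Rightarrow> bool list \<Rightarrow> bool list" where
  "var_bound u k = mult (mult (capped u k) (capped u k)) (mult (replicate 64 True) k)"

text \<open>\<open>False # snd x\<close> is twice the parameter. The constant outputs have no
  variables and no equations, and the parameter 0 for yes, 1 for no. An unfinished search counts as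
  yes.\<close>

definition decide :: "(bool list \<times> row list) \<times> bool list \<Rightarrow> (bool list \<times> row list) \<times> bool list" where
  "decide x = (if drop (length (var_bound (fst (fst x)) (snd x))) (fst (fst x)) = [] then x
     else if (\<lambda>a. fst a \<or> \<not> snd a = []) (search (False # snd x) (snd (fst x))) then (([], []), [])
     else (([], []), [True]))"

definition kernelize :: "(bool list \<times> row list) \<times> bool list \<Rightarrow> (bool list \<times> row list) \<times> bool list"
  where
  "kernelize x =
     decide (compress (fst (fst x)) (gauss (fst (fst x)) (prune (snd (fst x)))), snd x)"

subsection \<open>Running time\<close>

lemma poly_time_zeros [polytime]: "poly_time f \<Longrightarrow> poly_time (\<lambda>x. zeros (f x))"
  unfolding zeros_def by (intro polytime)

lemma length_zeros [simp]: "length (zeros v) = length v"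
  by (simp add: zeros_def)

lemma length_foldl_add_step: "length (snd (foldl add_step a ps)) = length (snd a) + length ps"
  by (induction ps arbitrary: a) (auto simp: add_step_def)

lemma length_add: "length (add u v) = length u + length v + 1"
  unfolding add_def by (simp add: length_foldl_add_step)

lemma pbounded_length:
  assumes "poly_time f"
  shows "pbounded (\<lambda>x. length (f x))"
  by (rule pbounded_mono[OF pbounded_len[OF assms]]) (rule length_le_len)

lemma poly_time_foldl_state:
  assumes "poly_time xs" "poly_time init" "poly_time (\<lambda>z. step (fst z) (fst (snd z)) (snd (snd z)))"
    and "pbounded B" "\<And>x i. i \<le> length (xs x) \<Longrightarrow> len (foldl (step x) (init x) (take i (xs x))) \<le> B x"
  shows "poly_time (\<lambda>x. foldl (step x) (init x) (xs x))"
proof (rule poly_time_foldl[OF assms(1-4)])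
  show "len (foldl (step x) (init x) (take i (xs x))) \<le> B x" for x i
    using assms(5)[of i x] assms(5)[of "length (xs x)" x] by (cases "i \<le> length (xs x)") simp_all
qed

lemma poly_time_add [polytime]:
  assumes "poly_time f" "poly_time g"
  shows "poly_time (\<lambda>x. add (f x) (g x))"
proof -
  let ?z = "\<lambda>x. zip (f x @ zeros (g x)) (g x @ zeros (f x))"
  have "poly_time (\<lambda>x. foldl add_step (False, []) (?z x))"
  proof (rule poly_time_foldl_state)
    show "pbounded (\<lambda>x. 2 * length (?z x) + 2)"
      by (intro pbounded_add pbounded_mult pbounded_const pbounded_length polytime assms)
    show "len (foldl add_step (False, []) (take i (?z x))) \<le> 2 * length (?z x) + 2" for x i
      using length_foldl_add_step[of "(False, [])" "take i (?z x)"]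
        len_bool_list_le[of "snd (foldl add_step (False, []) (take i (?z x)))"]
        len_bool_le[of "fst (foldl add_step (False, []) (take i (?z x)))"]
      by (simp add: min_def split: if_splits)
    show "poly_time (\<lambda>z. add_step (fst (snd z)) (snd (snd z)))"
      unfolding add_step_def by (intro polytime)
  qed (intro polytime assms)+
  then show ?thesis unfolding add_def by (intro polytime)
qed

lemma poly_time_le [polytime]:
  assumes "poly_time f" "poly_time g"
  shows "poly_time (\<lambda>x. le (f x) (g x))"
  unfolding le_def
proof (rule poly_time_foldl_state)
  show "pbounded (\<lambda>_ :: 'a. 1)" by (rule pbounded_const)
qed (use len_bool_le in \<open>intro polytime assms | simp\<close>)+

text \<open>The carry costs one bit per addition, so lengths grow additively and the sum remains
  linear in the size of the list.\<close>

lemma length_total: "length (foldl add a ws) = length a + (\<Sum>w\<leftarrow>ws. length w + 1)"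
  by (induction ws arbitrary: a) (auto simp: length_add)

lemma poly_time_total [polytime]:
  assumes "poly_time f"
  shows "poly_time (\<lambda>x. total (f x))"
  unfolding total_def
proof (rule poly_time_foldl_state)
  show "pbounded (\<lambda>x. 2 * len (f x))"
    by (intro pbounded_mult pbounded_const pbounded_len assms)
  show "len (foldl add [] (take i (f x))) \<le> 2 * len (f x)" for x i
  proof -
    have "len (foldl add [] (take i (f x))) \<le> 2 * (\<Sum>w\<leftarrow>take i (f x). length w + 1)"
      using len_bool_list_le[of "foldl add [] (take i (f x))"] length_total[of "[]" "take i (f
        x)"] by simp
    also have "\<dots> \<le> 2 * len (take i (f x))"
      unfolding len_list[of "take i (f x)"]
      by (intro mult_left_mono sum_list_mono add_right_mono length_le_len) simp
    also have "\<dots> \<le> 2 * len (f x)" using len_take_le[of i "f x"] by simp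
    finally show ?thesis .
  qed
qed (intro polytime assms)+

lemma poly_time_xor [polytime]:
  "poly_time f \<Longrightarrow> poly_time g \<Longrightarrow> poly_time (\<lambda>x. xor (f x) (g x))"
  unfolding xor_def by (intro polytime)

lemma poly_time_diff [polytime]:
  "poly_time f \<Longrightarrow> poly_time g \<Longrightarrow> poly_time (\<lambda>x. diff (f x) (g x))"
  unfolding diff_def by (intro polytime)

lemma poly_time_union [polytime]:
  "poly_time f \<Longrightarrow> poly_time g \<Longrightarrow> poly_time (\<lambda>x. union (f x) (g x))"
  unfolding union_def by (intro polytime)

lemma poly_time_meets [polytime]:
  "poly_time f \<Longrightarrow> poly_time g \<Longrightarrow> poly_time (\<lambda>x. meets (f x) (g x))"
  unfolding meets_def by (intro polytime)

lemma poly_time_nonzero [polytime]: "poly_time f \<Longrightarrow> poly_time (\<lambda>x. nonzero (f x))"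
  unfolding nonzero_def by (intro polytime)

lemma poly_time_first_one [polytime]:
  assumes "poly_time f"
  shows "poly_time (\<lambda>x. first_one (f x))"
  unfolding first_one_def
proof (rule poly_time_foldl_state)
  let ?s = "\<lambda>a b. if b then True # zeros a else False # a"
  show "pbounded (\<lambda>x. 2 * length (f x))"
    by (intro pbounded_mult pbounded_const pbounded_length assms)
  have "length (foldl ?s a bs) = length a + length bs" for a bs
    by (induction bs arbitrary: a) auto
  then show "len (foldl ?s [] (take i (rev (f x)))) \<le> 2 * length (f x)" if "i \<le> length (rev (f
    x))" for x i
    using len_bool_list_le[of "foldl ?s [] (take i (rev (f x)))"] that by simp
qed (intro polytime assms)+

lemma poly_time_pos_weight [polytime]:
  "poly_time f \<Longrightarrow> poly_time g \<Longrightarrow> poly_time (\<lambda>x. pos_weight (f x) (g x))"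
  unfolding pos_weight_def
  by (intro polytime poly_time_comp[of g fst])

lemma poly_time_neg_weight [polytime]:
  "poly_time f \<Longrightarrow> poly_time g \<Longrightarrow> poly_time (\<lambda>x. neg_weight (f x) (g x))"
  unfolding neg_weight_def by (intro polytime poly_time_comp[of g fst])

lemma poly_time_cancelled [polytime]:
  "poly_time f \<Longrightarrow> poly_time g \<Longrightarrow> poly_time (\<lambda>x. cancelled (f x) (g x))"
  unfolding cancelled_def by (intro polytime)

lemma poly_time_prune [polytime]: "poly_time f \<Longrightarrow> poly_time (\<lambda>x. prune (f x))"
  unfolding prune_def by (intro polytime poly_time_comp[of f fst])

lemma poly_time_sign [polytime]:
  "poly_time f \<Longrightarrow> poly_time g \<Longrightarrow> poly_time (\<lambda>x. sign (f x) (g x))"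
  unfolding sign_def by (intro polytime)

lemma poly_time_restrict [polytime]:
  "poly_time f \<Longrightarrow> poly_time s \<Longrightarrow> poly_time g \<Longrightarrow> poly_time (\<lambda>x. restrict (f x) (s x) (g x))"
  unfolding restrict_def by (intro polytime poly_time_comp[of f fst] poly_time_comp[of s fst])

lemma poly_time_pivot [polytime]:
  "poly_time f \<Longrightarrow> poly_time g \<Longrightarrow> poly_time (\<lambda>x. pivot (f x) (g x))"
  unfolding pivot_def
  by (intro polytime poly_time_comp[of f fst] poly_time_comp[of g fst]
      poly_time_comp[of f "\<lambda>x. fst (fst x)"])

lemma poly_time_mean_ge [polytime]:
  "poly_time f \<Longrightarrow> poly_time g \<Longrightarrow> poly_time (\<lambda>x. mean_ge (f x) (g x))"
  unfolding mean_ge_def by (intro polytime)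

lemma poly_time_satisfied [polytime]:
  "poly_time f \<Longrightarrow> poly_time g \<Longrightarrow> poly_time (\<lambda>x. satisfied (f x) (g x))"
  unfolding satisfied_def by (intro polytime)

lemma poly_time_falsified [polytime]:
  "poly_time f \<Longrightarrow> poly_time g \<Longrightarrow> poly_time h \<Longrightarrow> poly_time (\<lambda>x. falsified (f x) (g x) (h x))"
  unfolding falsified_def by (intro polytime)

lemma poly_time_search_step [polytime]:
  "poly_time f \<Longrightarrow> poly_time g \<Longrightarrow> poly_time (\<lambda>x. search_step (f x) (g x))"
  unfolding search_step_def
  by (intro polytime poly_time_comp[of f fst] poly_time_comp[of g fst]
      poly_time_comp[of g "\<lambda>x. fst (fst x)"])

section \<open>Size bounds for systems and for the search\<close>

lemma len_row: "len (t :: row) = len (fst t) + len (fst (snd t)) + len (snd (snd t)) + 2"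
  by (cases t) simp

text \<open>
  Unlike \<open>len\<close>, this size does not depend on the bits, so row operations do not increase it.
\<close>

definition row_size :: "row \<Rightarrow> nat" where
  "row_size t = 2 * length (fst t) + 2 * length (snd (snd t)) + 4"

definition rows_size :: "row list \<Rightarrow> nat" where
  "rows_size S = (\<Sum>t\<leftarrow>S. row_size t)"

lemma rows_size_simps [simp]: "rows_size [] = 0" "rows_size (t # S) = row_size t + rows_size S"
  by (simp_all add: rows_size_def)

lemma len_row_le: "len t + 1 \<le> row_size t"
  using len_bool_list_le[of "fst t"] len_bool_list_le[of "snd (snd t)"] len_bool_le[of "fst (snd t)"]
  unfolding len_row row_size_def by simp

lemma len_rows_le: "len S \<le> rows_size S"
  unfolding len_list rows_size_def using len_row_le by (intro sum_list_mono)

lemma row_size_le: "row_size t \<le> 2 * (len t + 1)"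
  using length_le_len[of "fst t"] length_le_len[of "snd (snd t)"]
  unfolding len_row row_size_def by simp

lemma rows_size_le: "rows_size S \<le> 2 * len S"
  using row_size_le by (induction S) (auto simp del: enc_prod_class intro: order_trans[OF add_mono])

lemma pbounded_rows_size:
  assumes "poly_time f"
  shows "pbounded (\<lambda>x. rows_size (f x))"
  by (rule pbounded_mono[OF pbounded_mult[OF pbounded_const[of 2] pbounded_len[OF assms]]])
    (rule rows_size_le)

lemma rows_size_map: "(\<And>t. row_size (f t) \<le> row_size t) \<Longrightarrow> rows_size (map f S) \<le> rows_size S"
  unfolding rows_size_def by (simp add: sum_list_mono comp_def)

lemma rows_size_filter: "rows_size (filter P S) \<le> rows_size S"
  by (induction S) auto

lemma row_size_xor: "row_size (xor (fst t) v, s, snd (snd t)) \<le> row_size t"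
  by (simp add: row_size_def xor_def)

lemma rows_size_restrict: "rows_size (restrict v s S) \<le> rows_size S"
  unfolding restrict_def by (rule rows_size_map) (use row_size_xor in auto)

lemma rows_size_pivot: "rows_size (pivot d S) \<le> rows_size S"
  unfolding pivot_def
  by (auto split: list.splits intro!: rows_size_map)
    (use row_size_xor[of "(u, b, w)" for u b w] in auto)

lemma rows_size_satisfied: "rows_size (satisfied S s) \<le> rows_size S"
  unfolding satisfied_def prune_def
  by (rule order_trans[OF rows_size_filter rows_size_restrict])

lemma poly_time_gauss [polytime]:
  assumes "poly_time n" "poly_time f"
  shows "poly_time (\<lambda>x. gauss (n x) (f x))"
proof -
  let ?s = "\<lambda>(a :: bool list \<times> row list) (b :: bool). (False # fst a, pivot (fst a) (snd a))"
  have inv: "length (fst (foldl ?s a bs)) = length (fst a) + length bs \<and>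
      rows_size (snd (foldl ?s a bs)) \<le> rows_size (snd a)" for a bs
  proof (induction bs arbitrary: a)
    case (Cons b bs)
    show ?case
      using Cons.IH[of "(False # fst a, pivot (fst a) (snd a))"] rows_size_pivot[of "fst a" "snd a"]
      by simp
  qed simp
  have "poly_time (\<lambda>x. foldl ?s (True # zeros (n x), f x) (n x))"
  proof (rule poly_time_foldl_state)
    show "pbounded (\<lambda>x. 4 * length (n x) + rows_size (f x) + 3)"
      by (intro pbounded_add pbounded_mult pbounded_const pbounded_length pbounded_rows_size assms)
    show "len (foldl ?s (True # zeros (n x), f x) (take i (n x))) \<le>
        4 * length (n x) + rows_size (f x) + 3" for x i
    proof -
      let ?r = "foldl ?s (True # zeros (n x), f x) (take i (n x))"
      have "len ?r = len (fst ?r) + len (snd ?r) + 1" by simp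
      moreover have "len (fst ?r) \<le> 2 * length (fst ?r)" by (rule len_bool_list_le)
      moreover have "len (snd ?r) \<le> rows_size (snd ?r)" by (rule len_rows_le)
      moreover have "length (fst ?r) \<le> 2 * length (n x) + 1" "rows_size (snd ?r) \<le> rows_size (f x)"
        using inv[of "(True # zeros (n x), f x)" "take i (n x)"] by simp_all
      ultimately show ?thesis by linarith
    qed
  qed (intro polytime assms)+
  then show ?thesis unfolding gauss_def by (intro polytime)
qed

lemma poly_time_support [polytime]:
  assumes "poly_time n" "poly_time f"
  shows "poly_time (\<lambda>x. support (n x) (f x))"
  unfolding support_def
proof (rule poly_time_foldl_state)
  show "pbounded (\<lambda>x. 2 * length (n x))"
    by (intro pbounded_mult pbounded_const pbounded_length assms)
  have "length (foldl (\<lambda>m t. union m (fst t)) m S) \<le> length m" for m and S :: "row list"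
  proof (induction S arbitrary: m)
    case (Cons t S)
    have "length (union m (fst t)) \<le> length m" by (simp add: union_def)
    then show ?case using Cons.IH[of "union m (fst t)"] by simp
  qed simp
  then have *: "length (foldl (\<lambda>m t. union m (fst t)) (zeros m) S) \<le> length m"
    for m and S :: "row list"
    by (metis length_zeros)
  show "len (foldl (\<lambda>m t. union m (fst t)) (zeros (n x)) (take i (f x))) \<le> 2 * length (n x)" for x i
    using len_bool_list_le[of "foldl (\<lambda>m t. union m (fst t)) (zeros (n x)) (take i (f x))"]
      *[of "n x" "take i (f x)"] by linarith
qed (intro polytime assms)+

lemma poly_time_select [polytime]:
  "poly_time f \<Longrightarrow> poly_time g \<Longrightarrow> poly_time (\<lambda>x. select (f x) (g x))"
  unfolding select_def by (intro polytime)

lemma poly_time_compress [polytime]: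
  "poly_time f \<Longrightarrow> poly_time g \<Longrightarrow> poly_time (\<lambda>x. compress (f x) (g x))"
  unfolding compress_def by (intro polytime poly_time_comp[of f fst] poly_time_comp[of g fst])

definition entries_size :: "(row list \<times> row list) list \<Rightarrow> nat" where
  "entries_size wl = (\<Sum>p\<leftarrow>wl. rows_size (fst p) + rows_size (snd p) + 2)"

lemma len_entries_le: "len wl \<le> entries_size wl"
  unfolding len_list entries_size_def
proof (intro sum_list_mono)
  fix p :: "row list \<times> row list"
  show "len p + 1 \<le> rows_size (fst p) + rows_size (snd p) + 2"
    using len_rows_le[of "fst p"] len_rows_le[of "snd p"] by simp
qed

text \<open>A step removes one entry and adds at most two, and restricting or pruning enlarges no
  system. So there is at most one more entry per step, and each is bounded by the size of the
  initial system.\<close>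

lemma search_step_sizes:
  assumes "\<forall>p\<in>set (snd a). rows_size (fst p) \<le> B \<and> rows_size (snd p) \<le> B"
  shows "length (snd (search_step k a)) \<le> length (snd a) + 1 \<and>
    (\<forall>p\<in>set (snd (search_step k a)). rows_size (fst p) \<le> B \<and> rows_size (snd p) \<le> B)"
  using assms unfolding search_step_def falsified_def
  by (auto split: list.splits intro: order_trans[OF rows_size_satisfied] order_trans[OF
    rows_size_restrict])

lemma poly_time_search [polytime]:
  assumes "poly_time k" "poly_time f"
  shows "poly_time (\<lambda>x. search (k x) (f x))"
  unfolding search_def
proof (rule poly_time_foldl_state)
  show "pbounded (\<lambda>x. (length (f x) + 1) * (2 * rows_size (f x) + 2) + 2)"
    by (intro pbounded_add pbounded_mult pbounded_const pbounded_length pbounded_rows_size assms)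
  show "len (foldl (\<lambda>a _. search_step (k x) a) (False, [(f x, f x)]) (take i (f x))) \<le>
      (length (f x) + 1) * (2 * rows_size (f x) + 2) + 2" for x i
  proof -
    let ?B = "rows_size (f x)" and ?s = "\<lambda>a _. search_step (k x) a"
    let ?r = "foldl ?s (False, [(f x, f x)]) (take i (f x))"
    have "length (snd (foldl ?s a ys)) \<le> length (snd a) + length ys \<and>
        (\<forall>p\<in>set (snd (foldl ?s a ys)). rows_size (fst p) \<le> ?B \<and> rows_size (snd p) \<le> ?B)"
      if "\<forall>p\<in>set (snd a). rows_size (fst p) \<le> ?B \<and> rows_size (snd p) \<le> ?B" for a and ys :: "row list"
      using that
    proof (induction ys arbitrary: a)
      case (Cons y ys)
      from Cons.IH[of "search_step (k x) a"] search_step_sizes[OF Cons.prems, of "k x"]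
      show ?case by auto
    qed auto
    from this[of "(False, [(f x, f x)])" "take i (f x)"]
    have r: "length (snd ?r) \<le> length (f x) + 1"
      "\<forall>p\<in>set (snd ?r). rows_size (fst p) \<le> ?B \<and> rows_size (snd p) \<le> ?B"
      by auto
    have "entries_size (snd ?r) \<le> (\<Sum>p\<leftarrow>snd ?r. 2 * ?B + 2)"
      unfolding entries_size_def using r(2) by (intro sum_list_mono) force
    also have "\<dots> \<le> (length (f x) + 1) * (2 * ?B + 2)"
      unfolding sum_list_triv using r(1) by (simp del: add_mult_distrib mult_Suc mult_Suc_right)
    finally have "len (snd ?r) \<le> (length (f x) + 1) * (2 * ?B + 2)"
      using len_entries_le order_trans by blast
    moreover have "len ?r = len (fst ?r) + len (snd ?r) + 1" by simp
    ultimately show ?thesis using len_bool_le[of "fst ?r"] by linarith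
  qed
qed (intro polytime assms poly_time_comp[of k fst])+

lemma foldl_mult: "foldl (\<lambda>a _. v @ a) a u = concat (replicate (length u) v) @ a"
proof -
  have "v @ concat (replicate n v) = concat (replicate n v) @ v" for n
    by (induction n) auto
  then show ?thesis by (induction u arbitrary: a) auto
qed

lemma length_mult [simp]: "length (mult u v) = length u * length v"
  unfolding mult_def by (simp add: foldl_mult length_concat sum_list_replicate)

lemma poly_time_mult [polytime]:
  assumes "poly_time f" "poly_time g"
  shows "poly_time (\<lambda>x. mult (f x) (g x))"
  unfolding mult_def
proof (rule poly_time_foldl_state)
  show "pbounded (\<lambda>x. 2 * (length (f x) * length (g x)))"
    by (intro pbounded_mult pbounded_const pbounded_length assms)
  show "len (foldl (\<lambda>a _. g x @ a) [] (take i (f x))) \<le> 2 * (length (f x) * length (g x))" for x i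
  proof -
    have "length (mult (take i (f x)) (g x)) \<le> length (f x) * length (g x)"
      by simp
    then show ?thesis using len_bool_list_le[of "mult (take i (f x)) (g x)"]
      unfolding mult_def by linarith
  qed
qed (intro polytime assms poly_time_comp[of g fst])+

lemma poly_time_capped [polytime]:
  assumes "poly_time f" "poly_time g"
  shows "poly_time (\<lambda>x. capped (f x) (g x))"
  unfolding capped_def
proof (rule poly_time_foldl_state)
  let ?s = "\<lambda>u a b. map (\<lambda>p. fst p) (zip u (a @ a @ (if b then [True] else [])))"
  show "pbounded (\<lambda>x. 2 * length (f x))"
    by (intro pbounded_mult pbounded_const pbounded_length assms)
  have "length (foldl (?s u) [] bs) \<le> length u" for u :: "bool list" and bs
    by (induction bs rule: rev_induct) auto
  then show "len (foldl (?s (f x)) [] (take i (rev (g x)))) \<le> 2 * length (f x)" for x i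
    using len_bool_list_le[of "foldl (?s (f x)) [] (take i (rev (g x)))"] le_trans mult_le_mono2
      by blast
qed (intro polytime assms poly_time_comp[of f fst])+

lemma poly_time_var_bound [polytime]:
  "poly_time f \<Longrightarrow> poly_time g \<Longrightarrow> poly_time (\<lambda>x. var_bound (f x) (g x))"
  unfolding var_bound_def by (intro polytime)

lemma poly_time_decide [polytime]: "poly_time f \<Longrightarrow> poly_time (\<lambda>x. decide (f x))"
  unfolding decide_def by (intro polytime)

lemma poly_time_kernelize: "poly_time kernelize"
  unfolding kernelize_def[abs_def] by (intro polytime)

section \<open>Binary numbers\<close>

primrec val :: "bool list \<Rightarrow> nat" where
  "val [] = 0"
| "val (b # bs) = of_bool b + 2 * val bs"

lemma val_append: "val (u @ v) = val u + 2 ^ length u * val v"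
  by (induction u) (auto simp: algebra_simps)

lemma val_zeros [simp]: "val (zeros v) = 0"
  unfolding zeros_def by (induction v) auto

lemma val_bits [simp]: "val (bits n) = n"
proof (induction n rule: bits.induct)
  case (1 n)
  then show ?case by (subst bits.simps) (auto simp: odd_two_times_div_two_succ)
qed

text \<open>The invariant of the addition: the output so far, plus carry and unread parts shifted by
  its length, has a constant value.\<close>

lemma val_add_step:
  "val (rev (fst r # snd r)) =
     val (rev out) + 2 ^ length out * (of_bool c + val (map fst ps) + val (map snd ps))"
  if "r = foldl add_step (c, out) ps"
  using that
proof (induction ps arbitrary: c out)
  case Nil
  then show ?case by (simp add: val_append)
next
  case (Cons p ps)
  show ?case
    using Cons.IH[of "fst (add_step (c, out) p)" "snd (add_step (c, out) p)"] Cons.prems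
    by (cases "fst p"; cases "snd p"; cases c) (simp_all add: add_step_def val_append algebra_simps)
qed

lemma val_add [simp]: "val (add u v) = val u + val v"
proof -
  let ?ps = "zip (u @ zeros v) (v @ zeros u)"
  have "map fst ?ps = u @ zeros v" "map snd ?ps = v @ zeros u" by simp_all
  then show ?thesis
    unfolding add_def using val_add_step[OF refl, of False "[]" ?ps] by (simp add: val_append)
qed

lemma le_iff [simp]: "le u v \<longleftrightarrow> val u \<le> val v"
proof -
  \<comment> \<open>\<open>a\<close> is the verdict on the lower bits; it survives only if all
    higher bits agree.\<close>
  have "foldl (\<lambda>a p. if fst p = snd p then a else snd p) a ps =
     (if val (map fst ps) = val (map snd ps) then a else val (map fst ps) < val (map snd ps))" for
       a ps
  proof (induction ps arbitrary: a)
    case (Cons p ps)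
    show ?case using Cons.IH by (cases "fst p"; cases "snd p") (simp_all, arith+)
  qed simp
  from this[of True "zip (u @ zeros v) (v @ zeros u)"] show ?thesis
    by (auto simp: le_def val_append)
qed

lemma val_total [simp]: "val (total ws) = (\<Sum>w\<leftarrow>ws. val w)"
proof -
  have "val (foldl add a ws) = val a + (\<Sum>w\<leftarrow>ws. val w)" for a
    by (induction ws arbitrary: a) auto
  then show ?thesis by (simp add: total_def)
qed

section \<open>Characters\<close>

lemma length_xor [simp]: "length (xor u v) = min (length u) (length v)"
  by (simp add: xor_def)

lemma nth_xor [simp]: "i < length u \<Longrightarrow> i < length v \<Longrightarrow> xor u v ! i \<longleftrightarrow> u ! i \<noteq> v ! i"
  by (simp add: xor_def)

lemma nonzero_iff: "nonzero v \<longleftrightarrow> (\<exists>i<length v. v ! i)"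
proof -
  have "nonzero v \<longleftrightarrow> True \<in> set v"
    unfolding nonzero_def filter_empty_conv by metis
  then show ?thesis unfolding in_set_conv_nth by simp
qed

lemma meets_iff: "meets u v \<longleftrightarrow> (\<exists>i<min (length u) (length v). u ! i \<and> v ! i)"
  by (auto simp: meets_def filter_empty_conv set_zip)

section \<open>The cube F_2^n\<close>

definition cube :: "nat \<Rightarrow> bool list set" where
  "cube n = {y. length y = n}"

lemma cube_iff [simp]: "y \<in> cube n \<longleftrightarrow> length y = n"
  by (simp add: cube_def)

lemma finite_cube [simp]: "finite (cube n)"
  using finite_lists_length_eq[of "UNIV :: bool set" n] by (simp add: cube_def)

lemma card_cube [simp]: "card (cube n) = 2 ^ n"
  using card_lists_length_eq[of "UNIV :: bool set" n] by (simp add: cube_def)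

lemma cube_Suc: "cube (Suc n) = Cons True ` cube n \<union> Cons False ` cube n"
  by (auto simp: cube_def image_iff length_Suc_conv)

lemma sum_cube_Suc:
  "(\<Sum>y\<in>cube (Suc n). g y) = (\<Sum>y\<in>cube n. g (True # y)) + (\<Sum>y\<in>cube n. g (False # y))"
  unfolding cube_Suc by (subst sum.union_disjoint) (auto simp: sum.reindex)

definition zero :: "nat \<Rightarrow> bool list" where
  "zero n = replicate n False"

definition unit :: "nat \<Rightarrow> nat \<Rightarrow> bool list" where
  "unit n j = (zero n)[j := True]"

lemma length_zero [simp]: "length (zero n) = n" and length_unit [simp]: "length (unit n j) = n"
  by (simp_all add: zero_def unit_def)

lemma nth_zero [simp]: "i < n \<Longrightarrow> \<not> zero n ! i"
  by (simp add: zero_def)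

lemma nth_unit [simp]: "i < n \<Longrightarrow> unit n j ! i \<longleftrightarrow> i = j"
  by (cases "i = j") (simp_all add: unit_def zero_def)

lemma not_nonzero_iff: "\<not> nonzero v \<longleftrightarrow> v = zero (length v)"
  by (auto simp: nonzero_iff list_eq_iff_nth_eq)

lemma nonzero_zero [simp]: "\<not> nonzero (zero n)"
  by (simp add: not_nonzero_iff)

lemma xor_zero [simp]: "length v = n \<Longrightarrow> xor (zero n) v = v" "length v = n \<Longrightarrow> xor v (zero n) = v"
  by (auto intro: nth_equalityI)

lemma xor_self: "xor v v = zero (length v)"
  by (auto intro: nth_equalityI)

lemma xor_commute: "xor u v = xor v u"
  by (auto intro: nth_equalityI)

lemma xor_assoc: "xor (xor u v) w = xor u (xor v w)"
  by (auto intro: nth_equalityI)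

lemma xor_cancel: "length u = length v \<Longrightarrow> xor u (xor u v) = v"
  by (auto intro: nth_equalityI)

lemma xor_eq_zero_iff: "length u = n \<Longrightarrow> length v = n \<Longrightarrow> xor u v = zero n \<longleftrightarrow> u = v"
  by (metis xor_cancel xor_self xor_zero(2))

lemma meets_unit: "j < length v \<Longrightarrow> n = length v \<Longrightarrow> meets (unit n j) v \<longleftrightarrow> v ! j"
  by (auto simp: meets_iff)

lemma first_one_unit:
  "nonzero v \<Longrightarrow> \<exists>j<length v. v ! j \<and> first_one v = unit (length v) j"
proof (induction v)
  case Nil
  then show ?case by (simp add: nonzero_def)
next
  case (Cons b v)
  have eq: "first_one (b # v) = (if b then True # zeros (first_one v) else False # first_one v)" for b
    by (simp add: first_one_def)
  have "length (first_one v) = length v" for v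
    unfolding first_one_def by (induction v) auto
  then have z: "zeros (first_one v) = zero (length v)"
    by (simp add: zeros_def zero_def map_replicate_const)
  show ?case
  proof (cases b)
    case True
    then show ?thesis by (intro exI[of _ 0]) (simp add: eq z unit_def zero_def)
  next
    case False
    then have "nonzero v" using Cons.prems by (simp add: nonzero_def)
    then obtain j where "j < length v" "v ! j" "first_one v = unit (length v) j"
      using Cons.IH by blast
    then show ?thesis using False by (intro exI[of _ "Suc j"]) (simp add: eq unit_def zero_def)
  qed
qed

text \<open>The character (-1)^(u . y); vectors of unequal length are cut to the shorter
  one.\<close>

fun chi :: "bool list \<Rightarrow> bool list \<Rightarrow> int" where
  "chi (a # u) (b # y) = (if a \<and> b then - chi u y else chi u y)"
| "chi _ _ = 1"

lemma chi_cases: "chi u y = 1 \<or> chi u y = -1"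
  by (induction u y rule: chi.induct) auto

lemma chi_square [simp]: "chi u y * chi u y = 1"
  using chi_cases[of u y] by auto

lemma chi_commute: "chi u y = chi y u"
  by (induction u y rule: chi.induct) auto

lemma chi_zero [simp]: "chi (zero n) y = 1" "chi y (zero n) = 1"
proof -
  show *: "chi (zero n) y = 1" for y
    unfolding zero_def
  proof (induction n arbitrary: y)
    case (Suc n)
    then show ?case by (cases y) auto
  qed simp
  show "chi y (zero n) = 1" using * by (metis chi_commute)
qed

lemma chi_xor: "length u = length v \<Longrightarrow> chi (xor u v) y = chi u y * chi v y"
proof (induction u v arbitrary: y rule: list_induct2)
  case Nil
  then show ?case by (simp add: xor_def)
next
  case (Cons a u b v)
  then show ?case by (cases y) (auto simp: xor_def)
qed

lemma chi_xor_right: "length y = length z \<Longrightarrow> chi u (xor y z) = chi u y * chi u z"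
  by (metis chi_xor chi_commute)

lemma chi_unit: "j < length u \<Longrightarrow> chi u (unit (length u) j) = (if u ! j then -1 else 1)"
proof (induction u arbitrary: j)
  case (Cons a u)
  show ?case
  proof (cases j)
    case 0
    then show ?thesis by (auto simp: unit_def zero_def chi_zero[unfolded zero_def])
  next
    case (Suc i)
    then show ?thesis using Cons.IH[of i] Cons.prems by (simp add: unit_def zero_def)
  qed
qed simp

text \<open>Orthogonality of characters: a bit set in \<open>u\<close> pairs the points of the cube
  with opposite values.\<close>

lemma sum_chi: "length u = n \<Longrightarrow> (\<Sum>y\<in>cube n. chi u y) = (if u = zero n then 2 ^ n else 0)"
proof (induction n arbitrary: u)
  case 0
  have "cube 0 = {[]}" by auto
  then show ?case using 0 by (simp add: zero_def)
next
  case (Suc n)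
  then obtain a v where u: "u = a # v" "length v = n" by (cases u) auto
  show ?case
    unfolding sum_cube_Suc u using Suc.IH[OF u(2)]
    by (cases a) (auto simp: sum_negf zero_def)
qed

section \<open>The excess of a system\<close>

definition pm :: "bool \<Rightarrow> int" where
  "pm b = (if b then 1 else -1)"

lemma pm_simps [simp]: "pm True = 1" "pm False = -1"
  by (simp_all add: pm_def)

lemma pm_eq: "pm (a = b) = pm a * pm b" and pm_not: "pm (\<not> a) = - pm a"
  by (auto simp: pm_def)

definition row_val :: "row \<Rightarrow> bool list \<Rightarrow> int" where
  "row_val t y = pm (fst (snd t)) * chi (fst t) y"

definition row_weight :: "row \<Rightarrow> int" where
  "row_weight t = int (val (snd (snd t)))"

definition excess :: "row list \<Rightarrow> bool list \<Rightarrow> int" where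
  "excess S y = (\<Sum>t\<leftarrow>S. row_weight t * row_val t y)"

text \<open>The Fourier coefficient of \<open>excess S\<close> at \<open>v\<close>, to which several
  rows may contribute.\<close>

definition coef :: "row list \<Rightarrow> bool list \<Rightarrow> int" where
  "coef S v = (\<Sum>t\<leftarrow>S. if fst t = v then row_weight t * pm (fst (snd t)) else 0)"

text \<open>The Fourier coefficient at zero, hence the average of \<open>excess S\<close>; phrased
  with \<open>nonzero\<close> so that it does not mention the number of variables.\<close>

definition mean :: "row list \<Rightarrow> int" where
  "mean S = (\<Sum>t\<leftarrow>S. if nonzero (fst t) then 0 else row_weight t * pm (fst (snd t)))"

definition rows :: "nat \<Rightarrow> row list set" where
  "rows n = {S. \<forall>t\<in>set S. length (fst t) = n}"

lemma excess_simps [simp]: "excess [] y = 0"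
    "excess (t # S) y = row_weight t * row_val t y + excess S y"
  by (simp_all add: excess_def)

lemma coef_simps [simp]: "coef [] v = 0"
    "coef (t # S) v = (if fst t = v then row_weight t * pm (fst (snd t)) else 0) + coef S v"
  by (simp_all add: coef_def)

lemma mean_simps [simp]: "mean [] = 0"
    "mean (t # S) = (if nonzero (fst t) then 0 else row_weight t * pm (fst (snd t))) + mean S"
  by (simp_all add: mean_def)

lemma rows_simps [simp]: "[] \<in> rows n" "t # S \<in> rows n \<longleftrightarrow> length (fst t) = n \<and> S \<in> rows n"
  by (auto simp: rows_def)

lemma rows_mem: "S \<in> rows n \<Longrightarrow> t \<in> set S \<Longrightarrow> length (fst t) = n"
  by (simp add: rows_def)

lemma coef_pos_neg: "coef S v = int (val (pos_weight S v)) - int (val (neg_weight S v))"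
  unfolding pos_weight_def neg_weight_def
  by (induction S) (auto simp: row_weight_def pm_def)

lemma cancelled_iff: "cancelled S v \<longleftrightarrow> coef S v = 0"
  by (auto simp: cancelled_def coef_pos_neg)

lemma sign_iff: "sign S v \<longleftrightarrow> coef S v > 0"
  by (auto simp: sign_def coef_pos_neg)

lemma mean_ge_iff: "mean_ge k S \<longleftrightarrow> mean S \<ge> int (val k)"
proof -
  have "mean S =
    int (val (total (map (\<lambda>t. snd (snd t)) (filter (\<lambda>t. \<not> nonzero (fst t) \<and> fst (snd t)) S)))) -
    int (val (total (map (\<lambda>t. snd (snd t)) (filter (\<lambda>t. \<not> nonzero (fst t) \<and> \<not> fst (snd t)) S))))"
    by (induction S) (auto simp: row_weight_def)
  then show ?thesis unfolding mean_ge_def by auto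
qed

lemma mean_eq_coef: "S \<in> rows n \<Longrightarrow> mean S = coef S (zero n)"
  by (induction S) (auto simp: not_nonzero_iff)

lemma coef_eq_0: "v \<notin> fst ` set S \<Longrightarrow> coef S v = 0"
  by (induction S) auto

lemma excess_eq_coef:
  "finite A \<Longrightarrow> fst ` set S \<subseteq> A \<Longrightarrow> excess S y = (\<Sum>v\<in>A. coef S v * chi v y)"
proof (induction S)
  case (Cons t S)
  have "(\<Sum>v\<in>A. coef (t # S) v * chi v y) =
      (\<Sum>v\<in>A. (if fst t = v then row_weight t * pm (fst (snd t)) * chi v y else 0)) +
      (\<Sum>v\<in>A. coef S v * chi v y)"
    by (simp add: sum.distrib[symmetric] distrib_right if_distrib[of "\<lambda>x. x * _"] cong: if_cong)
  then show ?case using Cons by (simp add: row_val_def mult.assoc)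
qed simp

lemma sum_excess:
  assumes "S \<in> rows n"
  shows "(\<Sum>y\<in>cube n. excess S y) = 2 ^ n * mean S"
  using assms
proof (induction S)
  case (Cons t S)
  have "(\<Sum>y\<in>cube n. row_weight t * row_val t y) =
      (if fst t = zero n then 2 ^ n * (row_weight t * pm (fst (snd t))) else 0)"
    using sum_chi[of "fst t" n] Cons.prems
    by (simp add: row_val_def sum_distrib_left[symmetric] mult.assoc[symmetric])
  then show ?case
    using Cons by (simp add: sum.distrib not_nonzero_iff algebra_simps)
qed simp

lemma excess_ge_mean:
  assumes "S \<in> rows n"
  shows "\<exists>y\<in>cube n. excess S y \<ge> mean S"
proof (rule ccontr)
  assume "\<not> ?thesis"
  then have "(\<Sum>y\<in>cube n. excess S y) < (\<Sum>y\<in>cube n. mean S)"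
    using length_zero[of n] by (intro sum_strict_mono) (auto simp: not_le simp del: length_zero)
  then show False using sum_excess[OF assms] by simp
qed

lemma coef_prune: "coef (prune S) v = coef S v"
proof (cases "coef S v = 0")
  case True
  have "coef (filter (\<lambda>t. \<not> cancelled S (fst t)) T) v = 0" for T
    by (induction T) (auto simp: cancelled_iff True)
  then show ?thesis using True by (simp add: prune_def)
next
  case False
  have "coef (filter (\<lambda>t. \<not> cancelled S (fst t)) T) v = coef T v" for T
    by (induction T) (use False in \<open>auto simp: cancelled_iff\<close>)
  then show ?thesis by (simp add: prune_def)
qed

lemma set_prune_subset: "set (prune S) \<subseteq> set S"
  by (auto simp: prune_def)

lemma rows_prune [simp]: "S \<in> rows n \<Longrightarrow> prune S \<in> rows n"
  using set_prune_subset by (auto simp: rows_def)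

lemma excess_prune: "excess (prune S) y = excess S y"
proof -
  have "fst ` set (prune S) \<subseteq> fst ` set S" using set_prune_subset by blast
  then show ?thesis
    using excess_eq_coef[of "fst ` set S" S y] excess_eq_coef[of "fst ` set S" "prune S" y]
    by (simp add: coef_prune)
qed

lemma mean_prune: "S \<in> rows n \<Longrightarrow> mean (prune S) = mean S"
  by (simp add: mean_eq_coef[of _ n] coef_prune)

text \<open>Each left-hand side present has a nonzero integer coefficient; every gain of at least 1
  in the proof comes from this.\<close>

definition pruned :: "row list \<Rightarrow> bool" where
  "pruned S \<longleftrightarrow> (\<forall>t\<in>set S. coef S (fst t) \<noteq> 0)"

lemma pruned_prune [simp]: "pruned (prune S)"
  unfolding pruned_def coef_prune by (auto simp: prune_def cancelled_iff)

section \<open>Correctness of the search\<close>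

definition restrict_row :: "bool list \<Rightarrow> bool \<Rightarrow> row \<Rightarrow> row" where
  "restrict_row v s t = (if meets (first_one v) (fst t)
     then (xor (fst t) v, fst (snd t) = s, snd (snd t)) else t)"

lemma restrict_eq_map: "restrict v s S = map (restrict_row v s) S"
  unfolding restrict_def restrict_row_def by simp

lemma length_restrict_row: "length (fst t) = n \<Longrightarrow> length v = n \<Longrightarrow> length (fst (restrict_row v s t)) = n"
  by (simp add: restrict_row_def)

lemma rows_restrict: "S \<in> rows n \<Longrightarrow> length v = n \<Longrightarrow> restrict v s S \<in> rows n"
  by (auto simp: restrict_eq_map rows_def length_restrict_row)

lemma row_weight_restrict_row [simp]: "row_weight (restrict_row v s t) = row_weight t"
  by (simp add: restrict_row_def row_weight_def)

lemma row_val_restrict_row: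
  assumes "length v = n" "length (fst t) = n" "chi v y = pm s"
  shows "row_val (restrict_row v s t) y = row_val t y"
  using assms by (auto simp: restrict_row_def row_val_def chi_xor pm_eq pm_def)

lemma nth_restrict_row:
  assumes "length v = n" "length (fst t) = n" "j < n" "v ! j" "first_one v = unit n j"
  shows "\<not> fst (restrict_row v s t) ! j"
  using assms by (auto simp: restrict_row_def meets_unit)

text \<open>No restricted row contains variable \<open>j\<close>, so flipping bit \<open>j\<close>
  of \<open>y\<close> changes none of their values, but it does change \<open>chi v y\<close>. Every
  point can thus be moved onto the solutions of the equation.\<close>

lemma ex_restrict_row:
  assumes v: "length v = n" "nonzero v" and y: "length y = n"
  shows "\<exists>y'\<in>cube n. chi v y' = pm s \<and>
    (\<forall>t. length (fst t) = n \<longrightarrow> row_val (restrict_row v s t) y = row_val t y')"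
proof (cases "chi v y = pm s")
  case True
  then show ?thesis using row_val_restrict_row[OF v(1)] y by auto
next
  case False
  obtain j where j: "j < n" "v ! j" "first_one v = unit n j"
    using first_one_unit[OF v(2)] v(1) by auto
  let ?y = "xor y (unit n j)"
  have flip: "chi u ?y = chi u y * (if u ! j then -1 else 1)" if "length u = n" for u
    using that j chi_unit[of j u] y by (simp add: chi_xor_right)
  have s: "chi v ?y = pm s"
    using flip[OF v(1)] j(2) chi_cases[of v y] False by (cases s) auto
  have "row_val (restrict_row v s t) y = row_val t ?y" if "length (fst t) = n" for t
  proof -
    have "row_val (restrict_row v s t) ?y = row_val (restrict_row v s t) y"
      using flip[OF length_restrict_row[OF that v(1)]] nth_restrict_row[OF v(1) that j]
      by (simp add: row_val_def)
    then show ?thesis using row_val_restrict_row[OF v(1) that s] by simp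
  qed
  then show ?thesis using s y by (intro bexI[of _ ?y]) auto
qed

text \<open>\<open>F\<close> is \<open>S\<close> on an affine subspace, reparametrised. Agreement is
  demanded row by row and not just for \<open>excess\<close>, so that the value of a row of
  \<open>S\<close> can be controlled through its counterpart in \<open>F\<close>.\<close>

definition specializes :: "nat \<Rightarrow> row list \<Rightarrow> row list \<Rightarrow> bool" where
  "specializes n S F \<longleftrightarrow> length F = length S \<and>
     (\<forall>p\<in>set (zip S F). row_weight (snd p) = row_weight (fst p)) \<and>
     (\<forall>y\<in>cube n. \<exists>y'\<in>cube n. \<forall>p\<in>set (zip S F). row_val (snd p) y = row_val (fst p) y')"

lemma specializes_refl: "specializes n S S"
  by (auto simp: specializes_def zip_same)

lemma specializes_restrict:
  assumes "specializes n S F" "F \<in> rows n" "length v = n" "nonzero v"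
  shows "specializes n S (restrict v s F)"
proof -
  have zip: "zip S (map f F) = map (\<lambda>p. (fst p, f (snd p))) (zip S F)" for f :: "row \<Rightarrow> row"
    by (simp add: zip_map2 case_prod_beta)
  have "\<exists>y''\<in>cube n. \<forall>p\<in>set (zip S F). row_val (restrict_row v s (snd p)) y = row_val (fst p) y''"
    if y: "y \<in> cube n" for y
  proof -
    obtain y' where y': "y' \<in> cube n"
      "\<And>t. length (fst t) = n \<Longrightarrow> row_val (restrict_row v s t) y = row_val t y'"
      using ex_restrict_row[OF assms(3,4), of y s] y by (metis cube_iff)
    obtain y'' where "y'' \<in> cube n" "\<And>p. p \<in> set (zip S F) \<Longrightarrow> row_val (snd p) y' = row_val (fst p) y''"
      using assms(1) y'(1) unfolding specializes_def by blast
    then show ?thesis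
      using y'(2) rows_mem[OF assms(2)] by (metis set_zip_rightD surjective_pairing)
  qed
  then show ?thesis using assms(1) unfolding specializes_def restrict_eq_map zip by simp
qed

lemma excess_cong:
  assumes "length F = length S"
    and "\<And>p. p \<in> set (zip S F) \<Longrightarrow> row_weight (snd p) = row_weight (fst p)"
    and "\<And>p. p \<in> set (zip S F) \<Longrightarrow> row_val (snd p) y = row_val (fst p) y'"
  shows "excess F y = excess S y'"
  using assms
proof (induction F S rule: list_induct2)
  case (Cons t F s S)
  have "row_weight t = row_weight s" "row_val t y = row_val s y'"
    using Cons.prems(1,2)[of "(s, t)"] by simp_all
  then show ?case using Cons by simp
qed simp

lemma excess_specializes:
  assumes "specializes n S F" "y \<in> cube n"
  shows "\<exists>y'\<in>cube n. excess F y = excess S y' \<and> (\<forall>p\<in>set (zip S F). row_val (snd p) y = row_val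
    (fst p) y')"
  using assms excess_cong[of F S y] unfolding specializes_def by blast

lemma excess_restrict:
  assumes "S \<in> rows n" "length v = n"
  shows "chi v y = pm s \<Longrightarrow> excess (restrict v s S) y = excess S y"
    and "nonzero v \<Longrightarrow> y \<in> cube n \<Longrightarrow> \<exists>y'\<in>cube n. excess (restrict v s S) y = excess S y'"
proof -
  show "chi v y = pm s \<Longrightarrow> excess (restrict v s S) y = excess S y"
    using assms(1) by (induction S) (auto simp: restrict_eq_map row_val_restrict_row[OF assms(2)])
  show "\<exists>y'\<in>cube n. excess (restrict v s S) y = excess S y'" if "nonzero v" "y \<in> cube n"
    using excess_specializes[OF specializes_restrict[OF specializes_refl assms that(1)] that(2)]
      by blast
qed

text \<open>A zero row of \<open>S\<close> is constant, hence so is its counterpart, whereas a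
  nonzero vector has a nonconstant character. An equation undetermined in \<open>F\<close> is
  therefore undetermined in \<open>S\<close>.\<close>

lemma specializes_nonzero:
  assumes "specializes n S F" "F \<in> rows n" "p \<in> set (zip S F)" "nonzero (fst (snd p))"
  shows "nonzero (fst (fst p))"
proof (rule ccontr)
  assume "\<not> ?thesis"
  then have const: "row_val (fst p) y = row_val (fst p) y'" for y y'
    by (metis row_val_def not_nonzero_iff chi_zero(1))
  let ?u = "fst (snd p)"
  have len: "length ?u = n" using assms(2,3) rows_mem by (metis set_zip_rightD surjective_pairing)
  then obtain j where j: "j < n" "?u ! j" using assms(4) nonzero_iff by auto
  have "row_val (snd p) (zero n) = row_val (snd p) (unit n j)"
    using assms(1,3) const unfolding specializes_def by (metis cube_iff length_zero length_unit)
  then show False using chi_unit[of j ?u] j len by (simp add: row_val_def pm_def split: if_splits)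
qed

definition attains :: "nat \<Rightarrow> int \<Rightarrow> row list \<Rightarrow> bool" where
  "attains n c S \<longleftrightarrow> (\<exists>y\<in>cube n. excess S y \<ge> c)"

lemma attains_mean: "S \<in> rows n \<Longrightarrow> mean S \<ge> c \<Longrightarrow> attains n c S"
  unfolding attains_def using excess_ge_mean order_trans by blast

lemma satisfied_rows:
  assumes "S \<in> rows n" "length (fst s) = n"
  shows "satisfied S s \<in> rows n"
  unfolding satisfied_def by (intro rows_prune rows_restrict assms)

lemma satisfied_pruned: "pruned (satisfied S s)"
  by (simp add: satisfied_def)

lemma excess_satisfied:
  assumes "S \<in> rows n" "length (fst s) = n"
  shows "chi (fst s) y = pm (sign S (fst s)) \<Longrightarrow> excess (satisfied S s) y = excess S y"
    and "nonzero (fst s) \<Longrightarrow> y \<in> cube n \<Longrightarrow> \<exists>y'\<in>cube n. excess (satisfied S s) y = excess S y'"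
  unfolding satisfied_def excess_prune using excess_restrict[OF assms] by blast+

definition good_entry :: "nat \<Rightarrow> row list \<Rightarrow> row list \<times> row list \<Rightarrow> bool" where
  "good_entry n S0 p \<longleftrightarrow> fst p \<in> rows n \<and> snd p \<in> rows n \<and> specializes n (fst p) (snd p) \<and>
     pruned (fst p) \<and> (\<forall>y\<in>cube n. \<exists>y'\<in>cube n. excess (fst p) y = excess S0 y')"

lemma good_entry_attains:
  assumes "good_entry n S0 p"
  shows "attains n c (fst p) \<Longrightarrow> attains n c S0" "attains n c (snd p) \<Longrightarrow> attains n c (fst p)"
  using assms excess_specializes unfolding good_entry_def attains_def by metis+

text \<open>A point of \<open>F\<close> either falsifies the chosen equation and survives in
  \<open>falsified\<close>, or it corresponds to a point of \<open>S\<close> that satisfies the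
  equation and survives in \<open>satisfied\<close>. Forgetting the earlier falsifications is sound,
  since it only admits further points of \<open>S\<close>.\<close>

lemma good_entry_branch:
  assumes good: "good_entry n S0 (S, F)" and q: "q \<in> set (zip S F)" "nonzero (fst (snd q))"
  shows "good_entry n S0 (satisfied S (fst q), satisfied S (fst q))" (is ?good_satisfied)
    and "good_entry n S0 (S, falsified S F q)" (is ?good_falsified)
    and "attains n c F \<Longrightarrow> attains n c (satisfied S (fst q)) \<or> attains n c (falsified S F q)"
proof -
  have S: "S \<in> rows n" "F \<in> rows n" "specializes n S F" "pruned S"
    "\<And>y. y \<in> cube n \<Longrightarrow> \<exists>y'\<in>cube n. excess S y = excess S0 y'"
    using good by (auto simp: good_entry_def)
  have len: "length (fst (fst q)) = n" "length (fst (snd q)) = n"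
    using rows_mem[OF S(1)] rows_mem[OF S(2)] q(1)
    by (metis set_zip_leftD surjective_pairing, metis set_zip_rightD surjective_pairing)
  have nz: "nonzero (fst (fst q))" by (rule specializes_nonzero[OF S(3,2) q])
  let ?\<sigma> = "sign S (fst (fst q))"
  show ?good_satisfied
    unfolding good_entry_def fst_conv snd_conv
    using satisfied_rows[OF S(1) len(1)] satisfied_pruned specializes_refl S(5)
      excess_satisfied(2)[OF S(1) len(1) nz] by metis
  show ?good_falsified
    unfolding good_entry_def falsified_def fst_conv snd_conv
    using S rows_restrict[OF S(2) len(2)] specializes_restrict[OF S(3,2) len(2) q(2)] by blast
  show "attains n c (satisfied S (fst q)) \<or> attains n c (falsified S F q)" if att: "attains n c F"
  proof -
    obtain y where y: "y \<in> cube n" "excess F y \<ge> c" using att attains_def by blast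
    \<comment> \<open>Paired rows take equal values, so the character of the row in \<open>F\<close>
      is that of the row in \<open>S\<close> times both signs; \<open>?\<tau>\<close> is this
      product when the latter character opposes the net sign.\<close>
    let ?\<tau> = "fst (snd (snd q)) = (fst (snd (fst q)) = (\<not> ?\<sigma>))"
    show ?thesis
    proof (cases "chi (fst (snd q)) y = pm ?\<tau>")
      case True
      then have "excess (falsified S F q) y = excess F y"
        unfolding falsified_def by (rule excess_restrict(1)[OF S(2) len(2)])
      then show ?thesis using y unfolding attains_def by metis
    next
      case False
      then have F: "chi (fst (snd q)) y = - pm ?\<tau>"
        using chi_cases[of "fst (snd q)" y] by (auto simp: pm_def split: if_splits)
      obtain y' where y': "y' \<in> cube n" "excess F y = excess S y'"
         "row_val (snd q) y = row_val (fst q) y'"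
        using excess_specializes[OF S(3) y(1)] q(1) by blast
      have "chi (fst (fst q)) y' = pm ?\<sigma>"
        using y'(3) F by (auto simp: row_val_def pm_def split: if_splits)
      from excess_satisfied(1)[OF S(1) len(1) this] show ?thesis
        using y y' unfolding attains_def by metis
    qed
  qed
qed

section \<open>Invariant and length of the search\<close>

definition search_inv :: "nat \<Rightarrow> int \<Rightarrow> row list \<Rightarrow> bool \<times> (row list \<times> row list) list \<Rightarrow> bool" where
  "search_inv n c S0 a \<longleftrightarrow> (\<forall>p\<in>set (snd a). good_entry n S0 p) \<and>
     (attains n c S0 \<longleftrightarrow> fst a \<or> (\<exists>p\<in>set (snd a). attains n c (snd p)))"

lemma excess_const:
  assumes "\<forall>t\<in>set F. \<not> nonzero (fst t)"
  shows "excess F y = mean F"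
  using assms
proof (induction F)
  case (Cons t F)
  have "row_val t y = pm (fst (snd t))"
    using Cons.prems by (metis chi_zero(1) list.set_intros(1) mult_1_right not_nonzero_iff
      row_val_def)
  then show ?case using Cons by simp
qed simp

lemma search_step_cases:
  obtains (stop) "snd a = []" "search_step k a = a"
  | (success) p ps where "snd a = p # ps" "mean_ge k (fst p) \<or> mean_ge k (snd p)"
      "search_step k a = (True, [])"
  | (fail) S F ps where "snd a = (S, F) # ps" "\<not> mean_ge k S" "\<not> mean_ge k F"
      "search_step k a = (fst a, ps)" "\<forall>q\<in>set (zip S F). \<not> nonzero (fst (snd q))"
  | (branch) S F ps q where "snd a = (S, F) # ps" "\<not> mean_ge k S" "\<not> mean_ge k F"
      "q \<in> set (zip S F)" "nonzero (fst (snd q))"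
      "search_step k a =
        (fst a, (satisfied S (fst q), satisfied S (fst q)) # (S, falsified S F q) # ps)"
proof (cases "snd a")
  case Nil
  then show ?thesis using stop by (simp add: search_step_def)
next
  case (Cons p ps)
  obtain S F where p: "p = (S, F)" by (cases p)
  show ?thesis
  proof (cases "mean_ge k (fst p) \<or> mean_ge k (snd p)")
    case True
    then show ?thesis using success[OF Cons] Cons by (simp add: search_step_def)
  next
    case no: False
    show ?thesis
    proof (cases "filter (\<lambda>q. nonzero (fst (snd q))) (zip S F)")
      case Nil
      then show ?thesis
        using no Cons p by (intro fail) (auto simp: search_step_def filter_empty_conv)
    next
      case (Cons q qs)
      then have "q \<in> set (filter (\<lambda>q. nonzero (fst (snd q))) (zip S F))" by simp
      then have "q \<in> set (zip S F)" "nonzero (fst (snd q))" unfolding set_filter by blast+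
      then show ?thesis
        using no Cons \<open>snd a = p # ps\<close> p by (intro branch[of S F ps q]) (auto simp: search_step_def)
    qed
  qed
qed

lemma search_inv_step:
  assumes inv: "search_inv n (int (val k)) S0 a"
  shows "search_inv n (int (val k)) S0 (search_step k a)"
proof (cases rule: search_step_cases[of a k])
  case stop
  then show ?thesis using inv by simp
next
  case (success p ps)
  then have good: "good_entry n S0 p" using inv by (simp add: search_inv_def)
  then have "attains n (int (val k)) (fst p) \<or> attains n (int (val k)) (snd p)"
    using success(2) attains_mean unfolding mean_ge_iff good_entry_def by blast
  then have "attains n (int (val k)) S0"
    using good_entry_attains[OF good] by blast
  then show ?thesis using success by (simp add: search_inv_def)
next
  case (fail S F ps)
  have good: "good_entry n S0 (S, F)" using inv fail(1) by (simp add: search_inv_def)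
  have "\<not> nonzero (fst t)" if t: "t \<in> set F" for t
  proof -
    have len: "length S = length F" using good by (simp add: good_entry_def specializes_def)
    obtain s where "(s, t) \<in> set (zip S F)" by (rule in_set_impl_in_set_zip2[OF len t])
    then show ?thesis using fail(5) by fastforce
  qed
  then have "\<not> attains n (int (val k)) F"
    using excess_const[of F] fail(3) unfolding attains_def mean_ge_iff by auto
  then show ?thesis using inv fail by (auto simp: search_inv_def)
next
  case (branch S F ps q)
  have good: "good_entry n S0 (S, F)" using inv branch(1) by (simp add: search_inv_def)
  note b = good_entry_branch[OF good branch(4,5)]
  show ?thesis
    using inv b(1,2) b(3)[of "int (val k)"] good_entry_attains[OF b(1)] good_entry_attains[OF b(2)]
    unfolding search_inv_def branch(1,6) by (auto 4 3)
qed

text \<open>The number of variables still occurring in \<open>F\<close>, which limits how many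
  equations can be falsified in succession.\<close>

definition live :: "nat \<Rightarrow> row list \<Rightarrow> nat" where
  "live n F = card {i. i < n \<and> (\<exists>t\<in>set F. fst t ! i)}"

lemma live_le: "live n F \<le> n"
  unfolding live_def using card_mono[of "{..<n}" "{i. i < n \<and> (\<exists>t\<in>set F. fst t ! i)}"] by auto

text \<open>The substitution adds only variables of the row \<open>r\<close>, all of which occur in
  \<open>F\<close> already, and it removes the first of them.\<close>

lemma live_restrict:
  assumes F: "F \<in> rows n" and r: "r \<in> set F" "nonzero (fst r)"
  shows "live n (restrict (fst r) s F) < live n F"
  unfolding live_def
proof (rule psubset_card_mono)
  let ?v = "fst r"
  have len: "length ?v = n" using rows_mem[OF F r(1)] .
  obtain j where j: "j < n" "?v ! j" "first_one ?v = unit n j"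
    using first_one_unit[OF r(2)] len by auto
  have sub: "fst t ! i \<or> ?v ! i" if "fst (restrict_row ?v s t) ! i" "i < n" "t \<in> set F" for i t
    using that len rows_mem[OF F that(3)] by (auto simp: restrict_row_def split: if_splits)
  have "{i. i < n \<and> (\<exists>t\<in>set (restrict ?v s F). fst t ! i)} \<subseteq> {i. i < n \<and> (\<exists>t\<in>set F. fst t ! i)}"
  proof (intro subsetI CollectI conjI)
    fix i assume "i \<in> {i. i < n \<and> (\<exists>t\<in>set (restrict ?v s F). fst t ! i)}"
    then obtain t where t: "i < n" "t \<in> set F" "fst (restrict_row ?v s t) ! i"
      unfolding restrict_eq_map by auto
    show "i < n" by (fact t(1))
    from sub[OF t(3,1,2)] show "\<exists>t\<in>set F. fst t ! i" using t(2) r(1) by blast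
  qed
  moreover have "j \<notin> {i. i < n \<and> (\<exists>t\<in>set (restrict ?v s F). fst t ! i)}"
    using nth_restrict_row[OF len rows_mem[OF F] j] by (auto simp: restrict_eq_map)
  moreover have "j \<in> {i. i < n \<and> (\<exists>t\<in>set F. fst t ! i)}" using j r by auto
  ultimately show "{i. i < n \<and> (\<exists>t\<in>set (restrict ?v s F). fst t ! i)} \<subset>
      {i. i < n \<and> (\<exists>t\<in>set F. fst t ! i)}" by blast
qed simp

text \<open>Among the nonconstant rows exactly those with left-hand side \<open>v\<close> become
  constant, as adding \<open>v\<close> to any other vector does not give zero; rows that are
  constant already lack variable \<open>j\<close> and stay as they are.\<close>

lemma mean_restrict:
  assumes "S \<in> rows n" "length v = n" "nonzero v"
  shows "mean (restrict v s S) = mean S + pm s * coef S v"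
proof -
  obtain j where j: "j < n" "v ! j" "first_one v = unit n j"
    using first_one_unit[OF assms(3)] assms(2) by auto
  show ?thesis using assms(1)
  proof (induction S)
    case (Cons t S)
    have len: "length (fst t) = n" using Cons.prems by simp
    have m: "meets (first_one v) (fst t) \<longleftrightarrow> fst t ! j" using j len by (simp add: meets_unit)
    have x: "nonzero (xor (fst t) v) \<longleftrightarrow> fst t \<noteq> v"
      using xor_eq_zero_iff[OF len assms(2)] len assms(2) not_nonzero_iff[of "xor (fst t) v"] by auto
    have nz: "nonzero (fst t)" if "fst t ! j" using that j len nonzero_iff by blast
    have "fst t \<noteq> v" if "\<not> fst t ! j" using that j by auto
    then show ?case
      using Cons m x nz
      by (cases "fst t ! j")
        (auto simp: restrict_eq_map restrict_row_def row_weight_def pm_eq algebra_simps)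
  qed (simp add: restrict_eq_map)
qed

lemma mean_satisfied:
  assumes "S \<in> rows n" "length (fst s) = n" "nonzero (fst s)" "coef S (fst s) \<noteq> 0"
  shows "mean (satisfied S s) \<ge> mean S + 1"
proof -
  have "mean (satisfied S s) = mean S + pm (sign S (fst s)) * coef S (fst s)"
    unfolding satisfied_def using assms mean_prune[OF rows_restrict[OF assms(1,2)]] mean_restrict
    by metis
  moreover have "pm (sign S (fst s)) * coef S (fst s) \<ge> 1"
    using assms(4) by (auto simp: sign_iff pm_def)
  ultimately show ?thesis by simp
qed

text \<open>
  Satisfying an equation raises the mean, falsifying one kills a coordinate; the base \<open>n + 2\<close> pays
  for the fresh start with all \<open>n\<close> coordinates in the first case.
\<close>

definition potential :: "nat \<Rightarrow> int \<Rightarrow> row list \<times> row list \<Rightarrow> nat" where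
  "potential n c p = (live n (snd p) + 1) * (n + 2) ^ nat (c - mean (fst p))"

lemma potential_pos: "potential n c p \<ge> 1"
  unfolding potential_def by (metis Suc_eq_plus1 add_2_eq_Suc' add_is_0 less_one mult_is_0
    not_less power_not_zero nat.simps(3) zero_neq_one)

lemma potential_branch:
  assumes good: "good_entry n S0 (S, F)" and q: "q \<in> set (zip S F)" "nonzero (fst (snd q))"
    and c: "mean S < c"
  shows "potential n c (satisfied S (fst q), satisfied S (fst q)) + potential n c (S, falsified S
    F q) + 1
    \<le> potential n c (S, F)"
proof -
  have S: "S \<in> rows n" "F \<in> rows n" "specializes n S F" "pruned S"
    using good by (auto simp: good_entry_def)
  have mem: "fst q \<in> set S" "snd q \<in> set F"
    using q(1) by (metis set_zip_leftD surjective_pairing, metis set_zip_rightD surjective_pairing)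
  let ?S = "satisfied S (fst q)" and ?F = "falsified S F q"
  define d where "d = nat (c - mean S - 1)"
  have d: "nat (c - mean S) = Suc d" using c by (simp add: d_def)
  have "mean ?S \<ge> mean S + 1"
    using mean_satisfied[OF S(1) rows_mem[OF S(1) mem(1)] specializes_nonzero[OF S(3,2) q]]
      S(4) mem(1) by (auto simp: pruned_def)
  then have "(n + 2) ^ nat (c - mean ?S) \<le> (n + 2) ^ d"
    by (intro power_increasing) (auto simp: d_def)
  then have 1: "potential n c (?S, ?S) \<le> (n + 1) * (n + 2) ^ d"
    unfolding potential_def using live_le[of n ?S] by (intro mult_le_mono) auto
  have "live n ?F + 1 \<le> live n F"
    using live_restrict[OF S(2) mem(2) q(2)] by (simp add: falsified_def Suc_leI)
  then have 2: "potential n c (S, ?F) \<le> live n F * (n + 2) ^ Suc d"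
    unfolding potential_def fst_conv snd_conv d by (rule mult_right_mono) simp
  have 3: "potential n c (S, F) = live n F * (n + 2) ^ Suc d + (n + 2) ^ Suc d"
    unfolding potential_def fst_conv snd_conv d by (simp add: algebra_simps)
  \<comment> \<open>The second summand is the spare amount that pays for the step itself.\<close>
  have 4: "(n + 2) ^ Suc d = (n + 1) * (n + 2) ^ d + (n + 2) ^ d" by simp
  have 5: "(n + 2) ^ d \<ge> 1" by simp
  show ?thesis using 1 2 3 4 5 by linarith
qed

lemma search_step_potential:
  assumes inv: "search_inv n c S0 a" and c: "c = int (val k)"
  shows "snd (search_step k a) = [] \<or>
    (\<Sum>p\<leftarrow>snd (search_step k a). potential n c p) + 1 \<le> (\<Sum>p\<leftarrow>snd a. potential n c p)"
proof (cases rule: search_step_cases[of a k])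
  case (fail S F ps)
  then show ?thesis using potential_pos[of n c "(S, F)"] by simp
next
  case (branch S F ps q)
  have good: "good_entry n S0 (S, F)" using inv branch(1) by (simp add: search_inv_def)
  have "mean S < c" using branch(2) by (simp add: mean_ge_iff c)
  from potential_branch[OF good branch(4,5) this] show ?thesis
    unfolding branch(1,6) by simp
qed auto

text \<open>Each of the \<open>length S\<close> steps that leaves work to do lowers the total
  potential by at least 1, and remaining work has potential at least 1; so
  \<open>length S + 1\<close> is at most the initial potential.\<close>

lemma search_correct:
  assumes S: "S \<in> rows n" "pruned S" and a_def: "a = search k S" and c_def: "c = int (val k)"
  shows "fst a \<Longrightarrow> attains n c S"
    and "snd a = [] \<Longrightarrow> attains n c S \<Longrightarrow> fst a"
    and "snd a = [] \<or> length S + 1 \<le> (n + 1) * (n + 2) ^ nat (c - mean S)"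
proof -
  let ?s = "\<lambda>a (_ :: row). search_step k a"
  have *: "search_inv n c S (foldl ?s b T) \<and> (snd (foldl ?s b T) = [] \<or>
    (\<Sum>p\<leftarrow>snd (foldl ?s b T). potential n c p) + length T \<le> (\<Sum>p\<leftarrow>snd b. potential n c p))"
    if "search_inv n c S b" for b T
    using that
  proof (induction T arbitrary: b)
    case (Cons t T)
    have inv: "search_inv n c S (search_step k b)" using search_inv_step Cons.prems c_def by blast
    have stop: "snd (foldl ?s e T) = []" if "snd e = []" for e
      using that by (induction T arbitrary: e) (auto simp: search_step_def)
    from search_step_potential[OF Cons.prems c_def] Cons.IH[OF inv] stop[of "search_step k b"]
    show ?case by auto
  qed simp
  have "good_entry n S (S, S)"
    using S specializes_refl by (auto simp: good_entry_def)
  then have "search_inv n c S (False, [(S, S)])"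
    by (simp add: search_inv_def)
  from *[OF this, of S] have inv: "search_inv n c S a" and
    pot: "snd a = [] \<or> (\<Sum>p\<leftarrow>snd a. potential n c p) + length S \<le> potential n c (S, S)"
    by (simp_all add: a_def search_def)
  show "fst a \<Longrightarrow> attains n c S" "snd a = [] \<Longrightarrow> attains n c S \<Longrightarrow> fst a"
    using inv by (auto simp: search_inv_def)
  have "(\<Sum>p\<leftarrow>snd a. potential n c p) \<ge> 1" if "snd a \<noteq> []"
    using that potential_pos by (cases "snd a") (auto intro: trans_le_add1)
  moreover have "potential n c (S, S) \<le> (n + 1) * (n + 2) ^ nat (c - mean S)"
    unfolding potential_def using live_le[of n S] by simp
  ultimately show "snd a = [] \<or> length S + 1 \<le> (n + 1) * (n + 2) ^ nat (c - mean S)"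
    using pot by linarith
qed

section \<open>Many variables and few equations\<close>

definition xor_sum :: "nat \<Rightarrow> bool list list \<Rightarrow> bool list" where
  "xor_sum n vs = foldr xor vs (zero n)"

lemma xor_sum_simps [simp]: "xor_sum n [] = zero n" "xor_sum n (v # vs) = xor v (xor_sum n vs)"
  by (simp_all add: xor_sum_def)

lemma length_xor_sum: "set vs \<subseteq> cube n \<Longrightarrow> length (xor_sum n vs) = n"
  by (induction vs) auto

primrec subsums :: "nat \<Rightarrow> bool list list \<Rightarrow> bool list set" where
  "subsums n [] = {zero n}"
| "subsums n (v # vs) = subsums n vs \<union> xor v ` subsums n vs"

primrec independent :: "nat \<Rightarrow> bool list list \<Rightarrow> bool" where
  "independent n [] \<longleftrightarrow> True"
| "independent n (v # vs) \<longleftrightarrow> v \<notin> subsums n vs \<and> independent n vs"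

lemma subsums_subset: "set vs \<subseteq> cube n \<Longrightarrow> subsums n vs \<subseteq> cube n"
  by (induction vs) auto

lemma zero_in_subsums: "zero n \<in> subsums n vs"
  by (induction vs) auto

lemma subsums_xor:
  assumes "set vs \<subseteq> cube n" "u \<in> set vs" "s \<in> subsums n vs"
  shows "xor u s \<in> subsums n vs"
  using assms
proof (induction vs arbitrary: s)
  case (Cons a vs)
  have len: "length a = n" "length s' = n" if "s' \<in> subsums n vs" for s'
    using Cons.prems(1) subsums_subset[of vs n] that by auto
  consider "s \<in> subsums n vs" | s' where "s' \<in> subsums n vs" "s = xor a s'"
    using Cons.prems(3) by auto
  then show ?case
  proof cases
    case 1
    then show ?thesis using Cons by (cases "u = a") auto
  next
    case 2
    show ?thesis
    proof (cases "u = a")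
      case True
      then show ?thesis using 2 len[OF 2(1)] xor_cancel[of a s'] by simp
    next
      case False
      then have "xor u s' \<in> subsums n vs" using Cons 2 by simp
      moreover have "xor u s = xor a (xor u s')" using 2 by (metis xor_assoc xor_commute)
      ultimately show ?thesis by auto
    qed
  qed
qed simp

lemma mem_subsums: "set vs \<subseteq> cube n \<Longrightarrow> u \<in> set vs \<Longrightarrow> u \<in> subsums n vs"
  using subsums_xor[OF _ _ zero_in_subsums, of vs n u] by (metis cube_iff subsetD xor_zero(2))

lemma independent_distinct: "set vs \<subseteq> cube n \<Longrightarrow> independent n vs \<Longrightarrow> distinct vs"
  by (induction vs) (auto simp: mem_subsums)

text \<open>A Riesz product. For values 1 and -1 of \<open>\<sigma>\<close> it is
  \<open>2 ^ length vs\<close> times the indicator of the points with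
  \<open>chi v y = \<sigma> v\<close> for all \<open>v\<close> in \<open>vs\<close>; it replaces
  conditioning on a subspace without choosing coordinates there.\<close>

primrec tilt :: "(bool list \<Rightarrow> int) \<Rightarrow> bool list list \<Rightarrow> bool list \<Rightarrow> int" where
  "tilt \<sigma> [] y = 1"
| "tilt \<sigma> (v # vs) y = (1 + \<sigma> v * chi v y) * tilt \<sigma> vs y"

lemma tilt_nonneg: "(\<And>v. \<sigma> v = 1 \<or> \<sigma> v = -1) \<Longrightarrow> tilt \<sigma> vs y \<ge> 0"
proof (induction vs)
  case (Cons v vs)
  have "1 + \<sigma> v * chi v y \<ge> 0" using Cons.prems[of v] chi_cases[of v y] by auto
  then show ?case using Cons by simp
qed simp

text \<open>\<open>2 ^ n\<close> times the Fourier coefficient of the tilt at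
  \<open>u\<close>.\<close>

definition tilted_mean :: "nat \<Rightarrow> (bool list \<Rightarrow> int) \<Rightarrow> bool list list \<Rightarrow> bool list \<Rightarrow> int" where
  "tilted_mean n \<sigma> vs u = (\<Sum>y\<in>cube n. chi u y * tilt \<sigma> vs y)"

lemma tilted_mean_Nil: "length u = n \<Longrightarrow> tilted_mean n \<sigma> [] u = (if u = zero n then 2 ^ n else 0)"
  by (simp add: tilted_mean_def sum_chi)

lemma tilted_mean_Cons:
  "length u = n \<Longrightarrow> length v = n \<Longrightarrow>
    tilted_mean n \<sigma> (v # vs) u = tilted_mean n \<sigma> vs u + \<sigma> v * tilted_mean n \<sigma> vs (xor u v)"
  unfolding tilted_mean_def sum_distrib_left sum.distrib[symmetric]
  by (intro sum.cong) (simp_all add: chi_xor algebra_simps)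

text \<open>Multiplying out the product gives only characters of subsums, and any other character is
  orthogonal to them.\<close>

lemma tilted_mean_outside:
  "set vs \<subseteq> cube n \<Longrightarrow> length u = n \<Longrightarrow> u \<notin> subsums n vs \<Longrightarrow> tilted_mean n \<sigma> vs u = 0"
proof (induction vs arbitrary: u)
  case (Cons v vs)
  have "xor u v \<notin> subsums n vs"
  proof
    assume "xor u v \<in> subsums n vs"
    moreover have "u = xor v (xor u v)" using Cons.prems xor_cancel[of v u] by (simp add: xor_commute)
    ultimately show False using Cons.prems(3) by auto
  qed
  then show ?case using Cons by (simp add: tilted_mean_Cons)
qed (simp add: tilted_mean_Nil)

text \<open>By independence only the empty subsum is zero, so the total mass remains that of the
  uniform weight.\<close>

lemma tilted_mean_zero:
  "set vs \<subseteq> cube n \<Longrightarrow> independent n vs \<Longrightarrow> tilted_mean n \<sigma> vs (zero n) = 2 ^ n"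
  by (induction vs) (auto simp: tilted_mean_Nil tilted_mean_Cons tilted_mean_outside)

lemma tilted_mean_member:
  "set vs \<subseteq> cube n \<Longrightarrow> independent n vs \<Longrightarrow> u \<in> set vs \<Longrightarrow> tilted_mean n \<sigma> vs u = \<sigma> u * 2 ^ n"
proof (induction vs)
  case (Cons v vs)
  have len: "length v = n" "length u = n" using Cons.prems by auto
  show ?case
  proof (cases "u = v")
    case True
    then show ?thesis
      using Cons.prems len by (simp add: tilted_mean_Cons tilted_mean_outside xor_self
        tilted_mean_zero)
  next
    case False
    then have u: "u \<in> set vs" using Cons.prems by simp
    have "xor u v \<notin> subsums n vs"
    proof
      assume "xor u v \<in> subsums n vs"
      from subsums_xor[OF _ u this] have "v \<in> subsums n vs"
        using Cons.prems(1) len xor_cancel[of u v] by simp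
      then show False using Cons.prems(2) by simp
    qed
    then show ?thesis using Cons u len by (simp add: tilted_mean_Cons tilted_mean_outside)
  qed
qed simp

text \<open>Averaging against the tilt: left-hand sides outside \<open>vs\<close> contribute 0, each
  member of \<open>vs\<close> contributes the absolute value of its coefficient, hence at least 1,
  and the total mass is \<open>2 ^ n\<close>.\<close>

lemma excess_ge_length:
  assumes S: "S \<in> rows n" "pruned S"
    and vs: "set vs \<subseteq> fst ` set S" "independent n vs" "subsums n vs \<inter> fst ` set S \<subseteq> set vs"
  shows "attains n (int (length vs)) S"
proof (rule ccontr)
  define \<sigma> where "\<sigma> v = pm (sign S v)" for v
  let ?M = "fst ` set S" and ?L = "int (length vs)"
  have M: "?M \<subseteq> cube n" using S(1) by (auto simp: rows_def)
  with vs(1) have vsn: "set vs \<subseteq> cube n" by auto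
  assume "\<not> attains n ?L S"
  then have less: "excess S y \<le> ?L - 1" if "y \<in> cube n" for y
    using that unfolding attains_def by force
  have "(\<Sum>y\<in>cube n. excess S y * tilt \<sigma> vs y) = (\<Sum>v\<in>?M. coef S v * tilted_mean n \<sigma> vs v)"
    unfolding tilted_mean_def sum_distrib_left excess_eq_coef[OF finite_imageI[OF finite_set]
      order_refl]
      sum_distrib_right
    by (subst sum.swap) (simp add: mult.assoc)
  also have "\<dots> = (\<Sum>v\<in>set vs. coef S v * tilted_mean n \<sigma> vs v)"
  proof (intro sum.mono_neutral_right ballI)
    fix v assume "v \<in> ?M - set vs"
    then have "v \<notin> subsums n vs" "length v = n" using vs(3) M by auto
    then show "coef S v * tilted_mean n \<sigma> vs v = 0" using tilted_mean_outside[OF vsn] by simp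
  qed (use vs(1) in auto)
  also have "\<dots> = (\<Sum>v\<in>set vs. \<bar>coef S v\<bar> * 2 ^ n)"
    by (intro sum.cong) (auto simp: tilted_mean_member[OF vsn vs(2)] \<sigma>_def sign_iff pm_def)
  also have "\<dots> \<ge> (\<Sum>v\<in>set vs. 1 * 2 ^ n)"
    using vs(1) S(2) by (intro sum_mono mult_right_mono) (fastforce simp: pruned_def)+
  also have "(\<Sum>v\<in>set vs. 1 * 2 ^ n) = ?L * 2 ^ n"
    using distinct_card[OF independent_distinct[OF vsn vs(2)]] by simp
  finally have "?L * 2 ^ n \<le> (\<Sum>y\<in>cube n. excess S y * tilt \<sigma> vs y)" .
  also have "\<dots> \<le> (\<Sum>y\<in>cube n. (?L - 1) * tilt \<sigma> vs y)"
    using less tilt_nonneg[of \<sigma> vs] by (intro sum_mono mult_right_mono) (auto simp: \<sigma>_def pm_def)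
  also have "\<dots> = (?L - 1) * 2 ^ n"
    using tilted_mean_zero[OF vsn vs(2), of \<sigma>] by (simp add: tilted_mean_def
      sum_distrib_left[symmetric])
  finally show False by simp
qed

section \<open>Shortest representations\<close>

definition shortest :: "nat \<Rightarrow> bool list set \<Rightarrow> bool list list \<Rightarrow> bool" where
  "shortest n M vs \<longleftrightarrow> (\<forall>ws. set ws \<subseteq> M \<longrightarrow> xor_sum n ws = xor_sum n vs \<longrightarrow> length vs \<le> length ws)"

text \<open>\<open>as\<close> are the terms of the subsum and \<open>bs\<close> the others; the
  equation on lengths is what minimality gets applied to.\<close>

lemma subsums_split:
  assumes "set vs \<subseteq> cube n" "s \<in> subsums n vs"
  shows "\<exists>as bs. set as \<subseteq> set vs \<and> set bs \<subseteq> set vs \<and> length as + length bs = length vs \<and>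
    xor_sum n as = s \<and> xor s (xor_sum n bs) = xor_sum n vs"
  using assms
proof (induction vs arbitrary: s)
  case Nil
  then show ?case by (intro exI[of _ "[]"]) simp
next
  case (Cons v vs)
  consider "s \<in> subsums n vs" | s' where "s' \<in> subsums n vs" "s = xor v s'"
    using Cons.prems(2) by auto
  then show ?case
  proof cases
    case 1
    then obtain as bs where "set as \<subseteq> set vs" "set bs \<subseteq> set vs" "length as + length bs = length vs"
      "xor_sum n as = s" "xor s (xor_sum n bs) = xor_sum n vs"
      using Cons.IH[of s] Cons.prems(1) by auto
    moreover from this have "xor s (xor v (xor_sum n bs)) = xor v (xor_sum n vs)"
      by (metis xor_assoc xor_commute)
    ultimately show ?thesis by (intro exI[of _ as] exI[of _ "v # bs"]) auto
  next
    case 2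
    then obtain as bs where "set as \<subseteq> set vs" "set bs \<subseteq> set vs" "length as + length bs = length vs"
      "xor_sum n as = s'" "xor s' (xor_sum n bs) = xor_sum n vs"
      using Cons.IH[of s'] Cons.prems(1) by auto
    then show ?thesis using 2 by (intro exI[of _ "v # as"] exI[of _ bs]) (auto simp: xor_assoc)
  qed
qed

lemma shortest_tl:
  assumes "shortest n M (v # vs)" "v \<in> M"
  shows "shortest n M vs"
  unfolding shortest_def
proof (intro allI impI)
  fix ws assume "set ws \<subseteq> M" "xor_sum n ws = xor_sum n vs"
  then show "length vs \<le> length ws"
    using assms unfolding shortest_def by (metis Suc_le_mono insert_subset length_Cons
      list.simps(15) xor_sum_simps(2))
qed

text \<open>A head that is a subsum of the tail cancels against those terms, and the remaining
  \<open>bs\<close> form a shorter representation.\<close>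

lemma shortest_independent:
  "shortest n M vs \<Longrightarrow> set vs \<subseteq> M \<Longrightarrow> M \<subseteq> cube n \<Longrightarrow> independent n vs"
proof (induction vs)
  case (Cons v vs)
  have vsn: "set vs \<subseteq> cube n" using Cons.prems by auto
  have "v \<notin> subsums n vs"
  proof
    assume "v \<in> subsums n vs"
    then obtain as bs :: "bool list list" where *: "set bs \<subseteq> set vs" "length as + length bs =
      length vs"
      "xor v (xor_sum n bs) = xor_sum n vs"
      using subsums_split[OF vsn] by blast
    have "length (xor_sum n bs) = n" "length v = n"
      using *(1) Cons.prems length_xor_sum[of bs n] by auto
    then have "xor_sum n (v # vs) = xor_sum n bs"
      using xor_cancel[of v "xor_sum n bs"] *(3) by simp
    moreover have "set bs \<subseteq> M" using *(1) Cons.prems by auto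
    ultimately have "length (v # vs) \<le> length bs"
      using Cons.prems(1) unfolding shortest_def by metis
    then show False using *(2) by simp
  qed
  then show ?case using Cons shortest_tl[of n M v vs] by simp
qed simp

text \<open>A subsum that lies in \<open>M\<close> can replace its terms \<open>as\<close> by
  itself, so minimality allows only one such term.\<close>

lemma shortest_sum_free:
  assumes "shortest n M vs" "set vs \<subseteq> M" "M \<subseteq> cube n" "zero n \<notin> M"
  shows "subsums n vs \<inter> M \<subseteq> set vs"
proof
  fix s assume s: "s \<in> subsums n vs \<inter> M"
  then obtain as bs where *: "set as \<subseteq> set vs" "set bs \<subseteq> set vs" "length as + length bs = length vs"
    "xor_sum n as = s" "xor s (xor_sum n bs) = xor_sum n vs"
    using subsums_split[of vs n s] assms by auto
  have "set (s # bs) \<subseteq> M" "xor_sum n (s # bs) = xor_sum n vs" using *(2,5) s assms(2) by auto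
  then have "length vs \<le> length (s # bs)"
    using assms(1) unfolding shortest_def by blast
  then have "length as \<le> 1" using *(3) by simp
  then consider "as = []" | a where "as = [a]" by (cases as) auto
  then show "s \<in> set vs"
  proof cases
    case 1
    then show ?thesis using *(4) s assms(4) by auto
  next
    case 2
    then have "length a = n" using *(1) assms(2,3) by auto
    then show ?thesis using 2 *(1,4) by simp
  qed
qed

lemma units_span:
  assumes "\<And>j. j < n \<Longrightarrow> unit n j \<in> M" "length u = n"
  shows "\<exists>vs. set vs \<subseteq> M \<and> xor_sum n vs = u"
  using assms(2)
proof (induction "card {j. j < n \<and> u ! j}" arbitrary: u rule: less_induct)
  case less
  show ?case
  proof (cases "nonzero u")
    case False
    then show ?thesis using less.prems not_nonzero_iff[of u] by (intro exI[of _ "[]"]) simp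
  next
    case True
    then obtain j where j: "j < n" "u ! j" using nonzero_iff less.prems by auto
    let ?v = "xor u (unit n j)"
    have "?v ! i \<longleftrightarrow> u ! i \<noteq> (i = j)" if "i < n" for i using that less.prems by simp
    then have "{i. i < n \<and> ?v ! i} = {i. i < n \<and> u ! i} - {j}" using j by blast
    then have "card {i. i < n \<and> ?v ! i} < card {i. i < n \<and> u ! i}"
      using card_Diff1_less[of "{i. i < n \<and> u ! i}" j] j by simp
    moreover have "length ?v = n" using less.prems by simp
    ultimately obtain vs where "set vs \<subseteq> M" "xor_sum n vs = ?v"
      using less.hyps by blast
    moreover have "xor (unit n j) ?v = u"
      using xor_cancel[of "unit n j" u] less.prems by (simp add: xor_commute)
    ultimately show ?thesis using assms(1)[OF j(1)] by (intro exI[of _ "unit n j # vs"]) simp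
  qed
qed

lemma xor_sum_pad:
  "set vs \<subseteq> cube n \<Longrightarrow> xor_sum n (vs @ replicate k (zero n)) = xor_sum n vs"
proof (induction vs)
  case Nil
  show ?case by (induction k) simp_all
qed simp

text \<open>
  Counting yields a vector that is not a sum of at most \<open>L\<close> left-hand sides.  No subsum of a
  shortest representation of it is again a left-hand side, apart from its members, so all equations
  of the representation can be satisfied without affecting the mean of the others.
\<close>

lemma attains_of_few_rows:
  assumes S: "S \<in> rows n" "pruned S" and nonzero: "zero n \<notin> fst ` set S"
    and units: "\<And>j. j < n \<Longrightarrow> unit n j \<in> fst ` set S"
    and few: "(length S + 1) ^ L < 2 ^ n"
  shows "attains n (int (L + 1)) S"
proof -
  \<comment> \<open>With the zero vector added, lists of length exactly \<open>L\<close> represent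
    all sums of at most \<open>L\<close> left-hand sides.\<close>
  let ?M = "fst ` set S" and ?A = "insert (zero n) (fst ` set S)"
  let ?W = "{ws. set ws \<subseteq> ?A \<and> length ws = L}"
  have M: "?M \<subseteq> cube n" using S(1) by (auto simp: rows_def)
  have "card ?M \<le> length S"
    by (rule order_trans[OF card_image_le card_length]) simp
  then have "card ?A \<le> length S + 1"
    using nonzero by simp
  then have "card (xor_sum n ` ?W) \<le> (length S + 1) ^ L"
    using card_image_le[of ?W "xor_sum n"] card_lists_length_eq[of ?A L] finite_lists_length_eq[of
      ?A L]
      power_mono[of "card ?A" "length S + 1" L] by simp
  then have "card (xor_sum n ` ?W) < card (cube n)" using few by simp
  then have "\<not> cube n \<subseteq> xor_sum n ` ?W"
    using card_mono[of "xor_sum n ` ?W" "cube n"] finite_lists_length_eq[of ?A L] by auto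
  then obtain u where u: "u \<in> cube n" "u \<notin> xor_sum n ` ?W" by blast
  obtain vs0 where vs0: "set vs0 \<subseteq> ?M" "xor_sum n vs0 = u"
    using units_span[of n ?M u] units u(1) by auto
  define vs where "vs = arg_min length (\<lambda>vs. set vs \<subseteq> ?M \<and> xor_sum n vs = u)"
  have vs: "set vs \<subseteq> ?M" "xor_sum n vs = u"
    using arg_min_natI[of "\<lambda>vs. set vs \<subseteq> ?M \<and> xor_sum n vs = u" vs0 length] vs0
    unfolding vs_def by auto
  have short: "shortest n ?M vs"
    unfolding shortest_def vs(2)
    using arg_min_nat_le[of "\<lambda>vs. set vs \<subseteq> ?M \<and> xor_sum n vs = u" _ length]
    unfolding vs_def by auto
  have "length vs \<ge> L + 1"
  proof (rule ccontr)
    assume "\<not> ?thesis"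
    then have "vs @ replicate (L - length vs) (zero n) \<in> ?W" using vs(1) by auto
    moreover have "xor_sum n (vs @ replicate (L - length vs) (zero n)) = u"
      using xor_sum_pad[of vs n] vs M by auto
    ultimately show False using u(2) by blast
  qed
  moreover have "attains n (int (length vs)) S"
    by (rule excess_ge_length[OF S vs(1) shortest_independent[OF short vs(1) M]
      shortest_sum_free[OF short vs(1) M nonzero]])
  ultimately show ?thesis unfolding attains_def by force
qed

section \<open>Eliminating variables\<close>

definition map_vec :: "(bool list \<Rightarrow> bool list) \<Rightarrow> row list \<Rightarrow> row list" where
  "map_vec f S = map (\<lambda>t. (f (fst t), snd t)) S"

lemma set_map_vec: "fst ` set (map_vec f S) = f ` fst ` set S"
  unfolding map_vec_def by (auto simp: image_image)

text \<open>Injectivity keeps rows with different left-hand sides apart, so no new cancellation can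
  arise.\<close>

lemma coef_map_vec:
  assumes "inj_on f A" "fst ` set S \<subseteq> A" "u \<in> A"
  shows "coef (map_vec f S) (f u) = coef S u"
  using assms(2)
proof (induction S)
  case (Cons t S)
  have "f (fst t) = f u \<longleftrightarrow> fst t = u"
    using assms(1,3) Cons.prems by (auto dest: inj_onD)
  then show ?case using Cons by (simp add: map_vec_def row_weight_def)
qed (simp add: map_vec_def)

lemma pruned_map_vec:
  assumes "inj_on f (fst ` set S)" "pruned S"
  shows "pruned (map_vec f S)"
  unfolding pruned_def
proof
  fix t assume "t \<in> set (map_vec f S)"
  then obtain r where r: "r \<in> set S" "fst t = f (fst r)" by (auto simp: map_vec_def)
  then have "coef (map_vec f S) (f (fst r)) = coef S (fst r)"
    by (intro coef_map_vec[OF assms(1)]) auto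
  then show "coef (map_vec f S) (fst t) \<noteq> 0" using r assms(2) by (auto simp: pruned_def)
qed

lemma excess_map_vec:
  assumes "\<And>t. t \<in> set S \<Longrightarrow> chi (f (fst t)) y = chi (fst t) y'"
  shows "excess (map_vec f S) y = excess S y'"
  using assms by (induction S) (auto simp: map_vec_def row_val_def row_weight_def)

text \<open>
  The substitution that turns the equation with left-hand side \<open>v\<close> into one for the single
  variable \<open>j\<close>.
\<close>

definition substitute :: "nat \<Rightarrow> bool list \<Rightarrow> bool list \<Rightarrow> bool list" where
  "substitute j v u = (if u ! j then xor u (v[j := False]) else u)"

lemma length_substitute [simp]: "length v = length u \<Longrightarrow> length (substitute j v u) = length u"
  by (simp add: substitute_def)

lemma nth_substitute:
  "length u = n \<Longrightarrow> length v = n \<Longrightarrow> i < n \<Longrightarrow>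
    substitute j v u ! i \<longleftrightarrow> u ! i \<noteq> (u ! j \<and> v ! i \<and> i \<noteq> j)"
  by (cases "i = j") (auto simp: substitute_def)

lemma substitute_self: "j < length v \<Longrightarrow> v ! j \<Longrightarrow> substitute j v v = unit (length v) j"
  by (rule nth_equalityI) (auto simp: nth_substitute)

lemma substitute_unit: "j < n \<Longrightarrow> i \<noteq> j \<Longrightarrow> substitute j v (unit n i) = unit n i"
  by (simp add: substitute_def)

lemma inj_on_substitute:
  assumes "length v = n" "j < n"
  shows "inj_on (substitute j v) (cube n)"
proof (rule inj_on_inverseI)
  fix u assume "u \<in> cube n"
  then show "substitute j v (substitute j v u) = u"
    using assms by (intro nth_equalityI) (auto simp: nth_substitute)
qed

text \<open>The dual map on points flips bit \<open>j\<close> iff the character of \<open>v\<close>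
  without \<open>j\<close> is -1 there. The flip does not affect this condition, so the map is an
  involution and the same point \<open>z\<close> serves both directions.\<close>

lemma chi_substitute:
  assumes "length v = n" "j < n" "length y = n"
  shows "\<exists>y'\<in>cube n. \<forall>u\<in>cube n. chi (substitute j v u) y = chi u y'"
    and "\<exists>y'\<in>cube n. \<forall>u\<in>cube n. chi (substitute j v u) y' = chi u y"
proof -
  let ?w = "v[j := False]"
  define z where "z = (if chi ?w y = 1 then y else xor y (unit n j))"
  have flip: "chi u (xor y (unit n j)) = chi u y * (if u ! j then -1 else 1)" if "length u = n" for u
    using that assms chi_unit[of j u] by (simp add: chi_xor_right)
  have z: "z \<in> cube n" using assms(3) by (simp add: z_def)
  have 1: "chi (substitute j v u) y = chi u z" if "u \<in> cube n" for u
    using that assms flip[of u] chi_cases[of ?w y]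
    by (auto simp: substitute_def z_def chi_xor)
  have w: "chi ?w z = chi ?w y" using flip[of ?w] assms by (simp add: z_def)
  have 2: "chi (substitute j v u) z = chi u y" if "u \<in> cube n" for u
    using that assms flip[of u] chi_cases[of ?w y] w
    by (auto simp: substitute_def chi_xor z_def)
  show "\<exists>y'\<in>cube n. \<forall>u\<in>cube n. chi (substitute j v u) y = chi u y'" using 1 z by blast
  show "\<exists>y'\<in>cube n. \<forall>u\<in>cube n. chi (substitute j v u) y' = chi u y" using 2 z by blast
qed

lemma excess_substitute:
  assumes "S \<in> rows n" "length v = n" "j < n"
  shows "excess (map_vec (substitute j v) S) ` cube n = excess S ` cube n"
proof -
  have mem: "t \<in> set S \<Longrightarrow> fst t \<in> cube n" for t using rows_mem[OF assms(1)] by simp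
  show ?thesis
  proof (intro equalityI subsetI)
    fix a assume "a \<in> excess (map_vec (substitute j v) S) ` cube n"
    then obtain y where y: "length y = n" "a = excess (map_vec (substitute j v) S) y" by auto
    obtain y' where y': "y' \<in> cube n" "\<forall>u\<in>cube n. chi (substitute j v u) y = chi u y'"
      using chi_substitute(1)[OF assms(2,3) y(1)] by blast
    then have "a = excess S y'" using y(2) excess_map_vec[of S "substitute j v" y y'] mem by blast
    then show "a \<in> excess S ` cube n" using y'(1) by blast
  next
    fix a assume "a \<in> excess S ` cube n"
    then obtain y where y: "length y = n" "a = excess S y" by auto
    obtain y' where y': "y' \<in> cube n" "\<forall>u\<in>cube n. chi (substitute j v u) y' = chi u y"
      using chi_substitute(2)[OF assms(2,3) y(1)] by blast
    then have "a = excess (map_vec (substitute j v) S) y'"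
      using y(2) excess_map_vec[of S "substitute j v" y' y] mem by metis
    then show "a \<in> excess (map_vec (substitute j v) S) ` cube n" using y'(1) by blast
  qed
qed

lemma pivot_cases:
  assumes S: "S \<in> rows n" "j < n" and d: "d = replicate j False @ True # zeros ds" "length d \<ge> n"
  obtains "\<forall>u\<in>fst ` set S. \<not> u ! j" "pivot d S = S"
  | v where "v \<in> fst ` set S" "v ! j" "pivot d S = map_vec (substitute j v) S"
proof -
  have nth: "d ! i \<longleftrightarrow> i = j" if "i < length d" for i
    using that d(1) by (auto simp: nth_append nth_Cons zeros_def split: nat.splits)
  have meets: "meets d u \<longleftrightarrow> u ! j" if "length u = n" for u
    using that nth S(2) d(2) by (auto simp: meets_iff)
  have diff: "diff v d = v[j := False]" if "length v = n" for v
  proof (rule nth_equalityI)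
    show "diff v d ! i \<longleftrightarrow> v[j := False] ! i" if "i < length (diff v d)" for i
      using that nth[of i] \<open>length v = n\<close> S(2) by (cases "i = j") (auto simp: diff_def)
  qed (use that d(2) in \<open>simp add: diff_def\<close>)
  show ?thesis
  proof (cases "filter (\<lambda>t. meets d (fst t)) S")
    case Nil
    then have "\<forall>t\<in>set S. \<not> meets d (fst t)" by (simp add: filter_empty_conv)
    then have "\<forall>u\<in>fst ` set S. \<not> u ! j" using meets rows_mem[OF S(1)] by auto
    moreover have "pivot d S = S" using Nil by (simp add: pivot_def)
    ultimately show ?thesis by (rule that(1))
  next
    case (Cons t ts)
    then have "t \<in> set (filter (\<lambda>t. meets d (fst t)) S)" by simp
    then have t: "t \<in> set S" "meets d (fst t)" unfolding set_filter by blast+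
    note len = rows_mem[OF S(1) t(1)]
    have "pivot d S = map_vec (substitute j (fst t)) S"
      unfolding pivot_def Cons list.case map_vec_def
    proof (intro map_cong refl)
      fix r assume "r \<in> set S"
      then have "length (fst r) = n" using rows_mem[OF S(1)] by blast
      then show "(if meets d (fst r) then (xor (fst r) (diff (fst t) d), snd r) else r) =
          (substitute j (fst t) (fst r), snd r)"
        by (simp add: meets diff[OF len] substitute_def)
    qed
    then show ?thesis using that(2)[of "fst t"] t meets[OF len] by blast
  qed
qed

definition equivalent :: "nat \<Rightarrow> row list \<Rightarrow> nat \<Rightarrow> row list \<Rightarrow> bool" where
  "equivalent n S n' S' \<longleftrightarrow> S' \<in> rows n' \<and> pruned S' \<and> zero n' \<notin> fst ` set S' \<and>
     excess S' ` cube n' = excess S ` cube n"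

text \<open>Earlier columns keep their state: other unit vectors lack bit \<open>j\<close> and are
  fixed by the substitution, and a column empty in all rows is empty in \<open>v\<close> as
  well.\<close>

lemma equivalent_pivot:
  assumes S: "equivalent n S0 n S" and j: "j < n" and d: "d = replicate j False @ True # zeros ds"
    "length d \<ge> n"
    and prev: "\<forall>i<j. unit n i \<in> fst ` set S \<or> (\<forall>u\<in>fst ` set S. \<not> u ! i)"
  shows "equivalent n S0 n (pivot d S) \<and>
    (\<forall>i<Suc j. unit n i \<in> fst ` set (pivot d S) \<or> (\<forall>u\<in>fst ` set (pivot d S). \<not> u ! i))"
proof -
  have rows: "S \<in> rows n" using S by (simp add: equivalent_def)
  show ?thesis
  proof (cases rule: pivot_cases[OF rows j d])
    case 1
    then show ?thesis using S prev by (auto simp: less_Suc_eq)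
  next
    case (2 v)
    let ?f = "substitute j v"
    have cube: "fst ` set S \<subseteq> cube n" using rows by (auto simp: rows_def)
    then have v: "length v = n" using 2(1) by auto
    note inj = inj_on_substitute[OF v j]
    have "map_vec ?f S \<in> rows n"
      using rows v by (auto simp: rows_def map_vec_def)
    moreover have "pruned (map_vec ?f S)"
      using pruned_map_vec[OF inj_on_subset[OF inj cube]] S by (simp add: equivalent_def)
    moreover have "zero n \<notin> fst ` set (map_vec ?f S)"
    proof
      assume "zero n \<in> fst ` set (map_vec ?f S)"
      then obtain u where u: "u \<in> fst ` set S" "?f u = zero n" unfolding set_map_vec by (metis imageE)
      have "?f (zero n) = zero n" using j by (simp add: substitute_def)
      then have "u = zero n" using inj_onD[OF inj, of u "zero n"] u cube by auto
      then show False using u(1) S by (simp add: equivalent_def)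
    qed
    moreover have "excess (map_vec ?f S) ` cube n = excess S0 ` cube n"
      using excess_substitute[OF rows v j] S by (simp add: equivalent_def)
    moreover have "unit n i \<in> ?f ` fst ` set S \<or> (\<forall>u\<in>?f ` fst ` set S. \<not> u ! i)" if "i < Suc j" for i
    proof (cases "i = j")
      case True
      have "?f v = unit n i" using substitute_self[of j v] 2(2) v j True by simp
      then show ?thesis using 2(1) by (metis image_eqI)
    next
      case False
      then have i: "i < j" using that by simp
      consider "unit n i \<in> fst ` set S" | "\<forall>u\<in>fst ` set S. \<not> u ! i" using prev i by blast
      then show ?thesis
      proof cases
        case 1
        then show ?thesis using substitute_unit[OF j False, of v] by (metis image_eqI)
      next
        case zero: 2
        then have "\<not> v ! i" using 2(1) by blast
        then have "\<not> ?f u ! i" if "u \<in> fst ` set S" for u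
          using nth_substitute[of u n v i j] zero that cube v i j by auto
        then show ?thesis by blast
      qed
    qed
    ultimately show ?thesis unfolding equivalent_def 2(3) set_map_vec by blast
  qed
qed

lemma gauss_correct:
  assumes S: "equivalent (length ns) S0 (length ns) S"
  defines "n \<equiv> length ns"
  shows "equivalent n S0 n (gauss ns S) \<and>
    (\<forall>i<n. unit n i \<in> fst ` set (gauss ns S) \<or> (\<forall>u\<in>fst ` set (gauss ns S). \<not> u ! i))"
proof -
  let ?s = "\<lambda>a (_ :: bool). (False # fst a, pivot (fst a) (snd a))"
  let ?r = "\<lambda>j. foldl ?s (True # zeros ns, S) (take j ns)"
  have "fst (?r j) = replicate j False @ True # zeros ns \<and> equivalent n S0 n (snd (?r j)) \<and>
    (\<forall>i<j. unit n i \<in> fst ` set (snd (?r j)) \<or> (\<forall>u\<in>fst ` set (snd (?r j)). \<not> u ! i))"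
    if "j \<le> n" for j
    using that
  proof (induction j)
    case 0
    then show ?case using S by (simp add: n_def)
  next
    case (Suc j)
    have step: "?r (Suc j) = ?s (?r j) (ns ! j)"
      using Suc.prems by (simp add: take_Suc_conv_app_nth n_def)
    from Suc have IH: "fst (?r j) = replicate j False @ True # zeros ns" "equivalent n S0 n (snd
      (?r j))"
      "\<forall>i<j. unit n i \<in> fst ` set (snd (?r j)) \<or> (\<forall>u\<in>fst ` set (snd (?r j)). \<not> u ! i)" by auto
    have "j < n" "length (fst (?r j)) \<ge> n" using Suc.prems by (simp_all add: IH(1) n_def)
    from equivalent_pivot[OF IH(2) this(1) IH(1) this(2) IH(3)] show ?case
      unfolding step by (simp add: IH(1))
  qed
  from this[of n] show ?thesis unfolding gauss_def by (simp add: n_def)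
qed

subsection \<open>Deleting unused variables\<close>

definition below :: "bool list \<Rightarrow> bool list \<Rightarrow> bool" where
  "below u m \<longleftrightarrow> list_all2 (\<lambda>a b. a \<longrightarrow> b) u m"

lemma select_simps [simp]: "select [] v = []" "select (b # m) (a # v) = (if b then a # select m v
  else select m v)"
  by (simp_all add: select_def)

lemma length_select: "length v = length m \<Longrightarrow> length (select m v) = length (filter (\<lambda>b. b) m)"
  by (induction v m rule: list_induct2) auto

lemma chi_select:
  assumes "below u m" "length y = length m"
  shows "chi (select m u) (select m y) = chi u y"
proof -
  have "length u = length m" "length m = length y"
    using assms by (simp_all add: below_def list_all2_lengthD)
  from this assms(1) show ?thesis
    by (induction u m y rule: list_induct3) (auto simp: below_def)
qed

lemma inj_on_select: "inj_on (select m) {u. below u m}"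
proof (rule inj_onI)
  fix u v assume "u \<in> {u. below u m}" "v \<in> {u. below u m}" "select m u = select m v"
  then show "u = v"
  proof (induction m arbitrary: u v)
    case (Cons b m)
    then show ?case by (cases u; cases v; cases b) (auto simp: below_def)
  qed (auto simp: below_def)
qed

lemma select_surj: "length z = length (filter (\<lambda>b. b) m) \<Longrightarrow> \<exists>y. length y = length m \<and> select m y = z"
proof (induction m arbitrary: z)
  case (Cons b m)
  show ?case
  proof (cases b)
    case True
    then obtain a z' where z: "z = a # z'" "length z' = length (filter (\<lambda>b. b) m)"
      using Cons.prems by (cases z) auto
    then obtain y where "length y = length m" "select m y = z'" using Cons.IH by blast
    then show ?thesis using z True by (intro exI[of _ "a # y"]) simp
  next
    case False
    then obtain y where "length y = length m" "select m y = z" using Cons by auto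
    then show ?thesis using False by (intro exI[of _ "False # y"]) simp
  qed
qed simp

lemma select_zero: "select m (zero (length m)) = zero (length (filter (\<lambda>b. b) m))"
  by (induction m) (auto simp: zero_def)

lemma select_unit:
  "k < length (filter (\<lambda>b. b) m) \<Longrightarrow>
    \<exists>i<length m. m ! i \<and> select m (unit (length m) i) = unit (length (filter (\<lambda>b. b) m)) k"
proof (induction m arbitrary: k)
  case (Cons b m)
  have z: "select m (replicate (length m) False) = replicate (length (filter (\<lambda>b. b) m)) False"
    using select_zero[of m] by (simp add: zero_def)
  show ?case
  proof (cases "b \<and> k = 0")
    case True
    then show ?thesis by (intro exI[of _ 0]) (simp add: unit_def zero_def z)
  next
    case False
    define l where "l = (if b then k - 1 else k)"
    have "l < length (filter (\<lambda>b. b) m)" using False Cons.prems by (auto simp: l_def)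
    then obtain i where "i < length m" "m ! i"
      "select m (unit (length m) i) = unit (length (filter (\<lambda>b. b) m)) l"
      using Cons.IH by blast
    then show ?thesis
      using False by (intro exI[of _ "Suc i"]) (cases b; cases k; simp add: unit_def zero_def l_def)
  qed
qed simp

lemma support_iff:
  assumes "S \<in> rows (length ns)"
  shows "length (support ns S) = length ns \<and>
    (\<forall>i<length ns. support ns S ! i \<longleftrightarrow> (\<exists>u\<in>fst ` set S. u ! i))"
proof -
  have "length (foldl (\<lambda>m t. union m (fst t)) m S) = n \<and>
      (\<forall>i<n. foldl (\<lambda>m t. union m (fst t)) m S ! i \<longleftrightarrow> m ! i \<or> (\<exists>u\<in>fst ` set S. u ! i))"
    if "length m = n" "S \<in> rows n" for m n
    using that
  proof (induction S arbitrary: m)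
    case (Cons t S)
    have "length (union m (fst t)) = n" "\<And>i. i < n \<Longrightarrow> union m (fst t) ! i \<longleftrightarrow> m ! i \<or> fst t ! i"
      using Cons.prems by (simp_all add: union_def)
    then show ?case using Cons.IH[of "union m (fst t)"] Cons.prems by auto
  qed simp
  from this[of "zeros ns" "length ns"] assms show ?thesis
    by (simp add: support_def zeros_def)
qed

text \<open>The deleted variables occur in no row, so all characters are unchanged. A column that is
  kept is nonempty, so \<open>units\<close> provides its unit vector as a left-hand side.\<close>

lemma compress_correct:
  assumes S: "equivalent (length ns) S0 (length ns) S"
    and units: "\<forall>i<length ns. unit (length ns) i \<in> fst ` set S \<or> (\<forall>u\<in>fst ` set S. \<not> u ! i)"
    and c: "compress ns S = (R, S')"
  shows "R = replicate (length R) True" "equivalent (length ns) S0 (length R) S'"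
    "\<forall>k<length R. unit (length R) k \<in> fst ` set S'" "map snd S' = map snd S"
proof -
  let ?n = "length ns" and ?r = "length R"
  define m where "m = support ns S"
  have R: "R = filter (\<lambda>b. b) m" and S': "S' = map_vec (select m) S"
    using c by (simp_all add: compress_def m_def map_vec_def)
  have rows: "S \<in> rows ?n" using S by (simp add: equivalent_def)
  have m: "length m = ?n" "\<And>i. i < ?n \<Longrightarrow> m ! i \<longleftrightarrow> (\<exists>u\<in>fst ` set S. u ! i)"
    using support_iff[OF rows] by (auto simp: m_def)
  have below: "below u m" if "u \<in> fst ` set S" for u
    unfolding below_def list_all2_conv_all_nth using m that rows_mem[OF rows] by fastforce
  have inj: "inj_on (select m) (fst ` set S)"
    using inj_on_subset[OF inj_on_select] below by blast
  show "R = replicate ?r True"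
    unfolding R by (intro replicate_eqI) auto
  show "map snd S' = map snd S" by (simp add: S' map_vec_def)
  show "\<forall>k<?r. unit ?r k \<in> fst ` set S'"
  proof (intro allI impI)
    fix k assume "k < ?r"
    then obtain i where i: "i < ?n" "m ! i" "select m (unit ?n i) = unit ?r k"
      using select_unit[of k m] m(1) by (auto simp: R)
    then have "unit ?n i \<in> fst ` set S" using units m(2) by blast
    then show "unit ?r k \<in> fst ` set S'" unfolding S' set_map_vec using i(3) by (metis image_eqI)
  qed
  have "S' \<in> rows ?r"
    using length_select m(1) rows_mem[OF rows] by (auto simp: rows_def S' map_vec_def R)
  moreover have "pruned S'"
    unfolding S' using pruned_map_vec[OF inj] S by (simp add: equivalent_def)
  moreover have "zero ?r \<notin> fst ` set S'"
  proof
    assume "zero ?r \<in> fst ` set S'"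
    then obtain u where u: "u \<in> fst ` set S" "select m u = zero ?r"
      unfolding S' set_map_vec by (metis imageE)
    have "below (zero ?n) m" by (simp add: below_def list_all2_conv_all_nth m(1))
    moreover have "select m (zero ?n) = zero ?r" using select_zero[of m] by (simp add: m(1) R)
    ultimately have "u = zero ?n" using inj_onD[OF inj_on_select, of m u "zero ?n"] u below by simp
    then show False using u(1) S by (simp add: equivalent_def)
  qed
  moreover have "excess S' ` cube ?r = excess S ` cube ?n"
  proof -
    have *: "excess S' (select m y) = excess S y" if "y \<in> cube ?n" for y
      unfolding S' using that below m(1) by (intro excess_map_vec chi_select) auto
    have "select m ` cube ?n = cube ?r"
    proof (intro equalityI subsetI)
      fix z assume "z \<in> cube ?r"
      then show "z \<in> select m ` cube ?n" using select_surj[of z m] m(1) by (auto simp: R)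
    qed (use length_select m(1) in \<open>auto simp: R\<close>)
    then have "excess S' ` cube ?r = (\<lambda>y. excess S' (select m y)) ` cube ?n" by (metis image_image)
    also have "\<dots> = excess S ` cube ?n" using * by (intro image_cong) auto
    finally show ?thesis .
  qed
  ultimately show "equivalent ?n S0 ?r S'" using S by (simp add: equivalent_def)
qed

lemma equivalent_attains: "equivalent n S n' S' \<Longrightarrow> attains n' c S' \<longleftrightarrow> attains n c S"
  unfolding equivalent_def attains_def by (metis (no_types, lifting) image_iff)

section \<open>The number of variables\<close>

lemma val_less_power: "val bs < 2 ^ length bs"
  by (induction bs) auto

lemma power_length_bits_le: "0 < k \<Longrightarrow> 2 ^ (length (bits k) - 1) \<le> k"
proof (induction k rule: bits.induct)
  case (1 k)
  show ?case
  proof (cases "k div 2 = 0")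
    case True
    then show ?thesis using 1(2) by (simp add: bits.simps[of k] bits.simps[of 0])
  next
    case False
    then have "2 ^ (length (bits (k div 2)) - 1) \<le> k div 2" using 1 by simp
    moreover have "length (bits (k div 2)) > 0" using False by (simp add: bits.simps[of "k div 2"])
    then have "(2::nat) ^ (length (bits k) - 1) = 2 * 2 ^ (length (bits (k div 2)) - 1)"
      using 1(2) by (simp add: bits.simps[of k] flip: power_Suc)
    ultimately show ?thesis by linarith
  qed
qed

lemma double_less_power: "m \<ge> 5 \<Longrightarrow> 2 * m + 3 \<le> 2 ^ m" for m :: nat
  by (induction m rule: nat_induct_at_least) simp_all

text \<open>With q = r div 4k^2 it suffices that r + 2 <= 2^q. Here r + 2 is at most q + 2 times
  4k^2, and the two factors are at most 2^m for m = q div 2 and 2^(2 + 2l). The constant 64 gives q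
  >= 16 l, so that m + 2 + 2l <= q.\<close>

lemma many_variables:
  fixes k r l :: nat
  assumes k: "k < 2 ^ l" and r: "64 * k\<^sup>2 * l < r" and pos: "0 < k"
  shows "(r + 2) ^ (4 * k\<^sup>2) \<le> 2 ^ r"
proof -
  define q where "q = r div (4 * k\<^sup>2)"
  have l: "l \<ge> 1" using k pos by (cases l) auto
  have "(16 * l) * (4 * k\<^sup>2) \<le> r" using r by (simp add: algebra_simps)
  then have q: "16 * l \<le> q" using pos by (simp add: q_def less_eq_div_iff_mult_less_eq)
  have mod: "r mod (4 * k\<^sup>2) < 4 * k\<^sup>2" using pos by simp
  have rem: "q * (4 * k\<^sup>2) \<le> r" "r < (q + 1) * (4 * k\<^sup>2)"
    using mod div_mult_mod_eq[of r "4 * k\<^sup>2"] unfolding q_def add_mult_distrib by linarith+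
  have "k\<^sup>2 \<le> (2 ^ l)\<^sup>2" using k by (intro power_mono) auto
  then have k2: "4 * k\<^sup>2 \<le> 2 ^ (2 + 2 * l)" unfolding power_add power_even_eq by simp
  define m where "m = q div 2"
  have m: "q \<le> 2 * m + 1" "5 \<le> m" "2 + 2 * l + m \<le> q" using q l by (auto simp: m_def)
  have "r + 2 \<le> (q + 2) * (4 * k\<^sup>2)"
  proof -
    have "4 * k\<^sup>2 \<ge> 1" using pos by simp
    then show ?thesis using rem(2) by (simp add: algebra_simps)
  qed
  also have "\<dots> \<le> 2 ^ m * 2 ^ (2 + 2 * l)"
    using double_less_power[OF m(2)] m(1) k2 by (intro mult_le_mono) auto
  also have "\<dots> \<le> 2 ^ q"
    using m(3) unfolding power_add[symmetric] by (intro power_increasing) auto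
  finally have "(r + 2) ^ (4 * k\<^sup>2) \<le> (2 ^ q) ^ (4 * k\<^sup>2)" by (rule power_mono) simp
  also have "\<dots> \<le> 2 ^ r"
    unfolding power_mult[symmetric] using rem(1) by (intro power_increasing) auto
  finally show ?thesis .
qed

lemma length_capped: "length (capped u k) = min (length u) (val k)"
  unfolding capped_def
  by (induction k) auto

lemma length_var_bound:
  "length (var_bound u k) = 64 * (min (length u) (val k))\<^sup>2 * length k"
  by (simp add: var_bound_def length_capped power2_eq_square)

lemma decide_correct:
  assumes S: "S \<in> rows r" "pruned S" and nonzero: "zero r \<notin> fst ` set S"
    and units: "\<forall>j<r. unit r j \<in> fst ` set S" and R: "length R = r"
    and c_def: "c = int (2 * val k)"
  shows "decide ((R, S), k) = ((R, S), k) \<and> r \<le> 64 * (val k)\<^sup>2 * length k \<or>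
    decide ((R, S), k) = (([], []), []) \<and> attains r c S \<or>
    decide ((R, S), k) = (([], []), [True]) \<and> \<not> attains r c S"
proof (cases "r \<le> length (var_bound R k)")
  case True
  then have "r \<le> 64 * (min r (val k))\<^sup>2 * length k" by (simp add: length_var_bound R)
  also have "\<dots> \<le> 64 * (val k)\<^sup>2 * length k" by (intro mult_le_mono power_mono) auto
  finally show ?thesis using True R by (simp add: decide_def)
next
  case False
  define a where "a = search (False # k) S"
  have mean: "mean S = 0" using mean_eq_coef[OF S(1)] coef_eq_0[OF nonzero] by simp
  have c: "c = int (val (False # k))" by (simp add: c_def)
  note search = search_correct[OF S a_def c]
  have yes: "attains r c S" if "fst a \<or> snd a \<noteq> []"
  \<comment> \<open>For \<open>val k = 0\<close> the mean 0 is enough; the case is split off because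
    2k - 1 serves as an exponent below.\<close>
  proof (cases "fst a \<or> val k = 0")
    case True
    then show ?thesis using search(1) attains_mean[OF S(1)] mean by (auto simp: c_def)
  next
    case no: False
    then have k: "0 < val k" "k \<noteq> []" by auto
    have "nat (c - mean S) = 2 * val k" unfolding c_def mean by simp
    then have "length S + 1 \<le> (r + 1) * (r + 2) ^ (2 * val k)"
      using search(3) no that by simp
    also have "\<dots> \<le> (r + 2) ^ (2 * val k + 1)" by simp
    finally have "(length S + 1) ^ (2 * val k - 1) \<le> ((r + 2) ^ (2 * val k + 1)) ^ (2 * val k - 1)"
      by (rule power_mono) simp
    also have "\<dots> < (r + 2) ^ (4 * (val k)\<^sup>2)"
      unfolding power_mult[symmetric]
    proof (rule power_strict_increasing)
      \<comment> \<open>The product of the exponents is 4k^2 - 1.\<close>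
      obtain j where "val k = Suc j" using k(1) gr0_implies_Suc by blast
      then show "(2 * val k + 1) * (2 * val k - 1) < 4 * (val k)\<^sup>2"
        by (simp add: power2_eq_square algebra_simps)
    qed simp
    also have "\<dots> \<le> 2 ^ r"
    proof (rule many_variables[OF val_less_power _ k(1)])
      have r: "r > 64 * (min r (val k))\<^sup>2 * length k"
        using False by (simp add: length_var_bound R)
      \<comment> \<open>The cap is not active here: with \<open>min r (val k) = r\<close> the bound
        would be at least \<open>r\<close>.\<close>
      have "val k < r"
      proof (rule ccontr)
        assume "\<not> ?thesis"
        then have "min r (val k) = r" by simp
        with r have less: "64 * (r * r) * length k < r" by (simp only: power2_eq_square)
        then have "r * 1 \<le> r * r" by (intro mult_le_mono) auto
        then have "r * 1 \<le> 64 * (r * r) * length k"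
          using k(2) by (intro mult_le_mono) (auto simp: Suc_le_eq)
        with less show False by linarith
      qed
      then show "64 * (val k)\<^sup>2 * length k < r" using r by simp
    qed
    finally have "attains r (int (2 * val k - 1 + 1)) S"
      using attains_of_few_rows[OF S nonzero] units by blast
    then show ?thesis using k by (simp add: c_def)
  qed
  have "decide ((R, S), k) = (if fst a \<or> snd a \<noteq> [] then (([], []), []) else (([], []), [True]))"
    using False R by (simp add: decide_def a_def)
  then show ?thesis using yes search(2) by auto
qed

lemma var_bound_asymptotics:
  "(\<lambda>k. real (64 * k\<^sup>2 * length (bits k))) \<in> O(\<lambda>k. real k ^ 2 * ln (real k))"
proof (rule bigoI)
  \<comment> \<open>\<open>bits k\<close> has at most \<open>log 2 k + 1\<close> entries, which is
    at most \<open>2 * log 2 k\<close> from \<open>k = 2\<close> on; this doubles 64 to 128.\<close>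
  show "\<forall>\<^sub>F k in at_top. norm (real (64 * k\<^sup>2 * length (bits k))) \<le>
      (128 / ln 2) * norm (real k ^ 2 * ln (real k))"
    using eventually_ge_at_top[of 2]
  proof eventually_elim
    case (elim k)
    have "real (length (bits k) - 1) \<le> log 2 (real k)"
      using power_length_bits_le[of k] elim by (intro le_log2_of_power) simp
    moreover have "1 \<le> log 2 (real k)" using elim by (simp add: le_log_iff)
    ultimately have "real (length (bits k)) \<le> 2 * log 2 (real k)" by linarith
    then have "64 * (real k)\<^sup>2 * real (length (bits k)) \<le> 64 * (real k)\<^sup>2 * (2 * log 2 (real k))"
      by (intro mult_left_mono) auto
    also have "\<dots> = (128 / ln 2) * (real k ^ 2 * ln (real k))"
      by (simp add: log_def)
    finally show ?case using elim by simp
  qed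
qed

section \<open>Translating instances\<close>

type_synonym code = "(bool list \<times> row list) \<times> bool list"

definition row_of :: "nat \<Rightarrow> equation \<Rightarrow> row" where
  "row_of n e = (map (\<lambda>i. i \<in> lhs e) [1..<Suc n], rhs e = 1, bits (weight e))"

definition code_of :: "maxlin_instance \<Rightarrow> code" where
  "code_of x = ((replicate (num_vars (fst x)) True,
     map (row_of (num_vars (fst x))) (equations (fst x))), bits (snd x))"

definition equation_of :: "row \<Rightarrow> equation" where
  "equation_of t = Equation {i \<in> {1..length (fst t)}. fst t ! (i - 1)} (pm (fst (snd t))) (val
    (snd (snd t)))"

definition instance_of :: "code \<Rightarrow> maxlin_instance" where
  "instance_of c = (LinSystem (length (fst (fst c))) (map equation_of (snd (fst c))), val (snd c))"

text \<open>Leading zeros are excluded because the code would otherwise differ from the encoding of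
  the instance that it denotes.\<close>

definition valid_rows :: "row list \<Rightarrow> bool" where
  "valid_rows S \<longleftrightarrow> (\<forall>w\<in>(\<lambda>t. snd (snd t)) ` set S. bits (val w) = w \<and> 0 < val w)"

definition valid_code :: "code \<Rightarrow> bool" where
  "valid_code c \<longleftrightarrow> (\<exists>n S k. c = ((replicate n True, S), k) \<and> S \<in> rows n \<and> zero n \<notin> fst ` set S \<and>
     valid_rows S \<and> bits (val k) = k)"

lemma enc_list_map: "enc_list f (map g xs) = enc_list (\<lambda>x. f (g x)) xs"
  by (induction xs) auto

lemma enc_row_of: "enc (row_of n e) = enc_equation n e"
  by (simp add: row_of_def enc_equation_def enc_nat_def)

text \<open>The type of codes is chosen so that its generic encoding is literally that of the
  instance; the program for \<open>kernelize\<close> then runs on encoded instances without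
  conversion.\<close>

lemma enc_code_of: "enc (code_of x) = enc_instance x"
  unfolding code_of_def enc_instance_def enc_system_def enc_nat_def
  by (simp add: enc_list_map enc_row_of case_prod_beta del: enc_prod_class map_replicate)
    (simp add: enc_list_map enc_row_of[simplified] case_prod_beta)

lemma row_of_equation_of:
  assumes "length (fst t) = n" "bits (val (snd (snd t))) = snd (snd t)"
  shows "row_of n (equation_of t) = t"
proof -
  have "map (\<lambda>i. i \<in> lhs (equation_of t)) [1..<Suc n] = fst t"
    using assms(1) by (intro nth_equalityI) (auto simp: equation_of_def simp del: upt_Suc)
  then show ?thesis
    using assms(2) by (simp add: row_of_def equation_of_def pm_def prod_eq_iff del: upt_Suc)
qed

lemma code_of_instance_of:
  assumes "valid_code c"
  shows "code_of (instance_of c) = c"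
proof -
  obtain n S k where c: "c = ((replicate n True, S), k)" "S \<in> rows n" "valid_rows S" "bits (val k)
    = k"
    using assms by (auto simp: valid_code_def)
  have "row_of n (equation_of t) = t" if "t \<in> set S" for t
    using row_of_equation_of[OF rows_mem[OF c(2) that]] c(3) that by (simp add: valid_rows_def)
  then have "map (row_of n) (map equation_of S) = S" unfolding map_map comp_def by (rule map_idI)
  then show ?thesis using c(1,4) by (simp add: code_of_def instance_of_def)
qed

lemma enc_instance_of: "valid_code c \<Longrightarrow> enc_instance (instance_of c) = enc c"
  by (metis code_of_instance_of enc_code_of)

lemma equation_of_row_of:
  assumes "lhs e \<subseteq> {1..n}" "rhs e \<in> {-1, 1}"
  shows "equation_of (row_of n e) = e"
proof -
  have "map (\<lambda>i. i \<in> lhs e) [1..<Suc n] ! (i - 1) \<longleftrightarrow> i \<in> lhs e" if "i \<in> {1..n}" for i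
    using that by (auto simp del: upt_Suc)
  then have "{i \<in> {1..n}. map (\<lambda>i. i \<in> lhs e) [1..<Suc n] ! (i - 1)} = lhs e"
    using assms(1) by blast
  then show ?thesis
    using assms(2) by (cases e) (auto simp: equation_of_def row_of_def pm_def simp del: upt_Suc)
qed

lemma maxlin_instancesD:
  assumes "x \<in> maxlin_instances" "e \<in> set (equations (fst x))"
  shows "lhs e \<noteq> {} \<and> lhs e \<subseteq> {1..num_vars (fst x)} \<and> rhs e \<in> {-1, 1} \<and> 0 < weight e"
  using assms unfolding maxlin_instances_def by (cases x) simp

lemma instance_of_code_of:
  assumes "x \<in> maxlin_instances"
  shows "instance_of (code_of x) = x"
proof -
  have "map (\<lambda>e. equation_of (row_of (num_vars (fst x)) e)) (equations (fst x)) = equations (fst x)"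
    using maxlin_instancesD[OF assms] by (intro map_idI equation_of_row_of) blast+
  then show ?thesis
    by (cases x; cases "fst x") (simp add: instance_of_def code_of_def comp_def)
qed

lemma nonzero_row_of:
  assumes "lhs e \<subseteq> {1..n}" "lhs e \<noteq> {}"
  shows "fst (row_of n e) \<noteq> zero n"
proof -
  obtain i where i: "i \<in> lhs e" "1 \<le> i" "i \<le> n" using assms by fastforce
  then have "fst (row_of n e) ! (i - 1)" "\<not> zero n ! (i - 1)"
    by (auto simp: row_of_def simp del: upt_Suc)
  then show ?thesis by metis
qed

lemma valid_code_of:
  assumes "x \<in> maxlin_instances"
  shows "valid_code (code_of x)"
proof -
  let ?n = "num_vars (fst x)" and ?es = "equations (fst x)"
  have e: "lhs e \<noteq> {}" "lhs e \<subseteq> {1..?n}" "0 < weight e" if "e \<in> set ?es" for e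
    using maxlin_instancesD[OF assms that] by blast+
  have "map (row_of ?n) ?es \<in> rows ?n" by (auto simp: rows_def row_of_def)
  moreover have "zero ?n \<notin> fst ` set (map (row_of ?n) ?es)"
    using nonzero_row_of[OF e(2,1)] by auto (metis fst_conv)
  moreover have "valid_rows (map (row_of ?n) ?es)"
    using e(3) by (auto simp: valid_rows_def row_of_def)
  ultimately show ?thesis by (auto simp: valid_code_def code_of_def)
qed

lemma instance_of_valid:
  assumes "valid_code c"
  shows "instance_of c \<in> maxlin_instances"
proof -
  obtain n S k where c: "c = ((replicate n True, S), k)" "S \<in> rows n" "zero n \<notin> fst ` set S"
    "valid_rows S"
    using assms by (auto simp: valid_code_def)
  have "lhs (equation_of t) \<noteq> {} \<and> lhs (equation_of t) \<subseteq> {1..n} \<and> rhs (equation_of t) \<in> {-1, 1} \<and>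
      0 < weight (equation_of t)" if t: "t \<in> set S" for t
  proof -
    have len: "length (fst t) = n" using rows_mem[OF c(2) t] .
    have "fst t \<noteq> zero n" using c(3) t by (metis image_eqI)
    then obtain i where "i < n" "fst t ! i"
      using len not_nonzero_iff[of "fst t"] nonzero_iff[of "fst t"] by auto
    then have "Suc i \<in> lhs (equation_of t)" using len by (simp add: equation_of_def)
    then show ?thesis using c(4) t len by (auto simp: equation_of_def valid_rows_def pm_def)
  qed
  then show ?thesis by (auto simp: maxlin_instances_def instance_of_def c(1))
qed

lemma chi_eq_prod:
  "length u = n \<Longrightarrow> length y = n \<Longrightarrow> chi u y = (\<Prod>i<n. if u ! i \<and> y ! i then -1 else 1)"
proof (induction n arbitrary: u y)
  case (Suc n)
  then obtain a u' b y' where "u = a # u'" "y = b # y'" "length u' = n" "length y' = n"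
    by (metis length_Suc_conv)
  then show ?case using Suc.IH[of u' y'] by (simp add: prod.lessThan_Suc_shift del: prod.lessThan_Suc)
qed simp

text \<open>The bit \<open>True\<close> stands for the value -1, which turns products of variables
  into characters; variable \<open>i\<close> is at position \<open>i - 1\<close>. A row adds its
  weight if satisfied and subtracts it otherwise.\<close>

lemma excess_eq_satisfied_weight:
  assumes S: "S \<in> rows n" and y: "length y = n"
    and x: "\<And>i. i \<in> {1..n} \<Longrightarrow> x i = (if y ! (i - 1) then -1 else 1)"
  shows "2 * int (satisfied_weight (LinSystem n (map equation_of S)) x) -
    int (total_weight (LinSystem n (map equation_of S))) = excess S y"
  using S
proof (induction S)
  case Nil
  then show ?case by (simp add: satisfied_weight_def total_weight_def)
next
  case (Cons t S)
  have len: "length (fst t) = n" using Cons.prems by simp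
  have "(\<Prod>i\<in>{i \<in> {1..n}. fst t ! (i - 1)}. x i) = (\<Prod>i\<in>{1..n}. if fst t ! (i - 1) then x i else 1)"
    by (rule prod.inter_filter) simp
  also have "\<dots> = (\<Prod>i\<in>{1..n}. if fst t ! (i - 1) \<and> y ! (i - 1) then -1 else 1)"
    using x by (intro prod.cong) auto
  also have "\<dots> = (\<Prod>i<n. if fst t ! i \<and> y ! i then -1 else 1)"
    by (rule prod.reindex_bij_witness[of _ Suc "\<lambda>i. i - 1"]) auto
  also have "\<dots> = chi (fst t) y" using chi_eq_prod[OF len y] by simp
  finally have "satisfies x (equation_of t) \<longleftrightarrow> chi (fst t) y = pm (fst (snd t))"
    by (simp add: satisfies_def equation_of_def len)
  then have "satisfies x (equation_of t) \<longleftrightarrow> row_val t y = 1" "row_val t y = 1 \<or> row_val t y = -1"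
    using chi_cases[of "fst t" y] by (auto simp: row_val_def pm_def)
  moreover have "int (weight (equation_of t)) = row_weight t"
    by (simp add: equation_of_def row_weight_def)
  ultimately show ?case
    using Cons by (auto simp: satisfied_weight_def total_weight_def)
qed

lemma yes_iff_attains:
  assumes S: "S \<in> rows n"
  defines "L \<equiv> LinSystem n (map equation_of S)"
  shows "real (sat L) \<ge> real (total_weight L) / 2 + real k \<longleftrightarrow> attains n (int (2 * k)) S"
proof -
  have ge: "real (total_weight L) / 2 + real k \<le> real w \<longleftrightarrow>
      int (2 * k) \<le> 2 * int w - int (total_weight L)" for w
    by linarith
  have "sat L \<in> satisfied_weight L ` assignments L"
    unfolding sat_def using finite_assignments assignments_nonempty by (intro Max_in) auto
  moreover have "satisfied_weight L x \<le> sat L" if "x \<in> assignments L" for x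
    unfolding sat_def using finite_assignments that by (intro Max_ge) auto
  ultimately have "real (sat L) \<ge> real (total_weight L) / 2 + real k \<longleftrightarrow>
      (\<exists>x\<in>assignments L. int (2 * k) \<le> 2 * int (satisfied_weight L x) - int (total_weight L))"
    unfolding ge by (smt (verit) image_iff of_nat_le_iff)
  also have "\<dots> \<longleftrightarrow> attains n (int (2 * k)) S"
    unfolding attains_def
  proof
    assume "\<exists>x\<in>assignments L. int (2 * k) \<le> 2 * int (satisfied_weight L x) - int (total_weight L)"
    then obtain x where x: "x \<in> {1..n} \<rightarrow>\<^sub>E {-1, 1}"
      "int (2 * k) \<le> 2 * int (satisfied_weight L x) - int (total_weight L)"
      by (auto simp: assignments_def L_def)
    define y where "y = map (\<lambda>i. x (Suc i) = -1) [0..<n]"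
    have "x i = (if y ! (i - 1) then -1 else 1)" if "i \<in> {1..n}" for i
      using PiE_mem[OF x(1) that] that by (auto simp: y_def)
    then show "\<exists>y\<in>cube n. int (2 * k) \<le> excess S y"
      using excess_eq_satisfied_weight[OF S, of y x] x(2)
      by (intro bexI[of _ y]) (auto simp: y_def L_def)
  next
    assume "\<exists>y\<in>cube n. int (2 * k) \<le> excess S y"
    then obtain y where y: "length y = n" "int (2 * k) \<le> excess S y" by auto
    define x :: "nat \<Rightarrow> int" where
      "x i = (if i \<in> {1..n} then if y ! (i - 1) then -1 else 1 else undefined)" for i
    have "x \<in> assignments L" by (auto simp: assignments_def L_def x_def)
    then show "\<exists>x\<in>assignments L. int (2 * k) \<le> 2 * int (satisfied_weight L x) - int (total_weight L)"
      using excess_eq_satisfied_weight[OF S y(1), of x] y(2)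
      by (intro bexI[of _ x]) (auto simp: x_def L_def)
  qed
  finally show ?thesis .
qed

lemma instance_of_yes_iff:
  assumes "valid_code ((R, S), k)"
  shows "instance_of ((R, S), k) \<in> maxlin_yes \<longleftrightarrow> attains (length R) (int (2 * val k)) S"
proof -
  have "S \<in> rows (length R)" using assms by (auto simp: valid_code_def)
  from yes_iff_attains[OF this] instance_of_valid[OF assms] show ?thesis
    by (simp add: maxlin_yes_def instance_of_def)
qed

section \<open>The kernel\<close>

text \<open>Elimination leaves the weights alone, so they stay positive and free of leading
  zeros.\<close>

lemma map_snd_pivot: "map snd (pivot d S) = map snd S"
  by (auto simp: pivot_def split: list.splits)

lemma map_snd_gauss: "map snd (gauss ns S) = map snd S"
proof -
  let ?s = "\<lambda>a (_ :: bool). (False # fst a, pivot (fst a) (snd a))"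
  have "map snd (snd (foldl ?s a bs)) = map snd (snd a)" for a bs
    by (induction bs arbitrary: a) (auto simp: map_snd_pivot)
  then show ?thesis by (simp add: gauss_def)
qed

lemma valid_rows_cong: "snd ` set S' \<subseteq> snd ` set S \<Longrightarrow> valid_rows S \<Longrightarrow> valid_rows S'"
  unfolding valid_rows_def by fastforce

text \<open>The \<open>+ 1\<close> covers the constant no-instance, whose parameter is 1, without a
  case distinction on the given parameter.\<close>

lemma kernelize_correct:
  assumes "valid_code c"
  defines "c' \<equiv> kernelize c"
  shows "valid_code c'" "instance_of c' \<in> maxlin_yes \<longleftrightarrow> instance_of c \<in> maxlin_yes"
    "val (snd c') \<le> val (snd c) + 1" "length (fst (fst c')) \<le> 64 * (val (snd c))\<^sup>2 * length (snd c)"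
proof -
  obtain n S k where c: "c = ((replicate n True, S), k)" and S: "S \<in> rows n" "zero n \<notin> fst ` set S"
    "valid_rows S" and k: "bits (val k) = k"
    using assms(1) by (auto simp: valid_code_def)
  let ?ns = "replicate n True"
  define G where "G = gauss ?ns (prune S)"
  obtain R T where RT: "compress ?ns G = (R, T)" by fastforce
  have "equivalent n S n (prune S)"
    using S set_prune_subset[of S] unfolding equivalent_def excess_prune by auto
  then have G: "equivalent n S n G" "\<forall>i<n. unit n i \<in> fst ` set G \<or> (\<forall>u\<in>fst ` set G. \<not> u ! i)"
    using gauss_correct[of ?ns S "prune S"] by (simp_all add: G_def)
  then have T: "R = replicate (length R) True" "equivalent n S (length R) T"
    "\<forall>k<length R. unit (length R) k \<in> fst ` set T" "map snd T = map snd G"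
    using compress_correct[of ?ns S G R T] RT by simp_all
  have "snd ` set T = snd ` set (prune S)"
    using T(4) map_snd_gauss[of ?ns "prune S"] unfolding G_def by (metis list.set_map)
  then have valid_T: "valid_rows T"
    using valid_rows_cong[of T S] S(3) set_prune_subset[of S] by blast
  have T': "T \<in> rows (length R)" "pruned T" "zero (length R) \<notin> fst ` set T"
    using T(2) by (simp_all add: equivalent_def)
  have valid: "valid_code ((R, T), k)"
    using T(1) T' valid_T k unfolding valid_code_def by blast
  have c': "c' = decide ((R, T), k)"
    by (simp add: c'_def kernelize_def c RT flip: G_def)
  have att: "attains (length R) (int (2 * val k)) T \<longleftrightarrow> instance_of c \<in> maxlin_yes"
    using equivalent_attains[OF T(2)] instance_of_yes_iff[of ?ns S k] assms(1) by (simp add: c)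
  have triv: "valid_code (([], []), [])" "valid_code (([], []), [True])"
    by (auto simp: valid_code_def valid_rows_def bits.simps)
  \<comment> \<open>Without equations the excess is 0 at the only point of the cube, so parameter 0
    is reached and parameter 1 is not.\<close>
  have triv_yes: "instance_of (([], []), []) \<in> maxlin_yes" "instance_of (([], []), [True]) \<notin>
    maxlin_yes"
    using instance_of_yes_iff[OF triv(1)] instance_of_yes_iff[OF triv(2)]
    by (auto simp: attains_def intro: exI[of _ "[]"])
  from decide_correct[OF T' T(3) refl refl, of k] consider
    "c' = ((R, T), k)" "length R \<le> 64 * (val k)\<^sup>2 * length k"
    | "c' = (([], []), [])" "instance_of c \<in> maxlin_yes"
    | "c' = (([], []), [True])" "instance_of c \<notin> maxlin_yes"
    unfolding c' att by blast
  then have "valid_code c' \<and> (instance_of c' \<in> maxlin_yes \<longleftrightarrow> instance_of c \<in> maxlin_yes) \<and>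
    val (snd c') \<le> val (snd c) + 1 \<and> length (fst (fst c')) \<le> 64 * (val (snd c))\<^sup>2 * length (snd c)"
  proof cases
    case 1
    then show ?thesis using valid instance_of_yes_iff[OF valid] att by (simp add: c)
  qed (use triv triv_yes in \<open>simp_all add: c\<close>)
  then show "valid_code c'" "instance_of c' \<in> maxlin_yes \<longleftrightarrow> instance_of c \<in> maxlin_yes"
    "val (snd c') \<le> val (snd c) + 1" "length (fst (fst c')) \<le> 64 * (val (snd c))\<^sup>2 * length (snd c)"
    by blast+
qed

lemma polytime_kernel:
  "polytime_computable enc_instance enc_instance maxlin_instances (\<lambda>x. instance_of (kernelize
    (code_of x)))"
proof -
  obtain P e and p :: "nat poly" where run: "\<And>x. \<exists>t. eval P [enc x] e (enc (kernelize x)) t \<and> t \<le>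
    poly p (len x)"
    using poly_time_kernelize unfolding polytime_computable_iff_poly_time[symmetric]
      polytime_computable_def
    by blast
  show ?thesis
    unfolding polytime_computable_def
  proof (rule exI[of _ P], rule exI[of _ e], rule exI[of _ p], rule ballI)
    fix x assume "x \<in> maxlin_instances"
    then show "\<exists>t. eval P [enc_instance x] e (enc_instance (instance_of (kernelize (code_of x)))) t \<and>
        t \<le> poly p (size (enc_instance x))"
      using run[of "code_of x"] enc_instance_of[OF kernelize_correct(1)[OF valid_code_of]]
      by (simp only: enc_code_of)
  qed
qed

theorem theorem3:
  shows "\<exists>(K :: maxlin_instance \<Rightarrow> maxlin_instance) (h :: nat \<Rightarrow> nat) (g :: nat \<Rightarrow> real).
    polytime_computable enc_instance enc_instance maxlin_instances K \<and>
    g \<in> O(\<lambda>k. real k ^ 2 * ln (real k)) \<and>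
    (\<forall>S k S' k'. (S, k) \<in> maxlin_instances \<longrightarrow> K (S, k) = (S', k') \<longrightarrow>
       (S', k') \<in> maxlin_instances \<and>
       ((S, k) \<in> maxlin_yes \<longleftrightarrow> (S', k') \<in> maxlin_yes) \<and>
       k' \<le> h k \<and>
       real (num_vars S') \<le> g k)"
\<comment> \<open>The witnesses are fixed by unification with the facts shown; \<open>h k\<close>
  becomes \<open>k + 1\<close>.\<close>
proof (intro exI conjI allI impI)
  show "polytime_computable enc_instance enc_instance maxlin_instances
      (\<lambda>x. instance_of (kernelize (code_of x)))"
    by (rule polytime_kernel)
  show "(\<lambda>k. real (64 * k\<^sup>2 * length (bits k))) \<in> O(\<lambda>k. real k ^ 2 * ln (real k))"
    by (rule var_bound_asymptotics)
  fix S k S' k'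
  assume x: "(S, k) \<in> maxlin_instances" and eq: "instance_of (kernelize (code_of (S, k))) = (S', k')"
  note * = kernelize_correct[OF valid_code_of[OF x]]
  show "(S', k') \<in> maxlin_instances" using instance_of_valid[OF *(1)] eq by simp
  show "(S, k) \<in> maxlin_yes \<longleftrightarrow> (S', k') \<in> maxlin_yes"
    using *(2) eq instance_of_code_of[OF x] by simp
  have "k' = val (snd (kernelize (code_of (S, k))))"
    "num_vars S' = length (fst (fst (kernelize (code_of (S, k)))))"
    using eq by (auto simp: instance_of_def)
  moreover have "snd (code_of (S, k)) = bits k" by (simp add: code_of_def)
  ultimately have "k' \<le> k + 1" "num_vars S' \<le> 64 * k\<^sup>2 * length (bits k)"
    using *(3,4) by simp_all
  then show "k' \<le> k + 1" "real (num_vars S') \<le> real (64 * k\<^sup>2 * length (bits k))"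
    by (simp_all only: of_nat_le_iff)
qed

end
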